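(* For every $r\ge 3$ and $\ell\ge 2$ there exists a constant $C$ such that if $G$ is an $n$-vertex $r$-graph with $e(G)\ge n^{r-1}(\log n)^{C}$, then, as $n\to\infty$, $G$ contains at least \[ n^{(r-1)(2\ell+1)-o(1)}\left(\frac{e(G)}{n^{r}}\right)^{2\ell+1+\frac{4\ell-1}{(r-1)(2\ell+1)-3}} \] copies of $C^r_{2\ell+1}$. As a consequence, \[ s(C^r_{2\ell+1})\le \frac{4\ell-1}{(r-1)(2\ell+1)-3}. \]
   Context: An $r$-graph is an $r$-uniform hypergraph; $v(F)$, $e(F)$ denote the numbers of vertices and edges. The $r$-uniform linear cycle of length $k$, $C^r_{k}$, is the $r$-graph with $k$ edges $e_1,\dots,e_k$ where $e_i=\{v_{(r-1)(i-1)},\dots,v_{(r-1)i}\}$ (with $v_0=v_{(r-1)k}$). A copy of $F$ in $G$ is a subgraph of $G$ isomorphic to $F$. A homomorphism from $F$ to $H$ is a map $\phi:V(F)\to V(H)$ sending edges to edges; $\hom(F,H)$ is their number and $t_F(H)=\hom(F,H)/v(H)^{v(F)}$. $K^r_r$ is the $r$-graph with a single edge. For an $r$-partite $r$-graph $F$, $s(F)=\sup\{s:\exists H,\ t_F(H)=t_{K^r_r}(H)^{s+e(F)}>0\}$. $o(1)$ denotes a function tending to $0$ as $n\to\infty$. *)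

theory Defs
  imports Complex_Main "HOL-Library.FuncSet" "HOL-Library.Extended_Real"
begin

datatype 'a hypergraph = Hypergraph (verts: "'a set") (edges: "'a set set")

definition rgraph :: "nat \<Rightarrow> 'a hypergraph \<Rightarrow> bool" where
  "rgraph r G \<longleftrightarrow> finite (verts G) \<and> (\<forall>e \<in> edges G. e \<subseteq> verts G \<and> card e = r)"

definition subgraph :: "'a hypergraph \<Rightarrow> 'a hypergraph \<Rightarrow> bool" where
  "subgraph S G \<longleftrightarrow> verts S \<subseteq> verts G \<and> edges S \<subseteq> edges G"

definition isomorphic :: "'a hypergraph \<Rightarrow> 'b hypergraph \<Rightarrow> bool" where
  "isomorphic F S \<longleftrightarrow>
     (\<exists>f. bij_betw f (verts F) (verts S) \<and> edges S = (\<lambda>e. f ` e) ` edges F)"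

definition copies :: "'a hypergraph \<Rightarrow> 'b hypergraph \<Rightarrow> 'b hypergraph set" where
  "copies F G = {S. subgraph S G \<and> isomorphic F S}"

definition homs :: "'a hypergraph \<Rightarrow> 'b hypergraph \<Rightarrow> ('a \<Rightarrow> 'b) set" where
  "homs F H = {\<phi> \<in> verts F \<rightarrow>\<^sub>E verts H. \<forall>e \<in> edges F. \<phi> ` e \<in> edges H}"

definition hom_density :: "'a hypergraph \<Rightarrow> 'b hypergraph \<Rightarrow> real" where
  "hom_density F H = real (card (homs F H)) / real (card (verts H)) ^ card (verts F)"

definition single_edge :: "nat \<Rightarrow> nat hypergraph" where
  "single_edge r = Hypergraph {..<r} {{..<r}}"

text \<open>The vertex \<open>v\<^sub>j\<close> is the residue of \<open>j\<close> modulo \<open>(r - 1) k\<close>, so that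
  \<open>v\<^sub>0\<close> coincides with the last vertex of the \<open>k\<close>-th edge.\<close>

definition linear_cycle :: "nat \<Rightarrow> nat \<Rightarrow> nat hypergraph" where
  "linear_cycle r k = Hypergraph {..<(r - 1) * k}
     ((\<lambda>i. (\<lambda>j. j mod ((r - 1) * k)) ` {(r - 1) * (i - 1)..(r - 1) * i}) ` {1..k})"

text \<open>The parameter \<open>s(F)\<close>, meant for \<open>r\<close>-partite \<open>r\<close>-graphs \<open>F\<close>. The supremum is taken in the
  extended reals, so that no boundedness of the set is presupposed. Taking the vertices of
  \<open>H\<close> to be natural numbers loses no generality, since \<open>H\<close> is finite.\<close>

definition sidorenko_gap :: "nat \<Rightarrow> 'a hypergraph \<Rightarrow> ereal" where
  "sidorenko_gap r F = Sup {ereal s | s. \<exists>H :: nat hypergraph. rgraph r H \<and>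
     hom_density F H = hom_density (single_edge r) H powr (s + real (card (edges F))) \<and>
     hom_density F H > 0}"

end

theory Submission
  imports Defs
begin

text \<open>
  The proof gives the exponent \<open>x = 1 / (r - 2)\<close>, which is at most the required one since
  \<open>(2 l - 2) (r - 3) \<ge> 0\<close>.

  By dyadic pigeonholing and cleaning, the ordered edges of \<open>G\<close> contain a subsystem \<open>T\<close> that is only
  polylogarithmically smaller and in which, for every set \<open>A\<close> of coordinates, all fibres over \<open>A\<close>
  have size \<open>D A\<close> up to a polylogarithmic factor. A linear cycle arises from a closed walk of joint
  vertices by choosing edges through consecutive pairs, and the hypothesis on the number of edges
  ensures that these can be chosen to avoid any bounded set of vertices. Let \<open>{a, b}\<close> minimise
  \<open>D {a, b} = P\<close> over pairs and let \<open>c\<close> minimise \<open>D {a, b, c}\<close>; since the fibre of a pair is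
  contained in a product of \<open>r - 2\<close> extension sets, \<open>P / D {a, b, c}\<close> is at least about \<open>P\<close> to the
  power \<open>x\<close>. If the graph of \<open>ab\<close>-pairs has degrees well above \<open>\<surd>n\<close>, a Cauchy--Schwarz count of
  its cycles of length \<open>2 l\<close>, with one edge rerouted through part \<open>c\<close>, suffices. Otherwise \<open>P\<close> is so
  large that a greedy count of triangulated cycles (fans) suffices.

  The bound on the Sidorenko gap follows by applying the count to blown-up tensor powers of \<open>H\<close>:
  densities are multiplicative, so the factor \<open>n\<close> to the power \<open>o(1)\<close> disappears in the limit.
\<close>

section \<open>Counting sequences chosen one entry at a time\<close>

text \<open>The exponents come from the following account, in which polylogarithmic factors are
  dropped, m is the number of tuples, Q = \<open>D {a, b, c}\<close> and k = 2l+1. By minimality of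
  P every joint pair lies in at least P edges, so a cycle of joint vertices yields P^k copies; the
  target is m^(k+x) / n^(2l+2+2x). The graph of \<open>ab\<close>-pairs is bipartite, so an odd
  cycle has to leave it: this forces the detour through part c, which offers P/Q \<ge> P^x choices.
  With degrees \<delta> = m/(nP) there are \<delta>^(2l) closed walks of length 2l, and
  \<delta>^(2l) P^(k+x) = (m/n)^(2l) P^(1+x) reaches the target because P \<ge> m/n^2 always holds.
  The obstacle is degenerate walks: if \<Delta> paths start at a vertex, two given ends are joined
  by \<Delta>/n paths on average, whereas those through a prescribed inner vertex are only bounded
  by \<Delta>/\<delta>^2, so \<delta>^2 must beat n. If it does not, then P \<ge> m/n^(3/2), and the
  fans give (m/P) (P/Q)^(2l-1) P^k copies, which suffices because m \<ge> n^(r-1) =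
  n^(1+1/x).\<close>

definition greedy :: "('a list \<Rightarrow> 'a set) \<Rightarrow> nat \<Rightarrow> 'a list set" where
  "greedy S k = {xs. length xs = k \<and> (\<forall>j<k. xs ! j \<in> S (take j xs))}"

lemma greedyD:
  assumes "xs \<in> greedy S k"
  shows "length xs = k" "\<And>j. j < k \<Longrightarrow> xs ! j \<in> S (take j xs)"
  using assms by (auto simp: greedy_def)

lemma greedy_0 [simp]: "greedy S 0 = {[]}"
  by (auto simp: greedy_def)

lemma greedy_Suc: "greedy S (Suc k) = (\<lambda>(xs, x). xs @ [x]) ` (SIGMA xs:greedy S k. S xs)"
proof (intro set_eqI iffI)
  fix ys assume ys: "ys \<in> greedy S (Suc k)"
  define xs where "xs = take k ys"
  have len: "length ys = Suc k" using greedyD(1)[OF ys] .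
  have "ys = xs @ [ys ! k]"
    using len take_Suc_conv_app_nth[of k ys] by (simp add: xs_def)
  moreover have "xs \<in> greedy S k"
    using greedyD[OF ys] by (auto simp: greedy_def xs_def min_def)
  moreover have "ys ! k \<in> S xs" using greedyD(2)[OF ys, of k] by (simp add: xs_def)
  ultimately show "ys \<in> (\<lambda>(xs, x). xs @ [x]) ` (SIGMA xs:greedy S k. S xs)"
    by (intro image_eqI[of _ _ "(xs, ys ! k)"]) auto
next
  fix ys assume "ys \<in> (\<lambda>(xs, x). xs @ [x]) ` (SIGMA xs:greedy S k. S xs)"
  then obtain xs x where *: "ys = xs @ [x]" "xs \<in> greedy S k" "x \<in> S xs" by auto
  then show "ys \<in> greedy S (Suc k)"
    using greedyD[OF *(2)] by (auto simp: greedy_def nth_append less_Suc_eq)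
qed

lemma card_greedy_Suc:
  assumes "finite (greedy S k)" "\<And>xs. xs \<in> greedy S k \<Longrightarrow> finite (S xs)"
  shows "finite (greedy S (Suc k))" "card (greedy S (Suc k)) = (\<Sum>xs\<in>greedy S k. card (S xs))"
proof -
  show "finite (greedy S (Suc k))" unfolding greedy_Suc using assms by auto
  have "inj_on (\<lambda>(xs, x). xs @ [x]) (SIGMA xs:greedy S k. S xs)" by (auto simp: inj_on_def)
  then show "card (greedy S (Suc k)) = (\<Sum>xs\<in>greedy S k. card (S xs))"
    unfolding greedy_Suc using assms by (simp add: card_image)
qed

lemma finite_greedy:
  assumes "\<And>j xs. j < k \<Longrightarrow> xs \<in> greedy S j \<Longrightarrow> finite (S xs)"
  shows "finite (greedy S k)"
  using assms
proof (induction k)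
  case (Suc k)
  have "finite (greedy S k)" by (rule Suc.IH) (rule Suc.prems[OF less_SucI])
  then show ?case by (rule card_greedy_Suc(1)) (rule Suc.prems[OF lessI])
qed simp

text \<open>The number of choices is bounded only after prefixes that are themselves greedy, so an
  application may exploit everything the earlier choices guarantee, such as a tuple through the last
  vertex.\<close>

lemma greedy_lower:
  fixes m :: "nat \<Rightarrow> real"
  assumes "\<And>j xs. j < k \<Longrightarrow> xs \<in> greedy S j \<Longrightarrow> finite (S xs)"
    and "\<And>j xs. j < k \<Longrightarrow> xs \<in> greedy S j \<Longrightarrow> m j \<le> card (S xs)"
    and "\<And>j. j < k \<Longrightarrow> 0 \<le> m j"
  shows "(\<Prod>j<k. m j) \<le> card (greedy S k)"
  using assms
proof (induction k)
  case (Suc k)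
  have fin: "finite (greedy S k)" by (rule finite_greedy) (rule Suc.prems(1)[OF less_SucI])
  have IH: "(\<Prod>j<k. m j) \<le> card (greedy S k)"
    by (rule Suc.IH) (blast intro: Suc.prems less_SucI)+
  have "(\<Prod>j<Suc k. m j) \<le> card (greedy S k) * m k"
    using IH Suc.prems(3)[of k] by (simp add: mult_right_mono)
  also have "\<dots> = (\<Sum>xs\<in>greedy S k. m k)" by simp
  also have "\<dots> \<le> (\<Sum>xs\<in>greedy S k. real (card (S xs)))"
    by (rule sum_mono) (use Suc.prems(2) in auto)
  also have "\<dots> = card (greedy S (Suc k))"
    by (subst card_greedy_Suc(2)[OF fin Suc.prems(1)[OF lessI]]) simp_all
  finally show ?case .
qed simp

lemma greedy_upper:
  fixes m :: "nat \<Rightarrow> real"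
  assumes "\<And>j xs. j < k \<Longrightarrow> xs \<in> greedy S j \<Longrightarrow> finite (S xs)"
    and "\<And>j xs. j < k \<Longrightarrow> xs \<in> greedy S j \<Longrightarrow> card (S xs) \<le> m j"
    and "\<And>j. j < k \<Longrightarrow> 0 \<le> m j"
  shows "card (greedy S k) \<le> (\<Prod>j<k. m j)"
  using assms
proof (induction k)
  case (Suc k)
  have fin: "finite (greedy S k)" by (rule finite_greedy) (rule Suc.prems(1)[OF less_SucI])
  have IH: "card (greedy S k) \<le> (\<Prod>j<k. m j)"
    by (rule Suc.IH) (blast intro: Suc.prems less_SucI)+
  have "real (card (greedy S (Suc k))) = (\<Sum>xs\<in>greedy S k. real (card (S xs)))"
    by (subst card_greedy_Suc(2)[OF fin Suc.prems(1)[OF lessI]]) simp_all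
  also have "\<dots> \<le> (\<Sum>xs\<in>greedy S k. m k)"
    by (rule sum_mono) (use Suc.prems(2) in auto)
  also have "\<dots> = card (greedy S k) * m k" by simp
  also have "\<dots> \<le> (\<Prod>j<Suc k. m j)"
    using IH Suc.prems(3)[of k] by (simp add: mult_right_mono)
  finally show ?case .
qed simp

section \<open>Regular systems of tuples\<close>

lemma pigeonhole_fibre:
  assumes "finite T" "f ` T \<subseteq> C" "finite C" "T \<noteq> {}"
  shows "\<exists>c\<in>C. card T \<le> card C * card {t \<in> T. f t = c}"
proof (rule ccontr)
  assume neg: "\<not> ?thesis"
  have "C \<noteq> {}" using assms by auto
  have "card T = (\<Sum>c\<in>C. card {t \<in> T. f t = c})"
    using sum.group[OF assms(1,3,2), of "\<lambda>_. 1::nat"] by simp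
  then have "card C * card T = (\<Sum>c\<in>C. card C * card {t \<in> T. f t = c})"
    by (simp add: sum_distrib_left)
  also have "\<dots> < (\<Sum>c\<in>C. card T)"
    by (rule sum_strict_mono) (use neg \<open>C \<noteq> {}\<close> assms in \<open>auto simp: not_le\<close>)
  finally show False by simp
qed

definition fibre :: "('i \<Rightarrow> 'a) set \<Rightarrow> 'i set \<Rightarrow> ('i \<Rightarrow> 'a) \<Rightarrow> ('i \<Rightarrow> 'a) set" where
  "fibre T A t = {y \<in> T. \<forall>i\<in>A. y i = t i}"

definition ext :: "('i \<Rightarrow> 'a) set \<Rightarrow> 'i set \<Rightarrow> 'i \<Rightarrow> ('i \<Rightarrow> 'a) \<Rightarrow> 'a set" where
  "ext T A c t = (\<lambda>y. y c) ` fibre T A t"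

lemma fibre_eq_restrict: "fibre T A t = {y \<in> T. restrict y A = restrict t A}"
  unfolding fibre_def restrict_def fun_eq_iff by metis

text \<open>Working with ordered tuples makes the hypergraph r-partite without choosing a partition:
  a coordinate plays the role of a part, although all coordinates share the vertex set
  \<open>V\<close>. The price is that vertices in different parts may coincide, so distinctness has
  to be arranged by hand. Fibres are taken only at members of \<open>T\<close>, so
  \<open>D A\<close> is the size of the nonempty fibres over \<open>A\<close>, up to the factor
  \<open>L\<close>.\<close>

locale regular_tuples =
  fixes r :: nat and V :: "'a set" and T :: "(nat \<Rightarrow> 'a) set"
    and D :: "nat set \<Rightarrow> real" and L :: real
  assumes finite_V: "finite V"
    and T_PiE: "T \<subseteq> {..<r} \<rightarrow>\<^sub>E V"
    and T_inj: "\<And>t. t \<in> T \<Longrightarrow> inj_on t {..<r}"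
    and T_nonempty: "T \<noteq> {}"
    and L_ge_1: "1 \<le> L"
    and fibre_upper: "\<And>t A. t \<in> T \<Longrightarrow> A \<subseteq> {..<r} \<Longrightarrow> card (fibre T A t) \<le> D A"
    and fibre_lower: "\<And>t A. t \<in> T \<Longrightarrow> A \<subseteq> {..<r} \<Longrightarrow> D A \<le> L * card (fibre T A t)"

text \<open>A subset maximising the number of tuples minus a penalty \<open>w A\<close> for each occupied
  fibre over \<open>A\<close> has no fibre smaller than its penalty: deleting that fibre would pay off.\<close>

lemma exists_subset_large_fibres:
  fixes w :: "nat set \<Rightarrow> real" and T :: "(nat \<Rightarrow> 'a) set"
  assumes fin: "finite T" "finite \<A>" and w: "\<And>A. A \<in> \<A> \<Longrightarrow> 0 \<le> w A"
    and small: "(\<Sum>A\<in>\<A>. card ((\<lambda>t. restrict t A) ` T) * w A) \<le> card T / 2"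
  shows "\<exists>S\<subseteq>T. card T / 2 \<le> card S \<and> (\<forall>t\<in>S. \<forall>A\<in>\<A>. w A \<le> card (fibre S A t))"
proof -
  define \<Phi> :: "(nat \<Rightarrow> 'a) set \<Rightarrow> real" where "\<Phi> S = card S - (\<Sum>A\<in>\<A>. card ((\<lambda>t. restrict t A) ` S) * w A)" for S
  have finP: "finite (Pow T)" "Pow T \<noteq> {}" using fin by auto
  define m where "m = Max (\<Phi> ` Pow T)"
  have "m \<in> \<Phi> ` Pow T" unfolding m_def using finP by (intro Max_in) auto
  then obtain S where S: "S \<subseteq> T" "\<Phi> S = m" by auto
  have max: "\<Phi> S' \<le> \<Phi> S" if "S' \<subseteq> T" for S'
    unfolding S(2) m_def using finP that by (intro Max_ge) auto
  have finS: "finite S" using S fin finite_subset by blast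
  have "card T / 2 \<le> \<Phi> T" unfolding \<Phi>_def using small by linarith
  also have "\<dots> \<le> \<Phi> S" by (rule max) simp
  also have "\<dots> \<le> card S" unfolding \<Phi>_def using w by (simp add: sum_nonneg)
  finally have 1: "card T / 2 \<le> card S" .
  have 2: "w A \<le> card (fibre S A t)" if t: "t \<in> S" and A: "A \<in> \<A>" for t A
  proof (rule ccontr)
    assume neg: "\<not> w A \<le> card (fibre S A t)"
    define S' where "S' = S - fibre S A t"
    have cS': "real (card S') = card S - card (fibre S A t)"
    proof -
      have "fibre S A t \<subseteq> S" by (auto simp: fibre_def)
      then show ?thesis unfolding S'_def using finS
        by (simp add: card_Diff_subset finite_subset card_mono of_nat_diff)
    qed
    have le: "card ((\<lambda>t. restrict t B) ` S') \<le> card ((\<lambda>t. restrict t B) ` S)" for B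
      by (rule card_mono) (use finS in \<open>auto simp: S'_def\<close>)
    have "restrict t A \<notin> (\<lambda>t. restrict t A) ` S'"
      by (auto simp: S'_def fibre_eq_restrict)
    moreover have "(\<lambda>t. restrict t A) ` S' \<subseteq> (\<lambda>t. restrict t A) ` S" by (auto simp: S'_def)
    ultimately have "(\<lambda>t. restrict t A) ` S' \<subset> (\<lambda>t. restrict t A) ` S" using t by blast
    then have lt: "card ((\<lambda>t. restrict t A) ` S') + 1 \<le> card ((\<lambda>t. restrict t A) ` S)"
      using finS psubset_card_mono[of "(\<lambda>t. restrict t A) ` S"] by (simp add: Suc_le_eq)
    have "(\<Sum>B\<in>\<A>. card ((\<lambda>t. restrict t B) ` S') * w B) + w A
        = (\<Sum>B\<in>\<A>. card ((\<lambda>t. restrict t B) ` S') * w B + (if B = A then w A else 0))"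
      using A fin by (simp add: sum.distrib)
    also have "\<dots> \<le> (\<Sum>B\<in>\<A>. card ((\<lambda>t. restrict t B) ` S) * w B)"
    proof (rule sum_mono)
      fix B assume B: "B \<in> \<A>"
      have "card ((\<lambda>t. restrict t B) ` S') * w B + (if B = A then w A else 0)
         = (card ((\<lambda>t. restrict t B) ` S') + (if B = A then 1 else 0)) * w B"
        by (simp add: algebra_simps)
      also have "\<dots> \<le> card ((\<lambda>t. restrict t B) ` S) * w B"
        using le[of B] lt w[OF B] by (intro mult_right_mono) auto
      finally show "card ((\<lambda>t. restrict t B) ` S') * w B + (if B = A then w A else 0)
        \<le> card ((\<lambda>t. restrict t B) ` S) * w B" .
    qed
    finally have "\<Phi> S < \<Phi> S'" unfolding \<Phi>_def using cS' neg by linarith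
    moreover have "S' \<subseteq> T" using S by (auto simp: S'_def)
    ultimately show False using max[of S'] by linarith
  qed
  show ?thesis by (rule exI[of _ S]) (intro conjI ballI S(1) 1 2)
qed

text \<open>A tuple is classified by the dyadic sizes of its 2^r fibres. Sizes are at most n^r,
  which leaves (J + 1)^(2^r) classes, and a largest class \<open>T1\<close> is kept. The upper
  bounds survive every deletion, but passing to \<open>T1\<close> may have shrunk fibres; cleaning
  with the penalty \<open>D A / L\<close> restores the lower bounds.\<close>

lemma exists_regular_subsystem:
  fixes V :: "'a set" and n r :: nat and L :: real
  assumes fin: "finite V" and cV: "card V = n" "n \<ge> 1"
    and T: "T \<subseteq> {..<r} \<rightarrow>\<^sub>E V" "\<And>t. t \<in> T \<Longrightarrow> inj_on t {..<r}" "T \<noteq> {}"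
  defines "L \<equiv> 2 ^ (r + 2) * (r * log 2 n + 1) ^ (2 ^ r)"
  shows "\<exists>S D. S \<subseteq> T \<and> card T \<le> L * card S \<and> regular_tuples r V S D L"
proof -
  have finT: "finite T" using T(1) fin by (meson finite_PiE finite_lessThan finite_subset)
  define J where "J = nat \<lfloor>r * log 2 n\<rfloor>"
  have log_nn: "0 \<le> r * log 2 n" using cV by auto
  define R where "R = (J + 1) ^ (2 ^ r)"
  have RJ: "real R \<le> (r * log 2 n + 1) ^ (2 ^ r)"
    unfolding R_def J_def using log_nn by (auto intro!: power_mono)
  have R1: "1 \<le> R" by (simp add: R_def)
  define cls where "cls t A = nat \<lfloor>log 2 (card (fibre T A t))\<rfloor>" for t A
  have finf: "finite (fibre T A t)" for A t using finT by (simp add: fibre_def)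
  have cls_bounds: "2 ^ cls t A \<le> card (fibre T A t)" "card (fibre T A t) < 2 ^ (cls t A + 1)"
    "cls t A \<le> J" if "t \<in> T" for t A
  proof -
    have "t \<in> fibre T A t" using that by (simp add: fibre_def)
    then have pos: "1 \<le> card (fibre T A t)"
      using finf by (metis One_nat_def Suc_leI card_gt_0_iff empty_iff)
    then have lnn: "0 \<le> log 2 (card (fibre T A t))" by simp
    have le: "real (cls t A) \<le> log 2 (card (fibre T A t))"
      unfolding cls_def using lnn by linarith
    have gt: "log 2 (card (fibre T A t)) < real (cls t A + 1)"
      unfolding cls_def using lnn by linarith
    have e: "2 powr log 2 (card (fibre T A t)) = card (fibre T A t)" using pos by simp
    have "2 powr real (cls t A) \<le> 2 powr log 2 (card (fibre T A t))" using le by simp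
    then have "real (2 ^ cls t A) \<le> card (fibre T A t)" using e by (simp add: powr_realpow)
    then show "2 ^ cls t A \<le> card (fibre T A t)" by linarith
    have "2 powr log 2 (card (fibre T A t)) < 2 powr real (cls t A + 1)" using gt by simp
    then have "real (card (fibre T A t)) < real (2 ^ (cls t A + 1))"
      using e powr_realpow[of 2 "cls t A + 1"] by simp
    then show "card (fibre T A t) < 2 ^ (cls t A + 1)" by linarith
    have "card (fibre T A t) \<le> card ({..<r} \<rightarrow>\<^sub>E V)"
      using T(1) fin by (intro card_mono) (auto simp: fibre_def intro: finite_PiE)
    also have "\<dots> = n ^ r" using cV by (simp add: card_PiE)
    finally have "real (card (fibre T A t)) \<le> real (n ^ r)" by (rule of_nat_mono)
    then have "log 2 (card (fibre T A t)) \<le> log 2 (real n ^ r)"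
      using pos by (intro log_mono) auto
    also have "\<dots> = r * log 2 n" using cV by (simp add: log_nat_power)
    finally show "cls t A \<le> J" unfolding J_def using lnn by (simp add: cls_def floor_mono nat_mono)
  qed
  define C where "C = Pow {..<r} \<rightarrow>\<^sub>E {..J}"
  have "finite C" unfolding C_def by (intro finite_PiE) auto
  have "card C = R" unfolding C_def R_def by (simp add: card_PiE card_Pow)
  have "(\<lambda>t. restrict (cls t) (Pow {..<r})) ` T \<subseteq> C"
    unfolding C_def using cls_bounds(3) by (intro image_subsetI PiE_I) auto
  from pigeonhole_fibre[OF finT this \<open>finite C\<close> T(3)]
  obtain f where f: "f \<in> C"
    "card T \<le> card C * card {t \<in> T. restrict (cls t) (Pow {..<r}) = f}" by blast
  define T1 where "T1 = {t \<in> T. restrict (cls t) (Pow {..<r}) = f}"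
  have T1: "card T \<le> R * card T1" using f(2) \<open>card C = R\<close> by (simp add: T1_def)
  have T1T: "T1 \<subseteq> T" by (auto simp: T1_def)
  have finT1: "finite T1" using T1T finT finite_subset by blast
  have cls_f: "cls t A = f A" if "t \<in> T1" "A \<in> Pow {..<r}" for t A
  proof -
    have "restrict (cls t) (Pow {..<r}) A = f A" using that(1) by (simp add: T1_def)
    then show ?thesis using that(2) by simp
  qed
  define D where "D A = (2::real) ^ (f A + 1)" for A
  have Lnn: "0 < L" unfolding L_def using log_nn by (intro mult_pos_pos zero_less_power) auto
  \<comment> \<open>The factor 2^(r + 2) pays for the 2^r coordinate sets, for the dyadic rounding
    in \<open>D\<close>, and for keeping half of \<open>T1\<close>.\<close>
  have L_R: "2 ^ (r + 2) * real R \<le> L" unfolding L_def using RJ by (intro mult_left_mono) auto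
  have small: "(\<Sum>A\<in>Pow {..<r}. card ((\<lambda>t. restrict t A) ` T1) * (D A / L)) \<le> card T1 / 2"
  proof -
    have "card ((\<lambda>t. restrict t A) ` T1) * (D A / L) \<le> card T1 / 2 / 2 ^ r"
      if A: "A \<in> Pow {..<r}" for A
    proof -
      define X where "X = (\<lambda>t. restrict t A) ` T1"
      have finX: "finite X" using finT1 by (simp add: X_def)
      \<comment> \<open>The fibres are counted in \<open>T\<close>, where their sizes are known.
        They are disjoint, so 2^(f A) times their number is at most \<open>card T\<close>, hence at
        most \<open>R * card T1\<close>.\<close>
      have "real (card X) * 2 ^ f A = (\<Sum>s\<in>X. 2 ^ f A)" by simp
      also have "\<dots> \<le> (\<Sum>s\<in>X. real (card {y \<in> T. restrict y A = s}))"
      proof (rule sum_mono)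
        fix s assume "s \<in> X"
        then obtain t where t: "t \<in> T1" "s = restrict t A" by (auto simp: X_def)
        have "2 ^ cls t A \<le> card (fibre T A t)" using cls_bounds t T1T by blast
        then have "2 ^ f A \<le> card {y \<in> T. restrict y A = s}"
          using cls_f[OF t(1) A] t(2) by (simp add: fibre_eq_restrict)
        then show "2 ^ f A \<le> real (card {y \<in> T. restrict y A = s})"
          by (metis of_nat_le_iff of_nat_numeral of_nat_power)
      qed
      also have "\<dots> = real (card (\<Union>s\<in>X. {y \<in> T. restrict y A = s}))"
        using finX finT by (subst card_UN_disjoint) auto
      also have "\<dots> \<le> card T" using finT by (intro of_nat_mono card_mono) auto
      also have "\<dots> \<le> R * card T1" using of_nat_mono[OF T1, where 'a = real] by simp
      finally have "real (card X) * D A \<le> 2 * R * card T1" by (simp add: D_def)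
      then have "real (card X) * (D A / L) \<le> 2 * R * card T1 / L"
        using Lnn by (simp add: divide_right_mono)
      also have "\<dots> \<le> card T1 / 2 / 2 ^ r"
      proof -
        have "(2 ^ (r + 2) * real R) * card T1 \<le> L * card T1" using L_R by (rule mult_right_mono) simp
        then show ?thesis using Lnn by (simp add: field_simps)
      qed
      finally show ?thesis by (simp add: X_def)
    qed
    then have "(\<Sum>A\<in>Pow {..<r}. card ((\<lambda>t. restrict t A) ` T1) * (D A / L))
       \<le> (\<Sum>A\<in>Pow {..<r}. card T1 / 2 / 2 ^ r)" by (rule sum_mono)
    also have "\<dots> = card T1 / 2" by (simp add: card_Pow)
    finally show ?thesis .
  qed
  have "\<exists>S\<subseteq>T1. card T1 / 2 \<le> card S \<and>
    (\<forall>t\<in>S. \<forall>A\<in>Pow {..<r}. D A / L \<le> card (fibre S A t))"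
    by (rule exists_subset_large_fibres[OF finT1 _ _ small]) (use Lnn in \<open>auto simp: D_def\<close>)
  then obtain S where S: "S \<subseteq> T1" "card T1 / 2 \<le> card S"
    "\<And>t A. t \<in> S \<Longrightarrow> A \<in> Pow {..<r} \<Longrightarrow> D A / L \<le> card (fibre S A t)" by blast
  have LR2: "2 * real R \<le> L"
  proof -
    have "(2::real) ^ 1 \<le> 2 ^ (r + 2)" by (intro power_increasing) auto
    then have "2 * real R \<le> 2 ^ (r + 2) * real R" by (intro mult_right_mono) auto
    then show ?thesis using L_R by linarith
  qed
  have "real (card T) \<le> R * card T1" using of_nat_mono[OF T1, where 'a = real] by simp
  also have "\<dots> \<le> real R * (2 * real (card S))"
    using mult_left_mono[OF S(2), of "2 * real R"] by simp
  also have "\<dots> \<le> L * card S" using mult_right_mono[OF LR2, of "card S"] by (simp add: mult_ac)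
  finally have cS: "card T \<le> L * card S" .
  have "card T > 0" using finT T(3) by (simp add: card_gt_0_iff)
  then have "S \<noteq> {}" using cS by auto
  have "regular_tuples r V S D L"
  proof
    show "finite V" by fact
    show "S \<subseteq> {..<r} \<rightarrow>\<^sub>E V" using S T1T T by blast
    show "inj_on t {..<r}" if "t \<in> S" for t using that S T1T T by blast
    show "S \<noteq> {}" by fact
    show "1 \<le> L" using LR2 R1 by linarith
    fix t A assume tA: "t \<in> S" "A \<subseteq> {..<r}"
    have "fibre S A t \<subseteq> fibre T A t" using S T1T by (auto simp: fibre_def)
    then have "card (fibre S A t) \<le> card (fibre T A t)" using finf by (intro card_mono)
    also have "\<dots> < 2 ^ (cls t A + 1)" using cls_bounds(2) tA S T1T by blast
    also have "\<dots> = 2 ^ (f A + 1)" using cls_f tA S by auto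
    finally have "card (fibre S A t) \<le> (2::nat) ^ (f A + 1)" by simp
    then have "real (card (fibre S A t)) \<le> real (2 ^ (f A + 1))" by (rule of_nat_mono)
    then show "card (fibre S A t) \<le> D A" by (simp add: D_def)
    show "D A \<le> L * card (fibre S A t)"
      using S(3)[of t A] tA Lnn by (simp add: field_simps)
  qed
  then show ?thesis using S(1) T1T cS by blast
qed

section \<open>Extension numbers in a regular system\<close>

lemma card_le_mult_image:
  assumes "finite X" "\<And>y. y \<in> f ` X \<Longrightarrow> card {x \<in> X. f x = y} \<le> N"
  shows "card X \<le> N * card (f ` X)"
proof -
  have "card X = (\<Sum>y\<in>f ` X. card {x \<in> X. f x = y})"
    using sum.group[OF assms(1) finite_imageI[OF assms(1), of f] subset_refl, where h = "\<lambda>_. 1::nat"] by simp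
  also have "\<dots> \<le> (\<Sum>y\<in>f ` X. N)" by (rule sum_mono) (rule assms(2))
  finally show ?thesis by (simp add: mult.commute)
qed

lemma card_mult_image_le:
  assumes "finite X" "\<And>y. y \<in> f ` X \<Longrightarrow> N \<le> card {x \<in> X. f x = y}"
  shows "N * card (f ` X) \<le> card X"
proof -
  have "N * card (f ` X) = (\<Sum>y\<in>f ` X. N)" by simp
  also have "\<dots> \<le> (\<Sum>y\<in>f ` X. card {x \<in> X. f x = y})" by (rule sum_mono) (rule assms(2))
  also have "\<dots> = card X"
    using sum.group[OF assms(1) finite_imageI[OF assms(1), of f] subset_refl, where h = "\<lambda>_. 1::nat"] by simp
  finally show ?thesis .
qed

context regular_tuples
begin

lemma finite_T: "finite T"
  using T_PiE finite_V by (meson finite_PiE finite_lessThan finite_subset)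

lemma finite_fibre: "finite (fibre T A t)"
  using finite_T by (simp add: fibre_def)

lemma self_in_fibre: "t \<in> T \<Longrightarrow> t \<in> fibre T A t"
  by (simp add: fibre_def)

lemma finite_ext: "finite (ext T A c t)"
  unfolding ext_def using finite_fibre by blast

lemma D_ge_1:
  assumes "A \<subseteq> {..<r}"
  shows "1 \<le> D A"
proof -
  obtain t where t: "t \<in> T" using T_nonempty by auto
  have "1 \<le> card (fibre T A t)"
    using self_in_fibre[OF t] finite_fibre by (metis One_nat_def Suc_leI card_gt_0_iff empty_iff)
  then show ?thesis using fibre_upper[OF t assms] by linarith
qed

lemma L_pos: "0 < L" using L_ge_1 by linarith

lemma fibre_insert:
  assumes "z \<in> ext T A c t"
  obtains y where "y \<in> T" "{y \<in> fibre T A t. y c = z} = fibre T (insert c A) y"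
proof -
  obtain y where "y \<in> fibre T A t" "y c = z" using assms by (auto simp: ext_def)
  then show thesis by (intro that[of y]) (auto simp: fibre_def)
qed

text \<open>The values of the coordinate \<open>c\<close> cut a fibre over \<open>A\<close> into
  fibres over \<open>insert c A\<close>, whose sizes are all about \<open>D (insert c A)\<close>.
  With the converse \<open>ext_le_fibre\<close> this makes \<open>D A / D (insert c A)\<close> the
  number of extensions, whichever tuple is extended.\<close>

lemma fibre_le_ext:
  assumes "insert c A \<subseteq> {..<r}"
  shows "card (fibre T A t) \<le> card (ext T A c t) * D (insert c A)"
proof -
  define N where "N = nat \<lfloor>D (insert c A)\<rfloor>"
  have "card (fibre T A t) \<le> N * card ((\<lambda>y. y c) ` fibre T A t)"
  proof (rule card_le_mult_image)
    show "finite (fibre T A t)" by (rule finite_fibre)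
    fix z assume "z \<in> (\<lambda>y. y c) ` fibre T A t"
    then have "z \<in> ext T A c t" by (simp add: ext_def)
    then obtain y where y: "y \<in> T" "{y \<in> fibre T A t. y c = z} = fibre T (insert c A) y"
      by (rule fibre_insert)
    show "card {y \<in> fibre T A t. y c = z} \<le> N"
      unfolding y(2) N_def using fibre_upper[OF y(1) assms] by linarith
  qed
  then have "real (card (fibre T A t)) \<le> real N * card (ext T A c t)"
    unfolding ext_def by (metis of_nat_le_iff of_nat_mult)
  also have "\<dots> \<le> D (insert c A) * card (ext T A c t)"
    using D_ge_1[OF assms] by (intro mult_right_mono) (auto simp: N_def)
  finally show ?thesis by (simp add: mult.commute)
qed

lemma ext_le_fibre:
  assumes "insert c A \<subseteq> {..<r}"
  shows "card (ext T A c t) * D (insert c A) \<le> L * card (fibre T A t)"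
proof -
  define N where "N = nat \<lceil>D (insert c A) / L\<rceil>"
  have "N * card ((\<lambda>y. y c) ` fibre T A t) \<le> card (fibre T A t)"
  proof (rule card_mult_image_le)
    show "finite (fibre T A t)" by (rule finite_fibre)
    fix z assume "z \<in> (\<lambda>y. y c) ` fibre T A t"
    then have "z \<in> ext T A c t" by (simp add: ext_def)
    then obtain y where y: "y \<in> T" "{y \<in> fibre T A t. y c = z} = fibre T (insert c A) y"
      by (rule fibre_insert)
    have "D (insert c A) / L \<le> card (fibre T (insert c A) y)"
      using fibre_lower[OF y(1) assms] L_pos by (simp add: field_simps)
    then show "N \<le> card {y \<in> fibre T A t. y c = z}"
      unfolding y(2) N_def by linarith
  qed
  then have "real N * card (ext T A c t) \<le> card (fibre T A t)"
    unfolding ext_def by (metis of_nat_le_iff of_nat_mult)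
  moreover have "D (insert c A) / L * card (ext T A c t) \<le> real N * card (ext T A c t)"
    unfolding N_def by (intro mult_right_mono) linarith+
  ultimately have "D (insert c A) / L * card (ext T A c t) \<le> card (fibre T A t)" by linarith
  then show ?thesis using L_pos by (simp add: field_simps)
qed

lemma ext_lower:
  assumes "t \<in> T" "insert c A \<subseteq> {..<r}"
  shows "D A / (L * D (insert c A)) \<le> card (ext T A c t)"
proof -
  have "D A \<le> L * card (fibre T A t)" using fibre_lower assms by auto
  also have "\<dots> \<le> L * (card (ext T A c t) * D (insert c A))"
    using fibre_le_ext[OF assms(2)] L_pos by (intro mult_left_mono) auto
  finally show ?thesis using L_pos D_ge_1[OF assms(2)] by (simp add: field_simps)
qed

lemma ext_upper:
  assumes "t \<in> T" "insert c A \<subseteq> {..<r}"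
  shows "card (ext T A c t) \<le> L * D A / D (insert c A)"
proof -
  have "card (ext T A c t) * D (insert c A) \<le> L * card (fibre T A t)" by (rule ext_le_fibre[OF assms(2)])
  also have "\<dots> \<le> L * D A" using fibre_upper assms L_pos by auto
  finally show ?thesis using D_ge_1[OF assms(2)] by (simp add: field_simps)
qed

text \<open>Mostly read backwards, as a lower bound for \<open>D B\<close>, there being at most
  n^(card B) fibres over \<open>B\<close>. For a pair it gives P \<ge> m/n^2, for a single
  coordinate a lower bound on degrees, and for r - 1 coordinates the gain in
  \<open>D_insert\<close>.\<close>

lemma card_T_le:
  assumes B: "B \<subseteq> {..<r}"
  shows "card T \<le> real (card V) ^ card B * D B"
proof -
  have finB: "finite B" using B finite_subset by blast
  have "card T \<le> nat \<lfloor>D B\<rfloor> * card ((\<lambda>t. restrict t B) ` T)"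
  proof (rule card_le_mult_image[OF finite_T])
    fix s assume "s \<in> (\<lambda>t. restrict t B) ` T"
    then obtain t where t: "t \<in> T" "s = restrict t B" by auto
    have "{x \<in> T. restrict x B = s} = fibre T B t" by (simp add: fibre_eq_restrict t(2))
    then show "card {x \<in> T. restrict x B = s} \<le> nat \<lfloor>D B\<rfloor>"
      using fibre_upper[OF t(1) B] by (simp add: le_nat_floor)
  qed
  also have "card ((\<lambda>t. restrict t B) ` T) \<le> card (B \<rightarrow>\<^sub>E V)"
    using T_PiE B finite_V finB by (intro card_mono finite_PiE image_subsetI PiE_I) auto
  also have "\<dots> = card V ^ card B" using finB by (simp add: card_PiE)
  finally have "card T \<le> nat \<lfloor>D B\<rfloor> * card V ^ card B" by simp
  then have "real (card T) \<le> real (nat \<lfloor>D B\<rfloor>) * real (card V) ^ card B"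
    by (metis of_nat_le_iff of_nat_mult of_nat_power)
  also have "\<dots> \<le> D B * real (card V) ^ card B"
    using D_ge_1[OF B] by (intro mult_right_mono) auto
  finally show ?thesis by (simp add: mult.commute)
qed

lemma card_V_pos: assumes "0 < r" shows "0 < card V"
proof -
  obtain t where "t \<in> T" using T_nonempty by auto
  then have "t 0 \<in> V" using T_PiE assms by auto
  then show ?thesis using finite_V by (auto simp: card_gt_0_iff)
qed

text \<open>If there are far more than \<open>n ^ (r - 1)\<close> tuples, then fixing one more coordinate always
  loses a large factor, so vertices chosen later can avoid any bounded set of vertices.\<close>

lemma D_insert:
  assumes c: "c \<notin> A" "insert c A \<subseteq> {..<r}"
  shows "card T / (real (card V) ^ (r - 1) * L\<^sup>2) * D (insert c A) \<le> D A"
proof -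
  obtain t where t: "t \<in> T" using T_nonempty by auto
  \<comment> \<open>The members of \<open>?F\<close> share the coordinate \<open>c\<close>, so they
    are told apart by \<open>C\<close>, and their fibres over \<open>C\<close> are disjoint. These
    fibres stay inside the fibre over \<open>A\<close>, since \<open>A \<subseteq> C\<close>. Hence
    \<open>D (insert c A) * D C\<close> is at most about \<open>D A\<close>, with one
    \<open>L\<close> for each of the two lower bounds used.\<close>
  define C where "C = {..<r} - {c}"
  have C: "C \<subseteq> {..<r}" "card C = r - 1" using c by (auto simp: C_def)
  let ?F = "fibre T (insert c A) t"
  have disj: "fibre T C y \<inter> fibre T C y' = {}" if "y \<in> ?F" "y' \<in> ?F" "y \<noteq> y'" for y y'
  proof (rule ccontr)
    assume "fibre T C y \<inter> fibre T C y' \<noteq> {}"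
    then have "y i = y' i" if "i \<in> C" for i using that by (auto simp: fibre_def)
    moreover have "y c = y' c" using that by (auto simp: fibre_def)
    moreover have "y \<in> {..<r} \<rightarrow>\<^sub>E V" "y' \<in> {..<r} \<rightarrow>\<^sub>E V" using that T_PiE by (auto simp: fibre_def)
    ultimately have "y = y'" by (intro PiE_ext[of y "{..<r}" "\<lambda>_. V"]) (auto simp: C_def)
    then show False using that by simp
  qed
  have "D (insert c A) / L * (D C / L) \<le> card ?F * (D C / L)"
    using fibre_lower[OF t c(2)] L_pos D_ge_1[OF C(1)] by (intro mult_right_mono) (auto simp: field_simps)
  also have "\<dots> = (\<Sum>y\<in>?F. D C / L)" by simp
  also have "\<dots> \<le> (\<Sum>y\<in>?F. real (card (fibre T C y)))"
    using fibre_lower[OF _ C(1)] L_pos by (intro sum_mono) (auto simp: field_simps fibre_def)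
  also have "\<dots> = card (\<Union>y\<in>?F. fibre T C y)"
    using disj by (subst card_UN_disjoint) (auto simp: finite_fibre)
  also have "\<dots> \<le> card (fibre T A t)"
  proof (intro of_nat_mono card_mono finite_fibre subsetI)
    fix x assume "x \<in> (\<Union>y\<in>?F. fibre T C y)"
    then obtain y where y: "y \<in> ?F" "x \<in> fibre T C y" by auto
    have "x i = t i" if "i \<in> A" for i
    proof -
      have "i \<in> C" using that c by (auto simp: C_def)
      then show ?thesis using y that by (auto simp: fibre_def)
    qed
    then show "x \<in> fibre T A t" using y(2) by (auto simp: fibre_def)
  qed
  also have "\<dots> \<le> D A" using fibre_upper[OF t] c by auto
  finally have 1: "D (insert c A) * D C / L\<^sup>2 \<le> D A" by (simp add: power2_eq_square)
  have n: "0 < card V" using card_V_pos c by auto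
  have "card T / real (card V) ^ (r - 1) \<le> D C"
    using card_T_le[OF C(1)] C(2) n by (simp add: field_simps)
  then have "card T / real (card V) ^ (r - 1) * (D (insert c A) / L\<^sup>2) \<le> D C * (D (insert c A) / L\<^sup>2)"
    using D_ge_1[OF c(2)] by (intro mult_right_mono) auto
  then show ?thesis using 1 by (simp add: field_simps)
qed

lemma fibre_le_prod_ext:
  assumes "A \<subseteq> {..<r}" "t \<in> T"
  shows "card (fibre T A t) \<le> (\<Prod>c\<in>{..<r} - A. card (ext T A c t))"
proof -
  have "inj_on (\<lambda>y. restrict y ({..<r} - A)) (fibre T A t)"
  proof (rule inj_onI)
    fix y y' assume y: "y \<in> fibre T A t" "y' \<in> fibre T A t"
      and eq: "restrict y ({..<r} - A) = restrict y' ({..<r} - A)"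
    have PiE: "y \<in> {..<r} \<rightarrow>\<^sub>E V" "y' \<in> {..<r} \<rightarrow>\<^sub>E V" using y T_PiE by (auto simp: fibre_def)
    have "y i = y' i" if "i < r" for i
    proof (cases "i \<in> A")
      case True then show ?thesis using y by (auto simp: fibre_def)
    next
      case False then show ?thesis using fun_cong[OF eq, of i] that by simp
    qed
    then show "y = y'" using PiE by (intro PiE_ext[of y "{..<r}" "\<lambda>_. V"]) auto
  qed
  then have "card (fibre T A t) = card ((\<lambda>y. restrict y ({..<r} - A)) ` fibre T A t)"
    by (simp add: card_image)
  also have "\<dots> \<le> card (PiE ({..<r} - A) (\<lambda>c. ext T A c t))"
    by (intro card_mono finite_PiE finite_ext image_subsetI PiE_I) (auto simp: ext_def)
  also have "\<dots> = (\<Prod>c\<in>{..<r} - A. card (ext T A c t))" by (simp add: card_PiE)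
  finally show ?thesis .
qed

text \<open>This is where the exponent x = 1/(r - 2) arises: for a pair \<open>A\<close>, each of
  the r - 2 remaining coordinates takes at most about \<open>D A / Q\<close> values, so a large
  \<open>D A\<close> forces \<open>D A / Q\<close> to be large.\<close>

lemma D_le_power:
  assumes A: "A \<subseteq> {..<r}" and Q: "0 < Q" "\<And>c. c \<in> {..<r} - A \<Longrightarrow> Q \<le> D (insert c A)"
  shows "D A / L \<le> (L * D A / Q) ^ (r - card A)"
proof -
  obtain t where t: "t \<in> T" using T_nonempty by auto
  have finA: "finite A" using A finite_subset by blast
  have "D A / L \<le> card (fibre T A t)" using fibre_lower[OF t A] L_pos by (simp add: field_simps)
  also have "\<dots> \<le> (\<Prod>c\<in>{..<r} - A. real (card (ext T A c t)))"
    using of_nat_mono[OF fibre_le_prod_ext[OF A t], where 'a = real] by simp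
  also have "\<dots> \<le> (\<Prod>c\<in>{..<r} - A. L * D A / Q)"
  proof (rule prod_mono, intro conjI)
    fix c assume c: "c \<in> {..<r} - A"
    have "card (ext T A c t) \<le> L * D A / D (insert c A)" using ext_upper[OF t] c A by auto
    also have "\<dots> \<le> L * D A / Q"
      using Q(2)[OF c] Q(1) D_ge_1[OF A] L_pos by (intro divide_left_mono) auto
    finally show "real (card (ext T A c t)) \<le> L * D A / Q" .
  qed simp
  also have "\<dots> = (L * D A / Q) ^ (r - card A)"
    using A finA by (simp add: card_Diff_subset)
  finally show ?thesis .
qed

section \<open>Edges through an adjacent pair\<close>

definition edge_sets :: "'a set set" where
  "edge_sets = (\<lambda>t. t ` {..<r}) ` T"

text \<open>The coordinates are forgotten, so an adjacent pair may occur at any two of them.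
  Therefore the edges through it are counted with a lower bound for \<open>D\<close> over all
  pairs.\<close>

definition adj :: "'a \<Rightarrow> 'a \<Rightarrow> bool" where
  "adj x y \<longleftrightarrow> (\<exists>t\<in>T. \<exists>i<r. \<exists>j<r. i \<noteq> j \<and> t i = x \<and> t j = y)"

lemma adj_sym: "adj x y \<Longrightarrow> adj y x"
  unfolding adj_def by metis

lemma adjI: "t \<in> T \<Longrightarrow> i < r \<Longrightarrow> j < r \<Longrightarrow> i \<noteq> j \<Longrightarrow> adj (t i) (t j)"
  unfolding adj_def by blast

text \<open>Each of the at most b forbidden vertices, at each of the at most r remaining
  coordinates, cuts out a fibre over three coordinates. By \<open>D_insert\<close> and the
  hypothesis on \<open>card T\<close> it has at most \<open>D {i, j} / (2 * L * b * r)\<close>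
  members, so all of them together fill at most half of the \<open>D {i, j} / L\<close> tuples that
  are guaranteed.\<close>

lemma edges_through_adj:
  assumes xy: "adj x y" and B: "finite B" "x \<notin> B" "y \<notin> B" "card B \<le> b"
    and b: "2 * L * b * r * (real (card V) ^ (r - 1) * L\<^sup>2) \<le> card T"
    and P: "\<And>i j. i < r \<Longrightarrow> j < r \<Longrightarrow> i \<noteq> j \<Longrightarrow> P \<le> D {i, j}"
  shows "P / (2 * L * r ^ r) \<le> card {e \<in> edge_sets. x \<in> e \<and> y \<in> e \<and> e \<inter> B = {}}"
proof -
  obtain t i j where t: "t \<in> T" and ij: "i < r" "j < r" "i \<noteq> j" and txy: "t i = x" "t j = y"
    using xy by (auto simp: adj_def)
  let ?F = "fibre T {i, j} t"
  have n: "0 < card V" using card_V_pos ij by auto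
  define Bad where "Bad = (\<Union>v\<in>B. \<Union>c\<in>{..<r} - {i, j}. {y \<in> ?F. y c = v})"
  have one: "card {y \<in> ?F. y c = v} * (2 * L * b * r) \<le> D {i, j}" if c: "c \<in> {..<r} - {i, j}" for c v
  proof (cases "{y \<in> ?F. y c = v} = {}")
    case True show ?thesis unfolding True using D_ge_1[of "{i, j}"] ij by simp
  next
    case False
    then have "v \<in> ext T {i, j} c t" by (auto simp: ext_def)
    then obtain y where y: "y \<in> T" "{y \<in> ?F. y c = v} = fibre T (insert c {i, j}) y"
      by (rule fibre_insert)
    have sub: "insert c {i, j} \<subseteq> {..<r}" using c ij by auto
    have pos: "0 < real (card V) ^ (r - 1) * L\<^sup>2" using n L_pos by simp
    have "card {y \<in> ?F. y c = v} * (2 * L * b * r) \<le> D (insert c {i, j}) * (2 * L * b * r)"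
      unfolding y(2) using fibre_upper[OF y(1) sub] L_pos by (intro mult_right_mono) auto
    also have "\<dots> \<le> D (insert c {i, j}) * (card T / (real (card V) ^ (r - 1) * L\<^sup>2))"
      using b pos D_ge_1[OF sub] by (intro mult_left_mono) (auto simp: pos_le_divide_eq)
    also have "\<dots> \<le> D {i, j}" using D_insert[of c "{i, j}"] sub c by (simp add: mult.commute)
    finally show ?thesis .
  qed
  have "card Bad * (2 * L) \<le> D {i, j}"
  proof (cases "b = 0")
    case True
    then have "B = {}" using B by simp
    then show ?thesis using D_ge_1[of "{i, j}"] ij by (simp add: Bad_def)
  next
    case False
    define q where "q = D {i, j} / (2 * L * b * r)"
    have r0: "0 < r" using ij by auto
    have one': "card {y \<in> ?F. y c = v} \<le> q" if "c \<in> {..<r} - {i, j}" for c v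
      using one[OF that, of v] L_pos False r0 by (simp add: q_def field_simps)
    have q0: "0 \<le> q" unfolding q_def using D_ge_1[of "{i, j}"] ij L_pos by simp
    have "real (card Bad) \<le> (\<Sum>v\<in>B. real (card (\<Union>c\<in>{..<r} - {i, j}. {y \<in> ?F. y c = v})))"
      unfolding Bad_def
      using of_nat_mono[OF card_UN_le[OF B(1), of "\<lambda>v. \<Union>c\<in>{..<r} - {i, j}. {y \<in> ?F. y c = v}"],
          where 'a = real] by simp
    also have "\<dots> \<le> (\<Sum>v\<in>B. r * q)"
    proof (rule sum_mono)
      fix v
      have "real (card (\<Union>c\<in>{..<r} - {i, j}. {y \<in> ?F. y c = v}))
          \<le> (\<Sum>c\<in>{..<r} - {i, j}. real (card {y \<in> ?F. y c = v}))"
        using of_nat_mono[OF card_UN_le[of "{..<r} - {i, j}" "\<lambda>c. {y \<in> ?F. y c = v}"],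
            where 'a = real] by simp
      also have "\<dots> \<le> (\<Sum>c\<in>{..<r} - {i, j}. q)" by (intro sum_mono one')
      also have "\<dots> = real (card ({..<r} - {i, j})) * q" by simp
      also have "\<dots> \<le> r * q"
        using q0 card_mono[of "{..<r}" "{..<r} - {i, j}"] by (intro mult_right_mono) auto
      finally show "real (card (\<Union>c\<in>{..<r} - {i, j}. {y \<in> ?F. y c = v})) \<le> r * q" .
    qed
    also have "\<dots> = card B * (r * q)" by simp
    also have "\<dots> \<le> b * (r * q)" using q0 B by (intro mult_right_mono) auto
    also have "\<dots> = D {i, j} / (2 * L)" using False r0 L_pos by (simp add: q_def)
    finally show ?thesis using L_pos by (simp add: field_simps)
  qed
  then have bad: "card Bad \<le> D {i, j} / (2 * L)" using L_pos by (simp add: field_simps)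
  have fin: "finite (?F - Bad)" using finite_fibre by auto
  have BadF: "Bad \<subseteq> ?F" by (auto simp: Bad_def)
  have "D {i, j} / (2 * L) = D {i, j} / L - D {i, j} / (2 * L)" by simp
  also have "\<dots> \<le> card ?F - card Bad"
  proof -
    have "D {i, j} / L \<le> card ?F"
      using fibre_lower[OF t, of "{i, j}"] ij L_pos by (simp add: divide_le_eq mult.commute)
    then show ?thesis using bad by linarith
  qed
  also have "\<dots> = card (?F - Bad)"
    using BadF finite_fibre by (simp add: card_Diff_subset finite_subset card_mono of_nat_diff)
  finally have 1: "D {i, j} / (2 * L) \<le> card (?F - Bad)" .
  \<comment> \<open>The order of the tuples is forgotten here: an r-set is the image of at most r^r
    maps from \<open>{..<r}\<close>.\<close>
  have "card (?F - Bad) \<le> r ^ r * card ((\<lambda>t. t ` {..<r}) ` (?F - Bad))"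
  proof (rule card_le_mult_image[OF fin])
    fix e assume "e \<in> (\<lambda>t. t ` {..<r}) ` (?F - Bad)"
    then obtain s where s: "s \<in> T" "e = s ` {..<r}" by (auto simp: fibre_def)
    have ce: "finite e" "card e = r" using s T_inj by (auto simp: card_image)
    have "card {x \<in> ?F - Bad. x ` {..<r} = e} \<le> card ({..<r} \<rightarrow>\<^sub>E e)"
    proof (intro card_mono finite_PiE subsetI)
      fix x assume "x \<in> {x \<in> ?F - Bad. x ` {..<r} = e}"
      then have "x \<in> T" "x ` {..<r} = e" by (auto simp: fibre_def)
      then show "x \<in> {..<r} \<rightarrow>\<^sub>E e" using T_PiE by (intro PiE_I) auto
    qed (use ce in auto)
    also have "\<dots> = r ^ r" using ce by (simp add: card_PiE)
    finally show "card {x \<in> ?F - Bad. x ` {..<r} = e} \<le> r ^ r" .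
  qed
  also have "\<dots> \<le> r ^ r * card {e \<in> edge_sets. x \<in> e \<and> y \<in> e \<and> e \<inter> B = {}}"
  proof (intro mult_left_mono card_mono)
    show "finite {e \<in> edge_sets. x \<in> e \<and> y \<in> e \<and> e \<inter> B = {}}"
      using finite_T by (simp add: edge_sets_def)
    show "(\<lambda>t. t ` {..<r}) ` (?F - Bad) \<subseteq> {e \<in> edge_sets. x \<in> e \<and> y \<in> e \<and> e \<inter> B = {}}"
    proof (rule image_subsetI)
      fix s assume s: "s \<in> ?F - Bad"
      then have sT: "s \<in> T" "s i = x" "s j = y" using txy by (auto simp: fibre_def)
      have "s c \<notin> B" if "c < r" for c
        using that s sT B(2,3) by (cases "c \<in> {i, j}") (auto simp: Bad_def)
      then show "s ` {..<r} \<in> {e \<in> edge_sets. x \<in> e \<and> y \<in> e \<and> e \<inter> B = {}}"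
        using sT ij by (auto simp: edge_sets_def)
    qed
  qed simp
  finally have "real (card (?F - Bad)) \<le> real (r ^ r * card {e \<in> edge_sets. x \<in> e \<and> y \<in> e \<and> e \<inter> B = {}})"
    by (rule of_nat_mono)
  moreover have "P / (2 * L) \<le> D {i, j} / (2 * L)"
    using P[OF ij] L_pos by (intro divide_right_mono) auto
  ultimately have "P / (2 * L) \<le> r ^ r * real (card {e \<in> edge_sets. x \<in> e \<and> y \<in> e \<and> e \<inter> B = {}})"
    using 1 by simp
  moreover have "0 < real r ^ r" using ij by simp
  ultimately show ?thesis using L_pos by (simp add: field_simps)
qed

end

section \<open>Linear cycles from joint vertices and edges\<close>

text \<open>Here q = r - 1 and edges are numbered from 0. The joint vertices are the multiples of q,
  edge j owns the block of q vertices starting at q j, and only its last vertex can wrap around;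
  hence \<open>mod\<close> acts on the index of the joint vertex alone.\<close>

definition cycle_edge :: "nat \<Rightarrow> nat \<Rightarrow> nat \<Rightarrow> nat set" where
  "cycle_edge q k j = insert (q * (Suc j mod k)) ((\<lambda>t. q * j + t) ` {..<q})"

lemma linear_cycle_eq:
  assumes "0 < k" "1 < r"
  shows "linear_cycle r k = Hypergraph {..<(r - 1) * k} (cycle_edge (r - 1) k ` {..<k})"
proof -
  define q where "q = r - 1"
  have q: "0 < q" using assms by (simp add: q_def)
  have edge: "(\<lambda>v. v mod (q * k)) ` {q * (Suc j - 1)..q * Suc j} = cycle_edge q k j" if "j < k" for j
  proof -
    have "{q * (Suc j - 1)..q * Suc j} = insert (q * Suc j) {q * j + 0..<q * j + q}" by auto
    also have "{q * j + 0..<q * j + q} = (\<lambda>t. q * j + t) ` {..<q}"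
      by (intro set_eqI) (auto simp: le_iff_add)
    finally have 1: "{q * (Suc j - 1)..q * Suc j} = insert (q * Suc j) ((\<lambda>t. q * j + t) ` {..<q})" .
    have 2: "(q * j + t) mod (q * k) = q * j + t" if "t < q" for t
    proof -
      have "q * j + t < q * Suc j" using that by simp
      also have "\<dots> \<le> q * k" using \<open>j < k\<close> by (intro mult_le_mono) auto
      finally show ?thesis by simp
    qed
    have 3: "(q * Suc j) mod (q * k) = q * (Suc j mod k)" by (rule mult_mod_right[symmetric])
    show ?thesis unfolding 1 cycle_edge_def image_insert 3 image_image using 2 by simp
  qed
  have "{1..k} = Suc ` {..<k}" by (metis image_Suc_lessThan)
  then have "linear_cycle r k = Hypergraph {..<q * k}
      ((\<lambda>j. (\<lambda>v. v mod (q * k)) ` {q * (Suc j - 1)..q * Suc j}) ` {..<k})"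
    unfolding linear_cycle_def q_def by (simp add: image_image)
  also have "(\<lambda>j. (\<lambda>v. v mod (q * k)) ` {q * (Suc j - 1)..q * Suc j}) ` {..<k} = cycle_edge q k ` {..<k}"
    using edge by (intro image_cong) auto
  finally show ?thesis by (simp add: q_def)
qed

text \<open>For q \<ge> 2 edge i has the inner vertex q i + 1, which is no multiple of q and
  therefore determines i by division.\<close>

lemma inj_cycle_edge:
  assumes "2 \<le> q"
  shows "inj (cycle_edge q k)"
proof (rule injI)
  fix i j assume eq: "cycle_edge q k i = cycle_edge q k j"
  have "q * i + 1 \<in> cycle_edge q k i" using assms by (auto simp: cycle_edge_def)
  then have "q * i + 1 \<in> cycle_edge q k j" using eq by simp
  moreover have "q * i + 1 \<noteq> q * m" for m
  proof
    assume "q * i + 1 = q * m"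
    then have "q dvd q * i + 1" by simp
    then have "q dvd 1" using dvd_add_right_iff[of q "q * i" 1] by simp
    then show False using assms by simp
  qed
  ultimately obtain t where t: "t < q" "q * i + 1 = q * j + t" by (auto simp: cycle_edge_def)
  have "(q * i + 1) div q = i" "(q * j + t) div q = j" using assms t(1) by (intro div_nat_eqI; simp)+
  then show "i = j" using t by simp
qed

lemma cycle_edge_subset:
  assumes "j < k" "0 < q"
  shows "cycle_edge q k j \<subseteq> {..<q * k}"
proof
  fix v assume v: "v \<in> cycle_edge q k j"
  have "q * j + q \<le> q * k" using assms(1) by (metis Suc_leI mult_Suc_right mult_le_mono2 add.commute)
  moreover have "Suc j mod k < k" using assms(1) by simp
  ultimately show "v \<in> {..<q * k}" using v assms(2) by (auto simp: cycle_edge_def)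
qed

lemma card_cycle_edge:
  assumes "j < k" "2 \<le> k" "0 < q"
  shows "card (cycle_edge q k j) = Suc q"
proof -
  have "q * (Suc j mod k) \<noteq> q * j + t" if "t < q" for t
  proof
    assume "q * (Suc j mod k) = q * j + t"
    moreover have "q * (Suc j mod k) div q = Suc j mod k" "(q * j + t) div q = j"
      using assms(3) that by auto
    ultimately have "Suc j mod k = j" by simp
    then show False using assms by (cases "Suc j = k") auto
  qed
  then have "q * (Suc j mod k) \<notin> (\<lambda>t. q * j + t) ` {..<q}" by auto
  then show ?thesis by (simp add: cycle_edge_def card_image)
qed

lemma card_edges_linear_cycle:
  assumes "3 \<le> r" "0 < k"
  shows "card (edges (linear_cycle r k)) = k"
proof -
  have "inj_on (cycle_edge (r - 1) k) {..<k}"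
    using assms by (intro inj_on_subset[OF inj_cycle_edge]) auto
  then show ?thesis using assms by (simp add: linear_cycle_eq card_image)
qed

text \<open>Joint vertices go to \<open>us\<close>, and the q - 1 inner vertices of block j go
  bijectively to the r - 2 vertices of \<open>es ! j\<close> outside \<open>us\<close>. Edges meet
  only inside \<open>set us\<close>, so the pieces fit together injectively.\<close>

lemma linear_cycle_isomorphic:
  assumes r: "3 \<le> r" and k: "2 \<le> k"
    and us: "length us = k" "distinct us"
    and es: "length es = k" "\<And>j. j < k \<Longrightarrow> finite (es ! j) \<and> card (es ! j) = r"
    and joint: "\<And>j. j < k \<Longrightarrow> es ! j \<inter> set us = {us ! j, us ! (Suc j mod k)}"
    and inter: "\<And>i j. i < j \<Longrightarrow> j < k \<Longrightarrow> es ! i \<inter> es ! j \<subseteq> set us"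
  shows "isomorphic (linear_cycle r k) (Hypergraph (\<Union> (set es)) (set es))"
proof -
  define q where "q = r - 1"
  have q: "2 \<le> q" using r by (simp add: q_def)
  have Suc_ne: "Suc j mod k \<noteq> j" if "j < k" for j
    using that k by (cases "Suc j = k") auto
  have "\<exists>g. bij_betw g {1..<q} (es ! j - set us)" if j: "j < k" for j
  proof (rule finite_same_card_bij)
    have "es ! j - set us = es ! j - {us ! j, us ! (Suc j mod k)}" using joint[OF j] by auto
    moreover have "{us ! j, us ! (Suc j mod k)} \<subseteq> es ! j" using joint[OF j] by auto
    moreover have "us ! j \<noteq> us ! (Suc j mod k)"
      using us j k Suc_ne[OF j] by (subst nth_eq_iff_index_eq) auto
    ultimately show "card {1..<q} = card (es ! j - set us)"
      using es(2)[OF j] by (simp add: card_Diff_subset q_def)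
  qed (use es(2)[OF j] in auto)
  then obtain g where g: "\<And>j. j < k \<Longrightarrow> bij_betw (g j) {1..<q} (es ! j - set us)" by metis
  define f where "f v = (if v mod q = 0 then us ! (v div q) else g (v div q) (v mod q))" for v
  have g_img: "g j t \<in> es ! j - set us" if "j < k" "t < q" "t \<noteq> 0" for j t
    using g[OF that(1)] that by (auto simp: bij_betw_def)
  have f_int: "f v \<in> es ! (v div q) - set us" if "v < q * k" "v mod q \<noteq> 0" for v
  proof -
    have "v div q < k" using that by (simp add: less_mult_imp_div_less mult.commute)
    then show ?thesis using g_img[of "v div q" "v mod q"] that q by (simp add: f_def)
  qed
  have f_joint: "f v \<in> set us" if "v < q * k" "v mod q = 0" for v
    using that us(1) by (simp add: f_def less_mult_imp_div_less mult.commute)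
  have inj: "inj_on f {..<q * k}"
  proof (rule inj_onI)
    fix v w assume vw: "v \<in> {..<q * k}" "w \<in> {..<q * k}" and eq: "f v = f w"
    have lt: "v div q < k" "w div q < k" using vw by (auto simp: less_mult_imp_div_less mult.commute)
    have "v div q = w div q \<and> v mod q = w mod q"
    proof (cases "v mod q = 0")
      case True
      then have w0: "w mod q = 0" using eq f_int[of w] f_joint[of v] vw by auto
      have "us ! (v div q) = us ! (w div q)" using eq True w0 by (simp add: f_def)
      then have "v div q = w div q" using us lt by (simp add: nth_eq_iff_index_eq)
      then show ?thesis using True w0 by simp
    next
      case False
      then have w0: "w mod q \<noteq> 0" using eq f_int[of v] f_joint[of w] vw by auto
      have mem: "f v \<in> es ! (v div q)" "f v \<in> es ! (w div q)" "f v \<notin> set us"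
        using f_int[of v] f_int[of w] eq vw w0 False by auto
      have "v div q = w div q"
        using inter[of "v div q" "w div q"] inter[of "w div q" "v div q"] mem lt
        by (metis IntI linorder_neqE_nat subsetD)
      then have "g (v div q) (v mod q) = g (v div q) (w mod q)" using eq False w0 by (simp add: f_def)
      moreover have "v mod q \<in> {1..<q}" "w mod q \<in> {1..<q}" using False w0 q by auto
      ultimately have "v mod q = w mod q" using g[OF lt(1)] by (auto simp: bij_betw_def inj_on_def)
      then show ?thesis using \<open>v div q = w div q\<close> by simp
    qed
    then show "v = w" by (metis mult_div_mod_eq)
  qed
  have edge: "f ` cycle_edge q k j = es ! j" if j: "j < k" for j
  proof -
    have f1: "f (q * j + t) = (if t = 0 then us ! j else g j t)" if "t < q" for t
      using that q by (auto simp: f_def)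
    have f2: "f (q * (Suc j mod k)) = us ! (Suc j mod k)" using q by (simp add: f_def)
    have "{..<q} = insert 0 {1..<q}" using q by auto
    then have "(\<lambda>t. f (q * j + t)) ` {..<q} = insert (f (q * j + 0)) ((\<lambda>t. f (q * j + t)) ` {1..<q})"
      by (simp only: image_insert)
    also have "(\<lambda>t. f (q * j + t)) ` {1..<q} = g j ` {1..<q}" using f1 by (intro image_cong) auto
    also have "f (q * j + 0) = us ! j" using f1[of 0] q by simp
    also have "g j ` {1..<q} = es ! j - set us" using g[OF j] by (simp add: bij_betw_def)
    finally have "f ` cycle_edge q k j = {us ! j, us ! (Suc j mod k)} \<union> (es ! j - set us)"
      by (auto simp: cycle_edge_def image_image f2)
    then show ?thesis using joint[OF j] by auto
  qed
  have verts: "{..<q * k} = (\<Union>j<k. cycle_edge q k j)"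
  proof (intro set_eqI iffI)
    fix v assume v: "v \<in> {..<q * k}"
    have "v = q * (v div q) + v mod q" by simp
    then have "v \<in> (\<lambda>t. q * (v div q) + t) ` {..<q}"
      using q by (intro image_eqI[of _ _ "v mod q"]) auto
    then have "v \<in> cycle_edge q k (v div q)" by (simp add: cycle_edge_def)
    moreover have "v div q < k" using v by (simp add: less_mult_imp_div_less mult.commute)
    ultimately show "v \<in> (\<Union>j<k. cycle_edge q k j)" by auto
  next
    fix v assume "v \<in> (\<Union>j<k. cycle_edge q k j)"
    then obtain j where j: "j < k" "v \<in> cycle_edge q k j" by auto
    have "cycle_edge q k j \<subseteq> {..<q * k}" using q by (intro cycle_edge_subset j(1)) simp
    then show "v \<in> {..<q * k}" using j(2) by blast
  qed
  have set_es: "set es = (\<lambda>j. es ! j) ` {..<k}" using es(1) by (auto simp: in_set_conv_nth)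
  have "f ` {..<q * k} = \<Union> (set es)" unfolding verts set_es using edge by (auto simp: image_UN)
  then have "bij_betw f {..<q * k} (\<Union> (set es))" using inj by (simp add: bij_betw_def)
  moreover have "set es = (\<lambda>e. f ` e) ` cycle_edge q k ` {..<k}"
    unfolding set_es image_image using edge by (intro image_cong) auto
  ultimately show ?thesis
    using linear_cycle_eq[of k r] r k by (auto simp: isomorphic_def q_def)
qed

lemma finite_copies:
  assumes "rgraph r G"
  shows "finite (copies F G)"
proof -
  have "finite (verts G)" using assms by (simp add: rgraph_def)
  moreover have "edges G \<subseteq> Pow (verts G)" using assms by (auto simp: rgraph_def)
  ultimately have "finite (Pow (verts G) \<times> Pow (edges G))" by (auto intro: finite_subset)
  moreover have "copies F G \<subseteq> (\<lambda>(v, e). Hypergraph v e) ` (Pow (verts G) \<times> Pow (edges G))"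
  proof
    fix S assume "S \<in> copies F G"
    then show "S \<in> (\<lambda>(v, e). Hypergraph v e) ` (Pow (verts G) \<times> Pow (edges G))"
      by (cases S) (auto simp: copies_def subgraph_def)
  qed
  ultimately show ?thesis by (meson finite_imageI finite_subset)
qed

text \<open>Edges are chosen greedily along a cycle of joint vertices. Each has to avoid the other
  joint vertices and the earlier edges, at most k + r k vertices. The factor on the right bounds how
  often one copy arises: each of the k joint vertices is one of its at most r k vertices, and each
  of the k entries of \<open>es\<close> one of its at most k edges.\<close>

lemma linear_cycle_copies_lower:
  fixes U :: "'a list set" and m :: real
  assumes G: "rgraph r G" and r: "3 \<le> r" and k: "3 \<le> k" and E: "E \<subseteq> edges G"
    and U: "\<And>us. us \<in> U \<Longrightarrow> length us = k \<and> distinct us \<and> set us \<subseteq> verts G"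
    and m: "0 \<le> m"
    and ext: "\<And>us j B. us \<in> U \<Longrightarrow> j < k \<Longrightarrow> finite B \<Longrightarrow> card B \<le> k + r * k \<Longrightarrow> us ! j \<notin> B \<Longrightarrow>
      us ! (Suc j mod k) \<notin> B \<Longrightarrow> m \<le> card {e \<in> E. us ! j \<in> e \<and> us ! (Suc j mod k) \<in> e \<and> e \<inter> B = {}}"
  shows "card U * m ^ k \<le> real ((r * k) ^ k * k ^ k) * card (copies (linear_cycle r k) G)"
proof -
  have finV: "finite (verts G)" using G by (simp add: rgraph_def)
  have Ecard: "finite e \<and> card e = r \<and> e \<subseteq> verts G" if "e \<in> E" for e
  proof -
    have "e \<in> edges G" using that E by auto
    then have "card e = r" "e \<subseteq> verts G" using G by (auto simp: rgraph_def)
    then show ?thesis using finV finite_subset by blast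
  qed
  have finE: "finite E"
    by (rule finite_subset[of _ "Pow (verts G)"]) (use Ecard finV in auto)
  have finU: "finite U"
    by (rule finite_subset[OF _ finite_lists_length_eq[OF finV, of k]]) (use U in auto)
  \<comment> \<open>The index of the next edge is \<open>length es\<close>. Its own two joint
    vertices are exempt from avoidance even if an earlier edge contains them.\<close>
  define S where "S us es = {e \<in> E. us ! length es \<in> e \<and> us ! (Suc (length es) mod k) \<in> e \<and>
     e \<inter> (set us \<union> \<Union> (set es) - {us ! length es, us ! (Suc (length es) mod k)}) = {}}" for us es
  define \<P> where "\<P> = (SIGMA us:U. greedy (S us) k)"
  have in_E: "set es \<subseteq> E" if "es \<in> greedy (S us) j" for es us j
    using greedyD[OF that] by (auto simp: in_set_conv_nth S_def)
  have finS: "finite (S us es)" for us es using finE by (simp add: S_def)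
  have fin_greedy: "finite (greedy (S us) k)" for us by (rule finite_greedy) (rule finS)
  have fin\<P>: "finite \<P>" unfolding \<P>_def using finU fin_greedy by auto
  have lower: "m ^ k \<le> card (greedy (S us) k)" if us: "us \<in> U" for us
  proof -
    have "(\<Prod>j<k. m) \<le> card (greedy (S us) k)"
    proof (rule greedy_lower)
      fix j es assume j: "j < k" and es: "es \<in> greedy (S us) j"
      have len: "length es = j" using greedyD[OF es] by simp
      define B where "B = set us \<union> \<Union> (set es) - {us ! j, us ! (Suc j mod k)}"
      have "card (\<Union> (set es)) \<le> (\<Sum>e\<in>set es. card e)" by (rule card_Union_le_sum_card)
      also have "\<dots> \<le> (\<Sum>e\<in>set es. r)" using in_E[OF es] Ecard by (intro sum_mono) auto
      also have "\<dots> \<le> k * r" using card_length[of es] len j by simp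
      finally have c1: "card (\<Union> (set es)) \<le> r * k" by (simp add: mult.commute)
      have finUn: "finite (\<Union> (set es))" using in_E[OF es] Ecard by auto
      have "card B \<le> card (set us \<union> \<Union> (set es))" unfolding B_def using finUn by (intro card_mono) auto
      also have "\<dots> \<le> card (set us) + card (\<Union> (set es))" by (rule card_Un_le)
      also have "\<dots> \<le> k + r * k" using c1 U[OF us] card_length[of us] by simp
      finally have "card B \<le> k + r * k" .
      then have "m \<le> card {e \<in> E. us ! j \<in> e \<and> us ! (Suc j mod k) \<in> e \<and> e \<inter> B = {}}"
        using finUn by (intro ext[OF us j]) (auto simp: B_def)
      then show "m \<le> card (S us es)" by (simp add: S_def B_def len)
    qed (use finS m in auto)
    then show ?thesis by simp
  qed
  have "card U * m ^ k = (\<Sum>us\<in>U. m ^ k)" by simp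
  also have "\<dots> \<le> (\<Sum>us\<in>U. real (card (greedy (S us) k)))" by (rule sum_mono) (rule lower)
  also have "\<dots> = card \<P>" unfolding \<P>_def using finU fin_greedy by simp
  finally have 1: "card U * m ^ k \<le> card \<P>" .
  define F where "F = (\<lambda>(us :: 'a list, es :: 'a set list). Hypergraph (\<Union> (set es)) (set es))"
  have props: "length es = k" "set es \<subseteq> E" "us \<in> U" "set us \<subseteq> \<Union> (set es)"
    "isomorphic (linear_cycle r k) (Hypergraph (\<Union> (set es)) (set es))" if "(us, es) \<in> \<P>" for us es
  proof -
    have us: "us \<in> U" and es: "es \<in> greedy (S us) k" using that by (auto simp: \<P>_def)
    show len: "length es = k" using greedyD[OF es] by simp
    show "us \<in> U" by fact
    show sub: "set es \<subseteq> E" by (rule in_E[OF es])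
    have el: "us ! j \<in> es ! j" "us ! (Suc j mod k) \<in> es ! j"
      "es ! j \<inter> (set us \<union> \<Union> (set (take j es)) - {us ! j, us ! (Suc j mod k)}) = {}" if "j < k" for j
      using greedyD(2)[OF es that] that len by (auto simp: S_def)
    show "set us \<subseteq> \<Union> (set es)"
    proof
      fix x assume "x \<in> set us"
      then obtain j where "j < k" "x = us ! j" using U[OF us] by (auto simp: in_set_conv_nth)
      then show "x \<in> \<Union> (set es)" using el(1) len by (intro UnionI[of "es ! j"]) auto
    qed
    show "isomorphic (linear_cycle r k) (Hypergraph (\<Union> (set es)) (set es))"
    proof (rule linear_cycle_isomorphic)
      show "es ! j \<inter> set us = {us ! j, us ! (Suc j mod k)}" if "j < k" for j
      proof -
        have "us ! j \<in> set us" "us ! (Suc j mod k) \<in> set us" using U[OF us] that by auto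
        then show ?thesis using el[OF that] by blast
      qed
      show "es ! i \<inter> es ! j \<subseteq> set us" if "i < j" "j < k" for i j
      proof
        fix x assume x: "x \<in> es ! i \<inter> es ! j"
        have "es ! i \<in> set (take j es)" using that len by (auto simp: in_set_conv_nth intro!: exI[of _ i])
        then have "x \<in> {us ! j, us ! (Suc j mod k)}" using x el(3)[OF that(2)] by blast
        moreover have "us ! j \<in> set us" "us ! (Suc j mod k) \<in> set us" using U[OF us] that by auto
        ultimately show "x \<in> set us" by blast
      qed
      show "finite (es ! j) \<and> card (es ! j) = r" if "j < k" for j
        using Ecard sub len that by (meson nth_mem subsetD)
    qed (use r k U[OF us] len in auto)
  qed
  have "card \<P> \<le> (r * k) ^ k * k ^ k * card (F ` \<P>)"
  proof (rule card_le_mult_image[OF fin\<P>])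
    fix H assume "H \<in> F ` \<P>"
    then obtain us0 es0 where p0: "(us0, es0) \<in> \<P>" and H: "H = Hypergraph (\<Union> (set es0)) (set es0)"
      by (auto simp: F_def)
    note p0' = props[OF p0]
    let ?X = "{us. set us \<subseteq> \<Union> (set es0) \<and> length us = k}"
    let ?Y = "{es. set es \<subseteq> set es0 \<and> length es = k}"
    have fin: "finite (\<Union> (set es0))" using p0'(2) Ecard by auto
    have ce: "card (set es0) \<le> k" using p0'(1) card_length[of es0] by simp
    have "card (\<Union> (set es0)) \<le> (\<Sum>e\<in>set es0. card e)" by (rule card_Union_le_sum_card)
    also have "\<dots> \<le> (\<Sum>e\<in>set es0. r)" using p0'(2) Ecard by (intro sum_mono) auto
    also have "\<dots> \<le> r * k" using ce by simp
    finally have cu: "card (\<Union> (set es0)) \<le> r * k" .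
    have "{x \<in> \<P>. F x = H} \<subseteq> ?X \<times> ?Y"
    proof
      fix x assume x: "x \<in> {x \<in> \<P>. F x = H}"
      obtain us es where xe: "x = (us, es)" by (cases x)
      then have p: "(us, es) \<in> \<P>" and "set es = set es0" using x H by (auto simp: F_def)
      then show "x \<in> ?X \<times> ?Y" using props[OF p] U xe by auto
    qed
    then have "card {x \<in> \<P>. F x = H} \<le> card (?X \<times> ?Y)"
      using fin by (intro card_mono finite_cartesian_product finite_lists_length_eq) auto
    also have "\<dots> = card (\<Union> (set es0)) ^ k * card (set es0) ^ k"
      using fin by (simp add: card_cartesian_product card_lists_length_eq)
    also have "\<dots> \<le> (r * k) ^ k * k ^ k" using ce cu by (intro mult_le_mono power_mono) auto
    finally show "card {x \<in> \<P>. F x = H} \<le> (r * k) ^ k * k ^ k" .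
  qed
  also have "\<dots> \<le> (r * k) ^ k * k ^ k * card (copies (linear_cycle r k) G)"
  proof (intro mult_left_mono card_mono finite_copies[OF G])
    show "F ` \<P> \<subseteq> copies (linear_cycle r k) G"
    proof
      fix H assume "H \<in> F ` \<P>"
      then obtain us es where p: "(us, es) \<in> \<P>" and H: "H = Hypergraph (\<Union> (set es)) (set es)"
        by (auto simp: F_def)
      show "H \<in> copies (linear_cycle r k) G"
      proof -
        have "\<Union> (set es) \<subseteq> verts G" using props(2)[OF p] Ecard by blast
        then show ?thesis using props[OF p] E by (auto simp: copies_def subgraph_def H)
      qed
    qed
  qed simp
  finally have "real (card \<P>) \<le> real ((r * k) ^ k * k ^ k * card (copies (linear_cycle r k) G))"
    by (rule of_nat_mono)
  then show ?thesis using 1 by simp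
qed

section \<open>Cycles of joint vertices\<close>

text \<open>Cauchy--Schwarz for the fibre sizes \<open>c y\<close>, obtained from the nonnegative
  sum of their squared deviations from the mean \<open>S / card Y\<close>.\<close>

lemma card_square_le_card_eq_pairs:
  fixes f :: "'a \<Rightarrow> 'b"
  assumes "finite X" "finite Y" "f ` X \<subseteq> Y"
  shows "real (card X) ^ 2 \<le> card Y * real (card {(x, x') \<in> X \<times> X. f x = f x'})"
proof (cases "X = {}")
  case False
  define c where "c y = real (card {x \<in> X. f x = y})" for y
  define S where "S = sum c Y"
  have Y0: "Y \<noteq> {}" using False assms by auto
  then have cY: "0 < real (card Y)" using assms by (simp add: card_gt_0_iff)
  have "card X = (\<Sum>y\<in>Y. card {x \<in> X. f x = y})"
    using sum.group[OF assms(1,2,3), of "\<lambda>_. 1::nat"] by simp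
  then have X: "card X = S" by (simp add: c_def S_def)
  have "{(x, x') \<in> X \<times> X. f x = f x'} = (\<Union>y\<in>Y. {x \<in> X. f x = y} \<times> {x \<in> X. f x = y})"
    using assms by auto
  then have "card {(x, x') \<in> X \<times> X. f x = f x'} = (\<Sum>y\<in>Y. card ({x \<in> X. f x = y} \<times> {x \<in> X. f x = y}))"
    using assms by (simp only:) (rule card_UN_disjoint; auto)
  then have pairs: "card {(x, x') \<in> X \<times> X. f x = f x'} = (\<Sum>y\<in>Y. (c y)\<^sup>2)"
    by (simp add: c_def card_cartesian_product power2_eq_square)
  have "0 \<le> (\<Sum>y\<in>Y. (c y - S / card Y)\<^sup>2)" by (simp add: sum_nonneg)
  also have "\<dots> = (\<Sum>y\<in>Y. (c y)\<^sup>2 - 2 * (S / card Y) * c y + (S / card Y)\<^sup>2)"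
    by (intro sum.cong) (auto simp: power2_diff algebra_simps)
  also have "\<dots> = (\<Sum>y\<in>Y. (c y)\<^sup>2) - 2 * (S / card Y) * S + card Y * (S / card Y)\<^sup>2"
    by (simp add: sum.distrib sum_subtractf S_def sum_distrib_left)
  also have "\<dots> = (\<Sum>y\<in>Y. (c y)\<^sup>2) - S\<^sup>2 / card Y"
    using cY by (simp add: power2_eq_square field_simps)
  finally show ?thesis using cY pairs X by (simp add: field_simps)
qed simp

lemma successively_cyclic:
  assumes "successively P us" "P (last us) (hd us)" "j < length us"
  shows "P (us ! j) (us ! (Suc j mod length us))"
proof (cases "Suc j = length us")
  case True
  then have "us \<noteq> []" "j = length us - 1" by auto
  then show ?thesis using assms(2) True by (simp add: last_conv_nth hd_conv_nth)
next
  case False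
  then show ?thesis using assms by (simp add: successively_nth)
qed

section \<open>Closed walks of joint vertices in a regular system\<close>

context regular_tuples
begin

text \<open>Rooted and oriented, so one cycle gives several lists. This overcounting is covered by
  the factor (r k)^k in \<open>linear_cycle_copies_lower\<close>, which allows for every list of k
  vertices of a copy.\<close>

definition joint_cycles :: "nat \<Rightarrow> 'a list set" where
  "joint_cycles k = {us. length us = k \<and> distinct us \<and> set us \<subseteq> V \<and> successively adj us
     \<and> adj (last us) (hd us)}"

lemma finite_joint_cycles: "finite (joint_cycles k)"
  by (rule finite_subset[OF _ finite_lists_length_eq[OF finite_V, of k]]) (auto simp: joint_cycles_def)

text \<open>By \<open>D_insert\<close> the lower bound \<open>D A / (L * D (insert c A))\<close> for
  the number of extensions is at least 2 b, so half of it survives the removal of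
  \<open>W\<close>.\<close>

lemma ext_avoid:
  assumes t: "t \<in> T" and c: "c \<notin> A" "insert c A \<subseteq> {..<r}" and W: "finite W" "card W \<le> b"
    and b: "2 * L * b * (real (card V) ^ (r - 1) * L\<^sup>2) \<le> card T"
  shows "D A / (2 * L * D (insert c A)) \<le> card (ext T A c t - W)"
proof -
  have n: "0 < real (card V) ^ (r - 1) * L\<^sup>2" using card_V_pos c L_pos by auto
  have "2 * L * b * D (insert c A) \<le> card T / (real (card V) ^ (r - 1) * L\<^sup>2) * D (insert c A)"
    using b n D_ge_1[OF c(2)] by (intro mult_right_mono) (auto simp: pos_le_divide_eq)
  also have "\<dots> \<le> D A" by (rule D_insert[OF c])
  finally have "b \<le> D A / (2 * L * D (insert c A))"
    using L_pos D_ge_1[OF c(2)] by (simp add: field_simps)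
  moreover have "D A / (L * D (insert c A)) = 2 * (D A / (2 * L * D (insert c A)))" by simp
  moreover have "D A / (L * D (insert c A)) \<le> card (ext T A c t)" by (rule ext_lower[OF t c(2)])
  moreover have "card (ext T A c t) \<le> card (ext T A c t - W) + card W"
    using W by (metis card_Diff_subset_Int card_mono diff_le_mono2 finite_ext finite_Int inf_le2 le_diff_conv)
  ultimately show ?thesis using W(2) by linarith
qed

lemma D_empty_ge: "card T \<le> D {}"
proof -
  obtain t where t: "t \<in> T" using T_nonempty by auto
  show ?thesis using fibre_upper[OF t, of "{}"] by (simp add: fibre_def)
qed

lemma adj_in_V: "adj x y \<Longrightarrow> x \<in> V \<and> y \<in> V"
  using T_PiE by (auto simp: adj_def)

text \<open>A fan: all triangles \<open>u\<^sub>0 u\<^sub>j u\<^sub>j\<^sub>+\<^sub>1\<close> lie in tuples, where \<open>u\<^sub>0\<close> is in part \<open>a\<close> and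
  the other vertices alternate between the parts \<open>b\<close> and \<open>c\<close>.\<close>

lemma joint_cycles_fan:
  assumes abc: "a < r" "b < r" "c < r" "a \<noteq> b" "a \<noteq> c" "b \<noteq> c"
    and k: "3 \<le> k" "2 * L * k * (real (card V) ^ (r - 1) * L\<^sup>2) \<le> card T"
    and P: "P \<le> D {a, b}" "P \<le> D {a, c}" "0 \<le> P"
  shows "card T / (4 * L\<^sup>2 * D {a, b}) * (P / (2 * L * D {a, b, c})) ^ (k - 2) \<le> card (joint_cycles k)"
proof -
  define p where "p j = (if odd j then b else c)" for j :: nat
  have p: "p j < r" "p j \<noteq> a" "p j \<noteq> p (Suc j)" "p (Suc j) \<noteq> p j" "insert (p (Suc j)) {a, p j} = {a, b, c}" for j
    using abc by (auto simp: p_def)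
  \<comment> \<open>The new vertex has index \<open>length us\<close>. The root is any value of the
    coordinate \<open>a\<close>; later vertices share a tuple with the root and, from index 2 on,
    also with their predecessor. At index 1 the predecessor is the root itself.\<close>
  define S where "S us = {z. z \<notin> set us \<and> (\<exists>t\<in>T. (if us = [] then z = t a else
     t a = us ! 0 \<and> t (p (length us)) = z \<and> (2 \<le> length us \<longrightarrow> t (p (length us - 1)) = us ! (length us - 1))))}" for us
  \<comment> \<open>The factors \<open>D {a}\<close> of the first two steps cancel in the product.
    Afterwards \<open>D {a, b}\<close> or \<open>D {a, c}\<close> stands in the numerator, depending
    on parity, and \<open>P\<close> is below both.\<close>
  define m where "m j = (if j = 0 then card T / (2 * L * D {a}) else if j = 1 then D {a} / (2 * L * D {a, b})
     else P / (2 * L * D {a, b, c}))" for j :: nat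
  have SV: "S us \<subseteq> V" for us using T_PiE abc p(1) by (auto simp: S_def split: if_splits)
  have finS: "finite (S us)" for us using SV finite_V finite_subset by blast
  have D1: "1 \<le> D {a}" "1 \<le> D {a, b}" "1 \<le> D {a, b, c}" using D_ge_1 abc by auto
  have "(\<Prod>j<k. m j) \<le> card (greedy S k)"
  proof (rule greedy_lower)
    fix j us assume j: "j < k" and us: "us \<in> greedy S j"
    show "finite (S us)" by (rule finS)
    have len: "length us = j" using greedyD[OF us] by simp
    have cW: "card (set us) \<le> k" using card_length[of us] len j by simp
    note avoid = ext_avoid[OF _ _ _ finite_set cW k(2)]
    consider "j = 0" | "j = 1" | i where "j = Suc (Suc i)" by (metis One_nat_def not0_implies_Suc)
    then show "m j \<le> card (S us)"
    proof cases
      case 1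
      obtain t where t: "t \<in> T" using T_nonempty by auto
      have "D {} / (2 * L * D {a}) \<le> card (ext T {} a t - set us)" using abc by (intro avoid t) auto
      moreover have "card (ext T {} a t - set us) \<le> card (S us)"
        using 1 len by (intro card_mono finS) (auto simp: ext_def fibre_def S_def)
      moreover have "m j \<le> D {} / (2 * L * D {a})"
        unfolding m_def using 1 D_empty_ge D1 L_pos by (auto intro!: divide_right_mono)
      ultimately show ?thesis by linarith
    next
      case 2
      have "us ! 0 \<in> S []" using greedyD(2)[OF us, of 0] 2 by simp
      then obtain t where t: "t \<in> T" "us ! 0 = t a" by (auto simp: S_def)
      have "D {a} / (2 * L * D {b, a}) \<le> card (ext T {a} b t - set us)" using abc by (intro avoid t) auto
      moreover have "ext T {a} b t - set us \<subseteq> S us"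
        using 2 len t by (auto simp: ext_def fibre_def S_def p_def)
      then have "card (ext T {a} b t - set us) \<le> card (S us)" by (intro card_mono finS)
      ultimately show ?thesis using 2 by (simp add: m_def insert_commute)
    next
      case 3
      have "us ! Suc i \<in> S (take (Suc i) us)" using greedyD(2)[OF us, of "Suc i"] 3 by simp
      then obtain t where t: "t \<in> T" "t a = us ! 0" "t (p (Suc i)) = us ! Suc i"
        using 3 len by (auto simp: S_def min_def split: if_splits)
      have "D {a, p (Suc i)} / (2 * L * D (insert (p j) {a, p (Suc i)}))
          \<le> card (ext T {a, p (Suc i)} (p j) t - set us)"
        using abc p(1,2) p(4)[of "Suc i"] 3 by (intro avoid t) auto
      moreover have "ext T {a, p (Suc i)} (p j) t - set us \<subseteq> S us"
        using 3 len t by (auto simp: ext_def fibre_def S_def)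
      then have "card (ext T {a, p (Suc i)} (p j) t - set us) \<le> card (S us)" by (intro card_mono finS)
      moreover have "insert (p j) {a, p (Suc i)} = {a, b, c}" using p(5)[of "Suc i"] 3 by simp
      moreover have "P \<le> D {a, p (Suc i)}" using P by (auto simp: p_def)
      then have "m j \<le> D {a, p (Suc i)} / (2 * L * D {a, b, c})"
        using 3 D1 L_pos by (auto simp: m_def intro!: divide_right_mono)
      ultimately show ?thesis by simp
    qed
  next
    show "0 \<le> m j" for j using P L_pos D1 by (auto simp: m_def)
  qed
  moreover have "(\<Prod>j<k. m j) = card T / (4 * L\<^sup>2 * D {a, b}) * (P / (2 * L * D {a, b, c})) ^ (k - 2)"
  proof -
    obtain i where i: "k = Suc (Suc i)" using k(1) by (intro that[of "k - 2"]) auto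
    have "(\<Prod>j<k. m j) = m 0 * (m 1 * (\<Prod>j<i. m (Suc (Suc j))))"
      unfolding i by (simp add: prod.lessThan_Suc_shift del: prod.lessThan_Suc)
    also have "(\<Prod>j<i. m (Suc (Suc j))) = (P / (2 * L * D {a, b, c})) ^ i" by (simp add: m_def)
    finally show ?thesis using D1 L_pos i by (simp add: m_def power2_eq_square)
  qed
  moreover have "greedy S k \<subseteq> joint_cycles k"
  proof
    fix us assume us: "us \<in> greedy S k"
    note g = greedyD[OF us]
    have props: "us ! j \<notin> set (take j us)" "us ! j \<in> V" if "j < k" for j
    proof -
      show "us ! j \<in> V" using g(2)[OF that] SV by blast
      show "us ! j \<notin> set (take j us)" using g(2)[OF that] unfolding S_def by blast
    qed
    have tup: "\<exists>t\<in>T. t a = us ! 0 \<and> t (p j) = us ! j \<and> (2 \<le> j \<longrightarrow> t (p (j - 1)) = us ! (j - 1))"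
      if "j < k" "0 < j" for j
    proof -
      have len: "length (take j us) = j" "take j us \<noteq> []" using g(1) that by auto
      then have "\<exists>t\<in>T. t a = take j us ! 0 \<and> t (p j) = us ! j \<and>
          (2 \<le> j \<longrightarrow> t (p (j - 1)) = take j us ! (j - 1))"
        using g(2)[OF that(1)] by (simp add: S_def)
      then show ?thesis using that by simp
    qed
    have "us ! i \<noteq> us ! j" if "i < j" "j < k" for i j
    proof -
      have "us ! i \<in> set (take j us)" using that g(1) by (auto simp: in_set_conv_nth intro!: exI[of _ i])
      then show ?thesis using props(1)[OF that(2)] by auto
    qed
    then have "distinct us" unfolding distinct_conv_nth using g(1) by (metis linorder_neqE_nat)
    moreover have "set us \<subseteq> V" using props(2) g(1) by (auto simp: in_set_conv_nth)
    moreover have "successively adj us" unfolding successively_conv_nth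
    proof (intro allI impI)
      fix i assume i: "Suc i < length us"
      then obtain t where t: "t \<in> T" "t a = us ! 0" "t (p (Suc i)) = us ! Suc i"
        "2 \<le> Suc i \<longrightarrow> t (p i) = us ! i" using tup[of "Suc i"] g(1) by auto
      show "adj (us ! i) (us ! Suc i)"
      proof (cases "i = 0")
        case True
        then show ?thesis using adjI[OF t(1), of a "p (Suc i)"] t abc p by force
      next
        case False
        then show ?thesis using adjI[OF t(1), of "p i" "p (Suc i)"] t abc p by force
      qed
    qed
    \<comment> \<open>Closing the cycle costs nothing: the tuples used all contain the root, so the
      last vertex is adjacent to it for either parity of \<open>k\<close>.\<close>
    moreover have "adj (last us) (hd us)"
    proof -
      have "us \<noteq> []" using g(1) k by auto
      then have e: "last us = us ! (k - 1)" "hd us = us ! 0" using g(1) by (auto simp: last_conv_nth hd_conv_nth)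
      obtain t where "t \<in> T" "t a = us ! 0" "t (p (k - 1)) = us ! (k - 1)"
        using tup[of "k - 1"] k by auto
      then show ?thesis unfolding e using adjI[of t "p (k - 1)" a] abc p by metis
    qed
    ultimately show "us \<in> joint_cycles k" using g(1) by (simp add: joint_cycles_def)
  qed
  then have "card (greedy S k) \<le> card (joint_cycles k)" by (intro card_mono finite_joint_cycles)
  ultimately show ?thesis by linarith
qed

text \<open>An even cycle made of two internally disjoint paths between the parts \<open>a\<close> and \<open>b\<close>,
  with one edge replaced by a path of length two through the part \<open>c\<close>. Since the degrees exceed
  \<open>\<surd>n\<close> by a large factor, few of the pairs of paths supplied by the Cauchy--Schwarz inequality
  meet in an inner vertex.\<close>

lemma joint_cycles_theta:
  assumes abc: "a < r" "b < r" "c < r" "a \<noteq> b" "a \<noteq> c" "b \<noteq> c" and l: "2 \<le> l"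
    and K: "2 * L * real (2 * l + 2) * (real (card V) ^ (r - 1) * L\<^sup>2) \<le> card T"
  defines "\<delta> \<equiv> card T / (card V * D {a, b})"
  assumes \<delta>: "4 * real l * (real l + 1) * 2 ^ l * L ^ (2 * l + 3) * card V \<le> \<delta>\<^sup>2"
  shows "\<delta> ^ (2 * l) / (8 * L ^ 4 * (2 * L) ^ (2 * l)) * (D {a, b} / (2 * L * D {a, b, c}))
    \<le> card (joint_cycles (2 * l + 1))"
proof -
  define n where "n = real (card V)"
  have n: "0 < n" unfolding n_def using card_V_pos abc by auto
  have T0: "0 < real (card T)" using finite_T T_nonempty by (simp add: card_gt_0_iff)
  have D1: "1 \<le> D {a}" "1 \<le> D {b}" "1 \<le> D {a, b}" "1 \<le> D {a, b, c}" using D_ge_1 abc by auto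
  have \<delta>0: "0 < \<delta>" unfolding \<delta>_def using T0 D1 n by (simp add: n_def)
  define p where "p j = (if even j then a else b)" for j :: nat
  have p: "p j < r" "p j \<noteq> p (Suc j)" "p (Suc j) \<notin> {p j}" "insert (p (Suc j)) {p j} = {a, b}"
    "insert (p (Suc j)) {p j} \<subseteq> {..<r}" for j
    using abc by (auto simp: p_def)
  \<comment> \<open>Up to the factor \<open>L\<close>, \<open>d j\<close> is the number of
    neighbours, in the other part, of a vertex at position j of a path; \<delta> bounds all of these
    from below.\<close>
  define d where "d j = D {p j} / D {a, b}" for j
  have \<delta>_d: "\<delta> \<le> d j" for j
  proof -
    have "card T \<le> n * D {p j}" using card_T_le[of "{p j}"] p(1)[of j] by (simp add: n_def)
    then show ?thesis unfolding \<delta>_def d_def using n D1 by (simp add: n_def field_simps)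
  qed
  have d0: "0 < d j" for j using \<delta>_d[of j] \<delta>0 by linarith
  \<comment> \<open>Distinctness is left out of \<open>step\<close>. \<open>S\<close> adds it for
    the lower count of paths, while the upper count of paths with prescribed vertices uses
    \<open>step\<close> alone.\<close>
  define step where "step us z \<longleftrightarrow> (\<exists>t\<in>T. if us = [] then z = t a
     else t (p (length us - 1)) = us ! (length us - 1) \<and> t (p (length us)) = z)" for us z
  define S where "S us = {z. z \<notin> set us \<and> step us z}" for us
  have stepV: "step us z \<Longrightarrow> z \<in> V" for us z
    using T_PiE abc(1) p(1) by (auto simp: step_def split: if_splits)
  have fin_step: "finite {z. step us z}" for us
    using stepV by (intro finite_subset[OF _ finite_V]) auto
  have finS: "finite (S us)" for us
    by (rule finite_subset[OF _ fin_step[of us]]) (auto simp: S_def)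
  define \<P> where "\<P> = greedy S (Suc l)"
  have fin\<P>: "finite \<P>" unfolding \<P>_def by (rule finite_greedy) (rule finS)
  define A where "A = (\<lambda>t. t a) ` T"
  have A_ext: "A = ext T {} a t" for t by (auto simp: A_def ext_def fibre_def)
  have finA: "finite A" unfolding A_def using finite_T by auto
  have step_tup: "\<exists>t\<in>T. t (p i) = us ! i" if "us \<in> greedy S' j" "\<And>us. S' us \<subseteq> {z. step us z}" "i < j" for us j i S'
  proof -
    have "us ! i \<in> S' (take i us)" using greedyD(2)[OF that(1,3)] .
    then have st: "step (take i us) (us ! i)" using that(2) by blast
    have len: "length (take i us) = i" using greedyD(1)[OF that(1)] that(3) by simp
    show ?thesis
    proof (cases "i = 0")
      case True
      then show ?thesis using st by (auto simp: step_def p_def)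
    next
      case False
      then have "take i us \<noteq> []" using len by auto
      then show ?thesis using st len unfolding step_def by auto
    qed
  qed
  have S_step: "S us \<subseteq> {z. step us z}" for us by (auto simp: S_def)
  have \<P>_lower: "card A * (\<Prod>j<l. d j / (2 * L)) \<le> card \<P>"
  proof -
    define m where "m j = (if j = 0 then real (card A) else d (j - 1) / (2 * L))" for j
    have "(\<Prod>j<Suc l. m j) \<le> card (greedy S (Suc l))"
    proof (rule greedy_lower)
      fix j us assume j: "j < Suc l" and us: "us \<in> greedy S j"
      show "finite (S us)" by (rule finS)
      have len: "length us = j" using greedyD[OF us] by simp
      have cW: "card (set us) \<le> 2 * l + 2" using card_length[of us] len j by simp
      show "m j \<le> card (S us)"
      proof (cases j)
        case 0
        then have "A \<subseteq> S us" using len by (auto simp: A_def S_def step_def)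
        then show ?thesis using 0 finS by (simp add: m_def card_mono)
      next
        case (Suc i)
        obtain t where t: "t \<in> T" "t (p i) = us ! i" using step_tup[OF us S_step, of i] Suc by auto
        have "D {p i} / (2 * L * D (insert (p (Suc i)) {p i})) \<le> card (ext T {p i} (p (Suc i)) t - set us)"
          by (rule ext_avoid[OF t(1) p(3,5) finite_set cW]) (use K in \<open>simp add: add.commute\<close>)
        moreover have "ext T {p i} (p (Suc i)) t - set us \<subseteq> S us"
          using Suc len t by (auto simp: ext_def fibre_def S_def step_def)
        then have "card (ext T {p i} (p (Suc i)) t - set us) \<le> card (S us)" by (intro card_mono finS)
        ultimately show ?thesis unfolding p(4) m_def d_def using Suc by (simp add: mult_ac)
      qed
    next
      show "0 \<le> m j" for j using d0[of "j - 1"] L_pos by (simp add: m_def)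
    qed
    then show ?thesis unfolding \<P>_def by (simp add: prod.lessThan_Suc_shift m_def del: prod.lessThan_Suc)
  qed
  define \<Delta> where "\<Delta> = (\<Prod>j<l. d j)"
  have \<Delta>0: "0 < \<Delta>" unfolding \<Delta>_def using d0 by (intro prod_pos) auto
  have \<P>_lower': "card A * (\<Delta> / (2 * L) ^ l) \<le> card \<P>"
    using \<P>_lower by (simp add: \<Delta>_def prod_dividef)
  have A_lower: "card T / (L * D {a}) \<le> card A"
  proof -
    obtain t where t: "t \<in> T" using T_nonempty by auto
    have "D {} / (L * D {a}) \<le> card A" using ext_lower[OF t, of a "{}"] abc by (simp add: A_ext[of t])
    moreover have "card T / (L * D {a}) \<le> D {} / (L * D {a})"
      using D_empty_ge D1 L_pos by (intro divide_right_mono) auto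
    ultimately show ?thesis by linarith
  qed
  have A0: "0 < real (card A)" using A_lower T0 D1 L_pos by (smt (verit, best) divide_pos_pos mult_pos_pos)
  note gP = greedyD[of _ S "Suc l", folded \<P>_def]
  have \<P>_set: "set w \<subseteq> V" "distinct w" "w ! 0 \<in> A" if "w \<in> \<P>" for w
  proof -
    have st: "w ! j \<notin> set (take j w)" "step (take j w) (w ! j)" if "j < Suc l" for j
      using gP(2)[OF \<open>w \<in> \<P>\<close> that] by (auto simp: S_def)
    show "set w \<subseteq> V" using st(2) stepV gP(1)[OF that] by (metis in_set_conv_nth subsetI)
    have "w ! i \<noteq> w ! j" if "i < j" "j < Suc l" for i j
    proof -
      have "w ! i \<in> set (take j w)"
        using that gP(1)[OF \<open>w \<in> \<P>\<close>] by (auto simp: in_set_conv_nth intro!: exI[of _ i])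
      then show ?thesis using st(1)[OF that(2)] by auto
    qed
    then show "distinct w" unfolding distinct_conv_nth using gP(1)[OF that] by (metis linorder_neqE_nat)
    show "w ! 0 \<in> A" using st(2)[of 0] by (auto simp: step_def A_def)
  qed
  have \<P>_tup: "\<exists>t\<in>T. t (p j) = w ! j \<and> t (p (Suc j)) = w ! Suc j" if "w \<in> \<P>" "j < l" for w j
  proof -
    have "step (take (Suc j) w) (w ! Suc j)" using gP(2)[OF that(1), of "Suc j"] that(2) by (simp add: S_def)
    moreover have "length (take (Suc j) w) = Suc j" "take (Suc j) w \<noteq> []" using gP(1)[OF that(1)] that(2) by auto
    ultimately show ?thesis by (simp add: step_def)
  qed
  have \<P>_adj: "successively adj w" if "w \<in> \<P>" for w
    unfolding successively_conv_nth
  proof (intro allI impI)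
    fix i assume "Suc i < length w"
    then obtain t where "t \<in> T" "t (p i) = w ! i" "t (p (Suc i)) = w ! Suc i"
      using \<P>_tup[OF \<open>w \<in> \<P>\<close>, of i] gP(1)[OF \<open>w \<in> \<P>\<close>] by auto
    then show "adj (w ! i) (w ! Suc i)" using adjI[of t "p i" "p (Suc i)"] p(1,2) by metis
  qed
  define Q where "Q = {(w, w') \<in> \<P> \<times> \<P>. (w ! 0, w ! l) = (w' ! 0, w' ! l)}"
  \<comment> \<open>Members of \<open>Q\<close> are closed walks of length 2 l. Each of the two
    paths already has distinct vertices, so only meetings between them remain to be
    excluded.\<close>
  define Good where "Good = {(w, w') \<in> Q. \<forall>i\<in>{1..<l}. w' ! i \<notin> set w}"
  have finQ: "finite Q" unfolding Q_def by (rule finite_subset[of _ "\<P> \<times> \<P>"]) (use fin\<P> in auto)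
  \<comment> \<open>There are at most \<open>card A * n\<close> pairs of ends, so Cauchy--Schwarz
    yields \<open>card \<P> * (card \<P> / (card A * n))\<close> pairs of paths with common ends;
    \<open>X\<close> is the lower bound for this quotient that \<open>\<P>_lower'\<close>
    provides.\<close>
  define X where "X = \<Delta> / ((2 * L) ^ l * n)"
  have X0: "0 < X" unfolding X_def using \<Delta>0 L_pos n by simp
  have Q_lower: "card \<P> * X \<le> card Q"
  proof -
    have "real (card \<P>) ^ 2 \<le> card (A \<times> V) * real (card Q)"
      unfolding Q_def
    proof (rule card_square_le_card_eq_pairs[OF fin\<P>])
      show "finite (A \<times> V)" using finA finite_V by auto
      show "(\<lambda>w. (w ! 0, w ! l)) ` \<P> \<subseteq> A \<times> V"
      proof (rule image_subsetI)
        fix w assume w: "w \<in> \<P>"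
        have "w ! l \<in> set w" using gP(1)[OF w] by simp
        then show "(w ! 0, w ! l) \<in> A \<times> V" using \<P>_set[OF w] by auto
      qed
    qed
    then have 1: "real (card \<P>) * card \<P> \<le> card A * n * real (card Q)"
      by (simp add: card_cartesian_product n_def power2_eq_square)
    have "card A * n * (card \<P> * X) = card \<P> * (card A * (\<Delta> / (2 * L) ^ l))"
      unfolding X_def using n by simp
    also have "\<dots> \<le> real (card \<P>) * real (card \<P>)" using \<P>_lower' by (intro mult_left_mono) auto
    also have "\<dots> \<le> card A * n * real (card Q)" using 1 by simp
    finally have "(card A * n) * (card \<P> * X) \<le> (card A * n) * card Q" .
    then show ?thesis using A0 n by (simp del: of_nat_mult)
  qed
  \<comment> \<open>A path from \<open>x\<close> has at most \<open>L ^ l * \<Delta>\<close>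
    continuations. The steps into the positions i and l have their targets prescribed, and each
    saves a factor \<open>L * d j\<close>, which is at least \<delta>.\<close>
  have bad1: "card {w' \<in> \<P>. w' ! 0 = x \<and> w' ! l = y \<and> w' ! i = z} \<le> L ^ l * \<Delta> / \<delta>\<^sup>2"
    if i: "1 \<le> i" "i < l" for x y z i
  proof -
    define R where "R us = {v. step us v \<and> (length us = 0 \<longrightarrow> v = x) \<and> (length us = l \<longrightarrow> v = y) \<and>
      (length us = i \<longrightarrow> v = z)}" for us
    have R_step: "R us \<subseteq> {z. step us z}" for us by (auto simp: R_def)
    have finR: "finite (R us)" for us by (rule finite_subset[OF R_step fin_step])
    define m where "m j = (if j \<in> {0, i, l} then 1 else L * d (j - 1))" for j
    have "card (greedy R (Suc l)) \<le> (\<Prod>j<Suc l. m j)"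
    proof (rule greedy_upper)
      fix j us assume j: "j < Suc l" and us: "us \<in> greedy R j"
      show "finite (R us)" by (rule finR)
      have len: "length us = j" using greedyD[OF us] by simp
      show "card (R us) \<le> m j"
      proof (cases "j \<in> {0, i, l}")
        case True
        then obtain v where "R us \<subseteq> {v}" using len by (auto simp: R_def)
        then have "card (R us) \<le> card {v}" by (intro card_mono) auto
        then show ?thesis using True by (simp add: m_def)
      next
        case False
        then obtain q where q: "j = Suc q" by (cases j) auto
        have us_q: "us ! q \<in> R (take q us)" using greedyD(2)[OF us, of q] q by simp
        obtain t where t: "t \<in> T" "t (p q) = us ! q" using step_tup[OF us R_step, of q] q by auto
        have "R us \<subseteq> ext T {p q} (p (Suc q)) t"
        proof
          fix v assume "v \<in> R us"
          moreover have "us \<noteq> []" using len q by auto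
          ultimately obtain y' where "y' \<in> T" "y' (p q) = us ! q" "y' (p (Suc q)) = v"
            using len q by (auto simp: R_def step_def)
          then show "v \<in> ext T {p q} (p (Suc q)) t" using t
            by (auto simp: ext_def fibre_def intro!: image_eqI[of _ _ y'])
        qed
        then have "real (card (R us)) \<le> card (ext T {p q} (p (Suc q)) t)"
          by (intro of_nat_mono card_mono finite_ext)
        also have "\<dots> \<le> L * D {p q} / D (insert (p (Suc q)) {p q})" by (rule ext_upper[OF t(1) p(5)])
        also have "\<dots> = m j" unfolding p(4) m_def d_def using False q by simp
        finally show ?thesis .
      qed
    qed (use L_pos d0 in \<open>auto simp: m_def less_imp_le\<close>)
    also have "(\<Prod>j<Suc l. m j) = (\<Prod>j<l. m (Suc j))"
      by (simp add: prod.lessThan_Suc_shift m_def del: prod.lessThan_Suc)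
    also have "\<dots> \<le> (\<Prod>j<l. (L * d j) * (if j \<in> {i - 1, l - 1} then 1 / \<delta> else 1))"
    proof (rule prod_mono, intro conjI)
      fix j assume "j \<in> {..<l}"
      then have iff: "Suc j \<in> {0, i, l} \<longleftrightarrow> j \<in> {i - 1, l - 1}" using i by auto
      have "\<delta> \<le> L * d j" using mult_mono[OF L_ge_1 \<delta>_d[of j]] \<delta>0 L_pos by simp
      then show "m (Suc j) \<le> (L * d j) * (if j \<in> {i - 1, l - 1} then 1 / \<delta> else 1)"
        unfolding m_def iff using \<delta>0 by simp
      show "0 \<le> m (Suc j)" unfolding m_def using L_pos d0[of j] by simp
    qed
    also have "\<dots> = (\<Prod>j<l. L * d j) * (\<Prod>j<l. if j \<in> {i - 1, l - 1} then 1 / \<delta> else 1)"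
      by (rule prod.distrib)
    also have "(\<Prod>j<l. L * d j) = L ^ l * \<Delta>" by (simp add: \<Delta>_def prod.distrib)
    also have "(\<Prod>j<l. if j \<in> {i - 1, l - 1} then 1 / \<delta> else 1) = (\<Prod>j\<in>{..<l} \<inter> {i - 1, l - 1}. 1 / \<delta>)"
      by (rule prod.inter_restrict[symmetric]) simp
    also have "{..<l} \<inter> {i - 1, l - 1} = {i - 1, l - 1}" using i by auto
    also have "(\<Prod>j\<in>{i - 1, l - 1}. 1 / \<delta>) = 1 / \<delta>\<^sup>2" using i by (simp add: power2_eq_square)
    finally have up: "card (greedy R (Suc l)) \<le> L ^ l * \<Delta> / \<delta>\<^sup>2" by simp
    have "{w' \<in> \<P>. w' ! 0 = x \<and> w' ! l = y \<and> w' ! i = z} \<subseteq> greedy R (Suc l)"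
    proof
      fix w assume w: "w \<in> {w' \<in> \<P>. w' ! 0 = x \<and> w' ! l = y \<and> w' ! i = z}"
      have "w ! j \<in> R (take j w)" if "j < Suc l" for j
      proof -
        have "step (take j w) (w ! j)" "length (take j w) = j" using gP[of w] w that by (auto simp: S_def)
        then show ?thesis using w by (auto simp: R_def)
      qed
      then show "w \<in> greedy R (Suc l)" using gP(1)[of w] w by (simp add: greedy_def)
    qed
    then have "card {w' \<in> \<P>. w' ! 0 = x \<and> w' ! l = y \<and> w' ! i = z} \<le> card (greedy R (Suc l))"
      by (intro card_mono finite_greedy finR)
    then show ?thesis using up by linarith
  qed
  \<comment> \<open>Union bound over the position i in the second path and j in the first. This is
    the place where \<delta>^2 must exceed n by a large factor:
    \<open>l * (l + 1) * L ^ l * \<Delta> / \<delta>\<^sup>2\<close> has to be at most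
    \<open>X / 2\<close>, and \<open>X\<close> contains a division by n.\<close>
  have bad: "card (Q - Good) \<le> card \<P> * X / 2"
  proof -
    define N where "N w i j = {w' \<in> \<P>. w' ! 0 = w ! 0 \<and> w' ! l = w ! l \<and> w' ! i = w ! j}" for w i j
    have "Q - Good \<subseteq> (\<Union>w\<in>\<P>. \<Union>i\<in>{1..<l}. \<Union>j<Suc l. {w} \<times> N w i j)"
    proof
      fix x assume x: "x \<in> Q - Good"
      obtain w w' where xw: "x = (w, w')" by (cases x)
      have wQ: "w \<in> \<P>" "w' \<in> \<P>" "w' ! 0 = w ! 0" "w' ! l = w ! l" using x xw by (auto simp: Q_def)
      obtain i where i: "i \<in> {1..<l}" "w' ! i \<in> set w" using x xw by (auto simp: Good_def)
      then obtain j where "j < Suc l" "w ! j = w' ! i" using gP(1)[OF wQ(1)] by (auto simp: in_set_conv_nth)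
      then show "x \<in> (\<Union>w\<in>\<P>. \<Union>i\<in>{1..<l}. \<Union>j<Suc l. {w} \<times> N w i j)"
        using wQ i(1) unfolding xw by (intro UN_I[of w] UN_I[of i] UN_I[of j]) (simp_all add: N_def)
    qed
    then have "card (Q - Good) \<le> card (\<Union>w\<in>\<P>. \<Union>i\<in>{1..<l}. \<Union>j<Suc l. {w} \<times> N w i j)"
      by (intro card_mono) (use fin\<P> in \<open>auto simp: N_def\<close>)
    also have "\<dots> \<le> (\<Sum>w\<in>\<P>. \<Sum>i\<in>{1..<l}. \<Sum>j<Suc l. card ({w} \<times> N w i j))"
      by (intro order_trans[OF card_UN_le] sum_mono order_refl) (use fin\<P> in auto)
    finally have "real (card (Q - Good)) \<le> real (\<Sum>w\<in>\<P>. \<Sum>i\<in>{1..<l}. \<Sum>j<Suc l. card ({w} \<times> N w i j))"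
      by (rule of_nat_mono)
    also have "\<dots> = (\<Sum>w\<in>\<P>. \<Sum>i\<in>{1..<l}. \<Sum>j<Suc l. real (card (N w i j)))"
      by (simp add: card_cartesian_product)
    also have "\<dots> \<le> (\<Sum>w\<in>\<P>. \<Sum>i\<in>{1..<l}. \<Sum>j<Suc l. L ^ l * \<Delta> / \<delta>\<^sup>2)"
      unfolding N_def by (intro sum_mono bad1) auto
    also have "\<dots> = card \<P> * (real (l - 1) * (real (Suc l) * (L ^ l * \<Delta> / \<delta>\<^sup>2)))" by simp
    also have "\<dots> \<le> card \<P> * (X / 2)"
    proof (rule mult_left_mono)
      have "real (l - 1) * (real (Suc l) * (L ^ l * \<Delta> / \<delta>\<^sup>2)) \<le> l * ((l + 1) * (L ^ l * \<Delta> / \<delta>\<^sup>2))"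
        using \<Delta>0 L_pos by (intro mult_mono) auto
      also have "\<dots> = l * (l + 1) * L ^ l * \<Delta> / \<delta>\<^sup>2" by (simp add: algebra_simps)
      also have "\<dots> \<le> X / 2"
      proof -
        have "L ^ (2 * l) \<le> L ^ (2 * l + 3)" using L_ge_1 by (intro power_increasing) auto
        then have "2 * l * (l + 1) * 2 ^ l * n * L ^ (2 * l) \<le> 4 * l * (l + 1) * 2 ^ l * n * L ^ (2 * l + 3)"
          using n L_pos by (intro mult_mono) auto
        also have "\<dots> \<le> \<delta>\<^sup>2" using \<delta> by (simp add: n_def mult_ac add_ac)
        finally have le: "2 * l * (l + 1) * 2 ^ l * n * L ^ (2 * l) \<le> \<delta>\<^sup>2" .
        have pw: "L ^ (2 * l) = L ^ l * L ^ l" by (simp add: mult_2 power_add)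
        have "2 * l * (l + 1) * (L ^ l * ((2 * L) ^ l * n)) \<le> \<delta>\<^sup>2"
          using le unfolding pw power_mult_distrib of_nat_mult of_nat_power of_nat_numeral
          by (simp only: mult_ac)
        then have "\<Delta> * (2 * l * (l + 1) * (L ^ l * ((2 * L) ^ l * n))) \<le> \<Delta> * \<delta>\<^sup>2"
          using \<Delta>0 by (intro mult_left_mono) auto
        then show ?thesis unfolding X_def using \<delta>0 n L_pos by (simp add: field_simps)
      qed
      finally show "real (l - 1) * (real (Suc l) * (L ^ l * \<Delta> / \<delta>\<^sup>2)) \<le> X / 2" .
    qed simp
    finally show ?thesis by simp
  qed
  have Good_lower: "card \<P> * X / 2 \<le> card Good"
  proof -
    have "Good \<subseteq> Q" by (auto simp: Good_def)
    then have "card Q = card (Q - Good) + card Good"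
      using finQ by (metis card_Diff_subset card_mono finite_subset le_add_diff_inverse2)
    then show ?thesis using Q_lower bad by linarith
  qed
  have Good_lower': "\<delta> ^ (2 * l) / (8 * L ^ 4 * (2 * L) ^ (2 * l)) \<le> card Good"
  proof -
    obtain l' where l': "l = Suc l'" using l by (cases l) auto
    have "\<delta> ^ l' \<le> (\<Prod>j<l'. d (Suc j))"
      using prod_mono[of "{..<l'}" "\<lambda>_. \<delta>" "\<lambda>j. d (Suc j)"] \<delta>_d \<delta>0 by auto
    moreover have \<Delta>_eq: "\<Delta> = d 0 * (\<Prod>j<l'. d (Suc j))"
      unfolding \<Delta>_def l' by (simp add: prod.lessThan_Suc_shift del: prod.lessThan_Suc)
    ultimately have \<Delta>1: "d 0 * \<delta> ^ l' \<le> \<Delta>" using d0[of 0] by (simp add: mult_left_mono)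
    have "\<delta> * \<delta> ^ l' \<le> d 0 * \<delta> ^ l'" using \<delta>_d[of 0] \<delta>0 by (intro mult_right_mono) auto
    then have \<Delta>2: "\<delta> ^ l \<le> \<Delta>" using \<Delta>1 l' by simp
    \<comment> \<open>Up to powers of \<open>L\<close>, \<open>card A * d 0\<close> is the number of
      \<open>ab\<close>-pairs, which is n \<delta> however uneven the two parts are. So one factor
      \<open>d 0\<close> is kept together with \<open>card A\<close>, and only the other 2 l - 1
      degrees are lowered to \<delta>.\<close>
    have key: "n * \<delta> / L \<le> card A * d 0"
    proof -
      have "n * \<delta> / L = card T / (L * D {a}) * d 0"
        unfolding \<delta>_def d_def p_def using n D1 L_pos by (simp add: n_def)
      also have "\<dots> \<le> card A * d 0" using A_lower d0[of 0] by (intro mult_right_mono) auto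
      finally show ?thesis .
    qed
    have "\<delta> ^ (2 * l) * (n / L) = (n * \<delta> / L) * \<delta> ^ l' * \<delta> ^ l"
      unfolding l' by (simp add: power_add[symmetric] mult_2)
    also have "\<dots> \<le> (card A * d 0) * \<delta> ^ l' * \<delta> ^ l"
      using key \<delta>0 by (intro mult_right_mono) auto
    also have "\<dots> = card A * (d 0 * \<delta> ^ l') * \<delta> ^ l" by simp
    also have "\<dots> \<le> card A * \<Delta> * \<Delta>"
      using \<Delta>1 \<Delta>2 \<delta>0 \<Delta>0 d0[of 0] by (intro mult_mono) auto
    finally have le: "\<delta> ^ (2 * l) / L \<le> card A * \<Delta> * \<Delta> / n" using n by (simp add: field_simps)
    have "\<delta> ^ (2 * l) / (8 * L ^ 4 * (2 * L) ^ (2 * l)) \<le> \<delta> ^ (2 * l) / L / (2 * (2 * L) ^ (2 * l))"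
    proof -
      have "L ^ 1 \<le> L ^ 4" using L_ge_1 by (intro power_increasing) auto
      then have "L * (2 * (2 * L) ^ (2 * l)) \<le> 8 * L ^ 4 * (2 * L) ^ (2 * l)"
        using L_pos by (simp add: mult_ac)
      then have "\<delta> ^ (2 * l) / (8 * L ^ 4 * (2 * L) ^ (2 * l)) \<le> \<delta> ^ (2 * l) / (L * (2 * (2 * L) ^ (2 * l)))"
        using L_pos \<delta>0 by (intro divide_left_mono) auto
      then show ?thesis by simp
    qed
    also have "\<dots> \<le> (card A * \<Delta> * \<Delta> / n) / (2 * (2 * L) ^ (2 * l))"
      using le L_pos by (intro divide_right_mono) auto
    also have "\<dots> = card A * (\<Delta> / (2 * L) ^ l) * X / 2"
    proof -
      define B where "B = (2 * L) ^ l"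
      have "(2 * L) ^ (2 * l) = B * B" unfolding B_def by (simp only: mult_2[of l] power_add)
      moreover have "0 < B" unfolding B_def using L_pos by simp
      ultimately show ?thesis unfolding X_def B_def[symmetric] using n by simp
    qed
    also have "\<dots> \<le> card \<P> * X / 2"
      using \<P>_lower' X0 by (intro divide_right_mono mult_right_mono) auto
    also note Good_lower
    finally show ?thesis .
  qed
  define Z where "Z = (\<lambda>(w, w'). {z. z \<notin> set w \<union> set w' \<and> adj (w ! 0) z \<and> adj z (w ! 1)})"
  \<comment> \<open>The cycle visits w_0, z, w_1, ..., w_l and returns along the inner vertices of
    \<open>w'\<close>, in all 2 + l + (l - 1) = 2 l + 1 vertices. The pieces have fixed lengths,
    which makes \<open>F\<close> injective.\<close>
  define F :: "('a list \<times> 'a list) \<times> 'a \<Rightarrow> 'a list" where "F = (\<lambda>((w, w'), z). w ! 0 # z # tl w @ rev (butlast (tl w')))"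
  have finZ: "finite (Z x)" for x
    by (rule finite_subset[OF _ finite_V]) (auto simp: Z_def split: prod.splits dest: adj_in_V)
  have finGood: "finite Good" using finQ by (rule finite_subset[rotated]) (auto simp: Good_def)
  have Z_lower: "D {a, b} / (2 * L * D {a, b, c}) \<le> card (Z x)" if x: "x \<in> Good" for x
  proof -
    obtain w w' where xw: "x = (w, w')" by (cases x)
    have w: "w \<in> \<P>" "w' \<in> \<P>" using x xw by (auto simp: Good_def Q_def)
    obtain t where t: "t \<in> T" "t a = w ! 0" "t b = w ! 1"
      using \<P>_tup[OF w(1), of 0] l by (auto simp: p_def)
    have cW: "card (set w \<union> set w') \<le> 2 * l + 2"
      using card_Un_le[of "set w" "set w'"] card_length[of w] card_length[of w'] gP(1) w by fastforce
    have "D {a, b} / (2 * L * D (insert c {a, b})) \<le> card (ext T {a, b} c t - (set w \<union> set w'))"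
      by (rule ext_avoid[OF t(1) _ _ _ cW]) (use K abc in \<open>auto simp: add.commute\<close>)
    moreover have "ext T {a, b} c t - (set w \<union> set w') \<subseteq> Z x"
    proof
      fix z assume z: "z \<in> ext T {a, b} c t - (set w \<union> set w')"
      then obtain y where y: "y \<in> T" "y a = t a" "y b = t b" "y c = z" by (auto simp: ext_def fibre_def)
      have "adj (y a) (y c)" "adj (y c) (y b)" using adjI[OF y(1)] abc by auto
      then show "z \<in> Z x" using z y t by (simp add: Z_def xw)
    qed
    then have "card (ext T {a, b} c t - (set w \<union> set w')) \<le> card (Z x)" by (intro card_mono finZ)
    moreover have "insert c {a, b} = {a, b, c}" by auto
    ultimately show ?thesis by simp
  qed
  have decomp: "\<exists>q s. w = w ! 0 # w ! 1 # q @ [w ! l] \<and> w' = w ! 0 # s @ [w ! l] \<and> length s = l - 1 \<and>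
      tl w = w ! 1 # q @ [w ! l] \<and> butlast (tl w') = s" if "(w, w') \<in> Good" for w w'
  proof -
    have w: "w \<in> \<P>" "w' \<in> \<P>" "w' ! 0 = w ! 0" "w' ! l = w ! l" using that by (auto simp: Good_def Q_def)
    have len: "length w = Suc l" "length w' = Suc l" using gP(1) w by auto
    have f1: "w = w ! 0 # tl w" "w' = w' ! 0 # tl w'" using len by (metis Suc_length_conv list.sel(3) nth_Cons_0)+
    have f2: "tl w = butlast (tl w) @ [w ! l]" "tl w' = butlast (tl w') @ [w' ! l]"
    proof -
      have "tl w \<noteq> []" "tl w' \<noteq> []" using len l by (metis One_nat_def Suc_1 Suc_inject Suc_le_D length_Suc_conv length_tl diff_Suc_1 list.size(3) nat.distinct(1))+
      moreover have "last (tl w) = w ! l" "last (tl w') = w' ! l" using len l calculation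
        by (auto simp: last_conv_nth nth_tl)
      ultimately show "tl w = butlast (tl w) @ [w ! l]" "tl w' = butlast (tl w') @ [w' ! l]"
        by (metis append_butlast_last_id)+
    qed
    have f3: "butlast (tl w) = w ! 1 # tl (butlast (tl w))"
    proof -
      have "length (butlast (tl w)) = l - 1" using len by simp
      then obtain x xs where xs: "butlast (tl w) = x # xs" using l by (cases "butlast (tl w)") auto
      have "w ! 1 = butlast (tl w) ! 0" using len l by (simp add: nth_butlast nth_tl)
      then show ?thesis using xs by simp
    qed
    have f4: "tl w = w ! 1 # tl (butlast (tl w)) @ [w ! l]" using f2(1) f3 by (metis append_Cons)
    show ?thesis
    proof (rule exI[of _ "tl (butlast (tl w))"], rule exI[of _ "butlast (tl w')"], intro conjI f4 refl)
      show "w = w ! 0 # w ! 1 # tl (butlast (tl w)) @ [w ! l]" using f1(1) f4 by metis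
      show "w' = w ! 0 # butlast (tl w') @ [w ! l]" using f1(2) f2(2) w(3,4) by metis
      show "length (butlast (tl w')) = l - 1" using len by simp
    qed
  qed
  have F_in: "F x \<in> joint_cycles (2 * l + 1)" if x: "x \<in> Sigma Good Z" for x
  proof -
    obtain w w' z where xw: "x = ((w, w'), z)" by (metis prod.collapse)
    have g: "(w, w') \<in> Good" and z: "z \<notin> set w" "z \<notin> set w'" "adj (w ! 0) z" "adj z (w ! 1)"
      using x xw by (auto simp: Z_def)
    have w: "w \<in> \<P>" "w' \<in> \<P>" using g by (auto simp: Good_def Q_def)
    have dis: "w' ! i \<notin> set w" if "i \<in> {1..<l}" for i using g that by (auto simp: Good_def)
    obtain q s where qs: "w = w ! 0 # w ! 1 # q @ [w ! l]" "w' = w ! 0 # s @ [w ! l]" "length s = l - 1"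
      "tl w = w ! 1 # q @ [w ! l]" "butlast (tl w') = s" using decomp[OF g] by blast
    define x0 x1 y where "x0 = w ! 0" "x1 = w ! 1" "y = w ! l"
    have W: "w = x0 # x1 # q @ [y]" "w' = x0 # s @ [y]" using qs unfolding x0_x1_y_def by metis+
    have "length w = Suc l" using gP(1) w by auto
    then have lq: "length q = l - 2" using W by simp
    have Fx: "F x = x0 # z # x1 # q @ y # rev s"
      using qs by (simp add: F_def xw x0_x1_y_def)
    have s_dis: "set s \<inter> set w = {}"
    proof -
      have "s ! j \<notin> set w" if "j < l - 1" for j
      proof -
        have "s ! j = w' ! Suc j" using W(2) that qs(3) by (simp add: nth_append)
        then show ?thesis using dis[of "Suc j"] that by auto
      qed
      then show ?thesis using qs(3) by (auto simp: in_set_conv_nth)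
    qed
    have dw: "distinct (x0 # x1 # q @ [y])" "distinct (x0 # s @ [y])"
      using \<P>_set(2)[OF w(1)] \<P>_set(2)[OF w(2)] W by simp_all
    have z': "z \<notin> set (x0 # x1 # q @ [y])" "z \<notin> set (x0 # s @ [y])" using z W by simp_all
    have s': "set s \<inter> set (x0 # x1 # q @ [y]) = {}" using s_dis W by simp
    have Fx1: "distinct (F x)" unfolding Fx using dw z' s' by auto
    have Fx2: "length (F x) = 2 * l + 1" unfolding Fx using lq qs(3) l by simp
    have Fx3: "set (F x) \<subseteq> V"
    proof -
      have "set w \<subseteq> V" "set w' \<subseteq> V" using \<P>_set w by auto
      moreover have "z \<in> V" using z adj_in_V by blast
      ultimately show ?thesis unfolding Fx using W by auto
    qed
    have aw: "successively adj ((x0 # x1 # q) @ [y])" "successively adj (x0 # s @ [y])"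
      using \<P>_adj[OF w(1)] \<P>_adj[OF w(2)] W by simp_all
    have "successively adj (rev (x0 # s @ [y]))"
      unfolding successively_rev using aw(2) by (rule successively_mono) (rule adj_sym)
    then have r1: "successively adj ((y # rev s) @ [x0])" by simp
    have "successively adj (y # rev s)" using r1 unfolding successively_append_iff by blast
    moreover have "successively adj (x1 # q)" "adj (last (x1 # q)) y"
      using aw(1) unfolding successively_append_iff by (simp_all add: successively_Cons)
    ultimately have "successively adj ((x1 # q) @ (y # rev s))" unfolding successively_append_iff by simp
    moreover have "adj x0 z" "adj z x1" using z by (simp_all add: x0_x1_y_def)
    ultimately have Fx4: "successively adj (F x)" unfolding Fx by simp
    have "adj (last (F x)) (hd (F x))"
    proof -
      have "adj (last (y # rev s)) x0" using r1 unfolding successively_append_iff by simp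
      then show ?thesis unfolding Fx by simp
    qed
    then show ?thesis using Fx1 Fx2 Fx3 Fx4 by (simp add: joint_cycles_def)
  qed
  have "inj_on F (Sigma Good Z)"
  proof (rule inj_onI)
    fix x x' assume x: "x \<in> Sigma Good Z" "x' \<in> Sigma Good Z" and eq: "F x = F x'"
    obtain w w' z v v' z' where xw: "x = ((w, w'), z)" "x' = ((v, v'), z')" by (metis prod.collapse)
    have g: "(w, w') \<in> Good" "(v, v') \<in> Good" using x xw by auto
    obtain q s where qs: "w = w ! 0 # w ! 1 # q @ [w ! l]" "w' = w ! 0 # s @ [w ! l]" "length s = l - 1"
      "tl w = w ! 1 # q @ [w ! l]" "butlast (tl w') = s" using decomp[OF g(1)] by blast
    obtain q1 s1 where qs1: "v = v ! 0 # v ! 1 # q1 @ [v ! l]" "v' = v ! 0 # s1 @ [v ! l]" "length s1 = l - 1"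
      "tl v = v ! 1 # q1 @ [v ! l]" "butlast (tl v') = s1" using decomp[OF g(2)] by blast
    have "w ! 0 # z # w ! 1 # q @ w ! l # rev s = v ! 0 # z' # v ! 1 # q1 @ v ! l # rev s1"
      using eq qs qs1 by (simp add: F_def xw)
    then have e: "w ! 0 = v ! 0" "z = z'" "w ! 1 = v ! 1" "q = q1 \<and> w ! l # rev s = v ! l # rev s1"
      using qs(3) qs1(3) by (simp_all add: append_eq_append_conv)
    have "w = v" "w' = v'" using qs(1,2) qs1(1,2) e by (metis list.inject rev_rev_ident)+
    then show "x = x'" using xw e by simp
  qed
  then have "card (Sigma Good Z) = card (F ` Sigma Good Z)" by (simp add: card_image)
  also have "\<dots> \<le> card (joint_cycles (2 * l + 1))"
    using F_in by (intro card_mono finite_joint_cycles) auto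
  finally have "card (Sigma Good Z) \<le> card (joint_cycles (2 * l + 1))" .
  moreover have "real (card (Sigma Good Z)) = (\<Sum>x\<in>Good. real (card (Z x)))"
    using finGood finZ by simp
  moreover have "(\<Sum>x\<in>Good. D {a, b} / (2 * L * D {a, b, c})) \<le> (\<Sum>x\<in>Good. real (card (Z x)))"
    by (rule sum_mono) (rule Z_lower)
  moreover have "\<delta> ^ (2 * l) / (8 * L ^ 4 * (2 * L) ^ (2 * l)) * (D {a, b} / (2 * L * D {a, b, c}))
      \<le> card Good * (D {a, b} / (2 * L * D {a, b, c}))"
    using Good_lower' D1 L_pos by (intro mult_right_mono) auto
  ultimately show ?thesis by simp
qed

end

section \<open>Comparison of the two counts on a logarithmic scale\<close>

lemma exists_minimizer:
  fixes f :: "'a \<Rightarrow> real"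
  assumes "finite S" "S \<noteq> {}"
  obtains x where "x \<in> S" "\<And>y. y \<in> S \<Longrightarrow> f x \<le> f y"
  using arg_min_if_finite[OF assms, of f] that by (meson not_less)

text \<open>The arithmetic of the fan case, where m, \<nu>, p, q stand for the logarithms of
  \<open>card T\<close>, n, \<open>P\<close>, \<open>L\<close>. The last hypothesis says that p is
  at least m - 3\<nu>/2 up to error terms. Substituting this leaves a surplus (2l - 2) x m, which m
  \<ge> (1 + 1/x) \<nu> trades for (2l - 2)(x + 1) \<nu>; what is left over is (l + (3/2 - l) x)
  \<nu>, nonnegative because x \<le> 1.\<close>

lemma ln_lower_fan:
  fixes x m \<nu> p q c' :: real
  assumes x: "0 < x" "x \<le> 1" and l: "2 \<le> (l::real)" and m: "(1 + 1 / x) * \<nu> \<le> m" and \<nu>: "0 \<le> \<nu>"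
    and p: "2 * (m - \<nu> - p) \<le> c' + (2 * l + 3) * q + \<nu>"
  shows "(2 * l + 1 + x) * m - (2 * l + 2 + 2 * x) * \<nu>
    \<le> m + (2 * l + (2 * l - 1) * x) * (p + c' / 2 + (l + 3 / 2) * q)"
proof -
  have "0 \<le> 2 * l + (2 * l - 1) * x" using x l by (intro add_nonneg_nonneg mult_nonneg_nonneg) auto
  then have "(2 * l + (2 * l - 1) * x) * (m - 3 / 2 * \<nu>)
      \<le> (2 * l + (2 * l - 1) * x) * (p + c' / 2 + (l + 3 / 2) * q)"
    using p by (intro mult_left_mono) (auto simp: algebra_simps)
  moreover have "(2 * l - 2) * x * ((1 + 1 / x) * \<nu>) \<le> (2 * l - 2) * x * m"
    using m x l by (intro mult_left_mono) auto
  moreover have "(2 * l - 2) * x * ((1 + 1 / x) * \<nu>) = (2 * l - 2) * (x + 1) * \<nu>"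
    using x by (simp add: field_simps)
  moreover have "0 \<le> (l + (3 / 2 - l) * x) * \<nu>"
  proof -
    have "l * x \<le> l" using x l by (simp add: mult_left_le)
    then have "0 \<le> l + (3 / 2 - l) * x" using x by (simp add: algebra_simps)
    then show ?thesis using \<nu> by simp
  qed
  ultimately show ?thesis by (simp add: algebra_simps)
qed

context regular_tuples
begin

text \<open>\<open>A\<close> collects the multiplicity from \<open>linear_cycle_copies_lower\<close>
  and the factor 2 r^r lost at each of the k edges, \<open>B\<close> is the logarithm of the
  constant in the threshold of \<open>joint_cycles_theta\<close>, and \<open>c1\<close>,
  \<open>c2\<close> are large enough for both cases. Positivity is stated separately because the
  logarithm of 0 copies carries no information.\<close>

lemma linear_cycle_copies_regular:
  fixes G :: "'a hypergraph" and l k :: nat and x A B c1 c2 :: real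
  defines "x \<equiv> 1 / (real r - 2)" and "k \<equiv> 2 * l + 1"
  assumes r: "3 \<le> r" and l: "2 \<le> l" and G: "rgraph r G" "verts G = V" "edge_sets \<subseteq> edges G"
    and K: "2 * L * real (k + r * k) * r * (real (card V) ^ (r - 1) * L\<^sup>2) \<le> card T"
  defines "A \<equiv> ln (real ((r * k) ^ k * k ^ k)) + real k * (ln 2 + real r * ln (real r))"
    and "B \<equiv> ln (4 * real l * (real l + 1) * 2 ^ l)"
  defines "c1 \<equiv> A + ln 8 + k * ln 2 + (2 * real l + (2 * real l - 1) * x) * B / 2"
    and "c2 \<equiv> 12 * real l + (2 * real l + (2 * real l - 1) * x) * (real l + 3 / 2)"
  shows "0 < card (copies (linear_cycle r k) G)"
    and "(real k + x) * ln (card T) - (2 * real l + 2 + 2 * x) * ln (card V) - c1 - c2 * ln L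
      \<le> ln (card (copies (linear_cycle r k) G))"
proof -
  have x: "0 < x" "x \<le> 1" using r by (auto simp: x_def)
  have n1: "1 \<le> card V" using card_V_pos r by (simp add: Suc_le_eq)
  have T0: "0 < real (card T)" using finite_T T_nonempty by (simp add: card_gt_0_iff)
  have L0: "0 \<le> ln L" using L_ge_1 by simp
  obtain ab where ab: "ab \<in> {..<r} \<times> {..<r} - Id"
    "\<And>y. y \<in> {..<r} \<times> {..<r} - Id \<Longrightarrow> D {fst ab, snd ab} \<le> D {fst y, snd y}"
  proof (rule exists_minimizer[of "{..<r} \<times> {..<r} - Id" "\<lambda>y. D {fst y, snd y}"])
    have "(0, 1) \<in> {..<r} \<times> {..<r} - Id" using r by auto
    then show "{..<r} \<times> {..<r} - Id \<noteq> {}" by blast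
  qed (auto intro: that)
  define a b where "a = fst ab" and "b = snd ab"
  have abr: "a < r" "b < r" "a \<noteq> b" using ab(1) by (auto simp: a_def b_def)
  define P where "P = D {a, b}"
  have Pmin: "P \<le> D {i, j}" if "i < r" "j < r" "i \<noteq> j" for i j
    using ab(2)[of "(i, j)"] that by (simp add: P_def a_def b_def)
  obtain c where c: "c \<in> {..<r} - {a, b}" "\<And>y. y \<in> {..<r} - {a, b} \<Longrightarrow> D (insert c {a, b}) \<le> D (insert y {a, b})"
  proof (rule exists_minimizer[of "{..<r} - {a, b}" "\<lambda>y. D (insert y {a, b})"])
    have "card {a, b} < card {..<r}" using r abr by simp
    then show "{..<r} - {a, b} \<noteq> {}" by (metis Diff_eq_empty_iff card_mono finite.emptyI finite_insert not_le)
  qed (auto intro: that)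
  define Q where "Q = D {a, b, c}"
  have abc: "a < r" "b < r" "c < r" "a \<noteq> b" "a \<noteq> c" "b \<noteq> c" using abr c(1) by auto
  have ins: "insert c {a, b} = {a, b, c}" by auto
  have PQ: "1 \<le> P" "1 \<le> Q" unfolding P_def Q_def using D_ge_1 abc by auto
  define E where "E = P / Q"
  have E0: "0 < E" unfolding E_def using PQ by simp
  \<comment> \<open>This is \<open>D_le_power\<close> for the pair \<open>{a, b}\<close> and the
    minimising \<open>c\<close>; taking the (r - 2)-th root leaves the error L^(1 + x), which is at
    most L^2.\<close>
  have lnE: "x * ln P - 2 * ln L \<le> ln E"
  proof -
    have "P / L \<le> (L * P / Q) ^ (r - card {a, b})"
      unfolding P_def Q_def using abc c(2) D_ge_1[of "{a, b, c}"] by (intro D_le_power) (auto simp: ins)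
    also have "r - card {a, b} = r - 2" using abc by simp
    finally have "ln (P / L) \<le> ln ((L * E) ^ (r - 2))"
      using PQ L_pos E0 by (intro ln_mono) (auto simp: E_def)
    then have "ln P - ln L \<le> (real r - 2) * (ln L + ln E)"
      using PQ L_pos E0 r by (simp add: ln_div ln_realpow ln_mult of_nat_diff)
    then have "x * (ln P - ln L) \<le> x * ((real r - 2) * (ln L + ln E))" using x by (intro mult_left_mono) auto
    also have "\<dots> = ln L + ln E" using r by (simp add: x_def)
    finally have "x * ln P - x * ln L - ln L \<le> ln E" by (simp add: algebra_simps)
    moreover have "x * ln L \<le> ln L" using x L0 mult_right_mono[of x 1 "ln L"] by simp
    ultimately show ?thesis by linarith
  qed
  have lnP: "ln (card T) - 2 * ln (card V) \<le> ln P"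
  proof -
    have "card T \<le> real (card V) ^ 2 * P" unfolding P_def using card_T_le[of "{a, b}"] abc by (simp add: power2_eq_square)
    then have "ln (card T) \<le> ln (real (card V) ^ 2 * P)" using T0 n1 PQ by (intro ln_mono) auto
    also have "\<dots> = 2 * ln (card V) + ln P" using n1 PQ by (simp add: ln_mult ln_realpow)
    finally show ?thesis by linarith
  qed
  \<comment> \<open>Since r - 1 = 1 + 1/x, this says that there are at least n^(r - 1) tuples, a
    weak form of \<open>K\<close>.\<close>
  have lnT: "(1 + 1 / x) * ln (card V) \<le> ln (card T)"
  proof -
    have "1 \<le> real (k + r * k)" "1 \<le> real r" using r by (auto simp: k_def)
    then have "1 * 1 * 1 * 1 * (real (card V) ^ (r - 1) * 1\<^sup>2) \<le> 2 * L * real (k + r * k) * r * (real (card V) ^ (r - 1) * L\<^sup>2)"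
      using L_ge_1 by (intro mult_mono power_mono) auto
    from order_trans[OF this K] have "real (card V) ^ (r - 1) \<le> real (card T)"
      unfolding mult_1 power_one mult_1_right .
    then have "ln (real (card V) ^ (r - 1)) \<le> ln (card T)" using n1 T0 by (intro ln_mono) auto
    then show ?thesis using n1 r by (simp add: ln_realpow x_def of_nat_diff)
  qed
  have Kb: "2 * L * real b' * (real (card V) ^ (r - 1) * L\<^sup>2) \<le> card T" if "b' \<le> k + r * k" for b' :: nat
  proof -
    have "2 * L * real b' * 1 * (real (card V) ^ (r - 1) * L\<^sup>2)
        \<le> 2 * L * real (k + r * k) * r * (real (card V) ^ (r - 1) * L\<^sup>2)"
      using L_pos r of_nat_mono[OF that, where 'a = real] by (intro mult_right_mono mult_mono) auto
    then show ?thesis using K by simp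
  qed
  define U where "U = joint_cycles k"
  define N where "N = card (copies (linear_cycle r k) G)"
  define m where "m = P / (2 * L * r ^ r)"
  have rr: "0 < real r ^ r" using r by simp
  have m0: "0 < m" unfolding m_def using PQ L_pos rr by simp
  have copies: "card U * m ^ k \<le> real ((r * k) ^ k * k ^ k) * N"
    unfolding N_def
  proof (rule linear_cycle_copies_lower[OF G(1) r _ G(3)])
    show "3 \<le> k" using l by (simp add: k_def)
    show "0 \<le> m" using m0 by simp
    fix us assume us: "us \<in> U"
    then show "length us = k \<and> distinct us \<and> set us \<subseteq> verts G" by (simp add: U_def joint_cycles_def G(2))
    fix j B' assume j: "j < k" and B': "finite B'" "card B' \<le> k + r * k" "us ! j \<notin> B'" "us ! (Suc j mod k) \<notin> B'"
    have "adj (us ! j) (us ! (Suc j mod k))"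
      using successively_cyclic[of adj us j] us j by (auto simp: U_def joint_cycles_def)
    from edges_through_adj[OF this B'(1,3,4,2) K Pmin]
    show "m \<le> card {e \<in> edge_sets. us ! j \<in> e \<and> us ! (Suc j mod k) \<in> e \<and> e \<inter> B' = {}}" unfolding m_def .
  qed
  define C0 where "C0 = real ((r * k) ^ k * k ^ k)"
  have "0 < k" by (simp add: k_def)
  then have C0: "0 < C0" unfolding C0_def using r by simp
  have A_eq: "A = ln C0 + real k * (ln 2 + real r * ln (real r))" by (simp add: A_def C0_def)
  have lnm: "ln (m ^ k) = k * (ln P - ln 2 - ln L - r * ln r)"
    using m0 PQ L_pos r rr unfolding m_def by (simp add: ln_realpow ln_div ln_mult)
  have concl: "0 < N \<and> ln u + k * ln P - k * ln L - A \<le> ln N" if u: "0 < u" "u \<le> card U" for u :: real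
  proof -
    have "0 \<le> m ^ k" using m0 by simp
    from order_trans[OF mult_right_mono[OF u(2) this] copies]
    have le: "u * m ^ k \<le> C0 * N" unfolding C0_def .
    have um: "0 < u * m ^ k" using u m0 by simp
    have N0: "0 < N" using le um by (cases "N = 0") auto
    have "ln (u * m ^ k) \<le> ln (C0 * N)" using le um by (intro ln_mono) (auto simp: C0 N0)
    then have "ln u + ln (m ^ k) \<le> ln C0 + ln N"
      using u m0 C0 N0 by (simp add: ln_mult)
    then show ?thesis using N0 unfolding lnm A_eq by (simp add: algebra_simps)
  qed
  define \<delta> where "\<delta> = card T / (card V * D {a, b})"
  have \<delta>0: "0 < \<delta>" unfolding \<delta>_def using T0 n1 PQ by (simp add: P_def)
  have ln\<delta>: "ln \<delta> = ln (card T) - ln (card V) - ln P"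
    unfolding \<delta>_def P_def[symmetric] using T0 n1 PQ by (simp add: ln_div ln_mult)
  have B0: "0 \<le> B"
  proof -
    have "(1 * 1) * 1 \<le> ((4 * real l) * (real l + 1)) * 2 ^ l" using l by (intro mult_mono) auto
    then show ?thesis unfolding B_def by (intro ln_ge_zero) simp
  qed
  have cx: "0 \<le> 2 * real l + (2 * real l - 1) * x" using x l by (intro add_nonneg_nonneg mult_nonneg_nonneg) auto
  have kr: "real k = 2 * real l + 1" by (simp add: k_def)
  have l2: "2 \<le> real l" using l by simp
  have "0 < N \<and> (real k + x) * ln (card T) - (2 * real l + 2 + 2 * x) * ln (card V) - c1 - c2 * ln L \<le> ln N"
  proof (cases "4 * real l * (real l + 1) * 2 ^ l * L ^ (2 * l + 3) * card V \<le> \<delta>\<^sup>2")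
    case True
    define u where "u = \<delta> ^ (2 * l) / (8 * L ^ 4 * (2 * L) ^ (2 * l)) * (P / (2 * L * Q))"
    have "u \<le> card U"
      unfolding u_def U_def k_def P_def Q_def \<delta>_def
    proof (rule joint_cycles_theta[OF abc l])
      show "2 * L * real (2 * l + 2) * (real (card V) ^ (r - 1) * L\<^sup>2) \<le> real (card T)"
        using Kb[of "2 * l + 2"] r by (simp add: k_def add.commute)
    qed (use True in \<open>simp add: \<delta>_def\<close>)
    moreover have u0: "0 < u" unfolding u_def using \<delta>0 PQ L_pos by simp
    moreover have "ln u = 2 * l * ln \<delta> - ln 8 - 4 * ln L - 2 * l * (ln 2 + ln L) + ln E - ln 2 - ln L"
    proof -
      have "u = \<delta> ^ (2 * l) / (8 * L ^ 4 * (2 * L) ^ (2 * l)) * (E / (2 * L))" by (simp add: u_def E_def)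
      moreover have "ln (16 :: real) = ln 2 + ln 8" using ln_mult[of 2 "8 :: real"] by simp
      ultimately show ?thesis using \<delta>0 E0 L_pos by (simp add: ln_mult ln_div ln_realpow algebra_simps)
    qed
    ultimately have "0 < N" and
      1: "2 * l * ln \<delta> - ln 8 - 4 * ln L - 2 * l * (ln 2 + ln L) + ln E - ln 2 - ln L + k * ln P - k * ln L - A \<le> ln N"
      using concl[of u] by auto
    \<comment> \<open>\<open>P\<close> enters with exponent -2 l from \<delta>, k from the edges and
      x from \<open>E\<close>. These add up to 1 + x, which is positive, so the lower bound for
      \<open>P\<close> may be inserted.\<close>
    have "(1 + x) * (ln (card T) - 2 * ln (card V)) \<le> (1 + x) * ln P" using lnP x by (intro mult_left_mono) auto
    moreover have "0 \<le> (2 * real l + (2 * real l - 1) * x) * B / 2" using cx B0 by simp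
    moreover have "0 \<le> (2 * real l + (2 * real l - 1) * x) * (real l + 3 / 2) * ln L" using cx L0 by simp
    moreover have "(4 * l + 8) * ln L \<le> 12 * real l * ln L" using l2 L0 by (intro mult_right_mono) auto
    ultimately show ?thesis using 1 lnE \<open>0 < N\<close> unfolding c1_def c2_def ln\<delta> kr
      by (simp add: algebra_simps add_divide_distrib diff_divide_distrib)
  next
    case False
    \<comment> \<open>Failure of the threshold bounds \<delta> from above, and hence
      \<open>P\<close> from below.\<close>
    have "(2 * real l + 1 + x) * ln (card T) - (2 * real l + 2 + 2 * x) * ln (card V)
      \<le> ln (card T) + (2 * real l + (2 * real l - 1) * x) * (ln P + B / 2 + (real l + 3 / 2) * ln L)"
    proof (rule ln_lower_fan[OF x l2 lnT])
      show "0 \<le> ln (real (card V))" using n1 by simp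
      have Lf: "0 < 4 * real l * (real l + 1) * 2 ^ l" using l by simp
      have "ln (\<delta>\<^sup>2) \<le> ln (4 * real l * (real l + 1) * 2 ^ l * L ^ (2 * l + 3) * card V)"
        using False \<delta>0 by (intro ln_mono) auto
      also have "\<dots> = B + (2 * l + 3) * ln L + ln (card V)"
        using n1 L_pos Lf l unfolding B_def by (simp add: ln_mult ln_realpow)
      finally show "2 * (ln (card T) - ln (card V) - ln P) \<le> B + (2 * real l + 3) * ln L + ln (card V)"
        using \<delta>0 by (simp add: ln_realpow ln\<delta>)
    qed
    note fan = this
    define u where "u = card T / (4 * L\<^sup>2 * P) * (P / (2 * L * Q)) ^ (k - 2)"
    have "u \<le> card U"
      unfolding u_def U_def P_def Q_def
    proof (rule joint_cycles_fan[OF abc])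
      show "3 \<le> k" using l by (simp add: k_def)
      show "2 * L * real k * (real (card V) ^ (r - 1) * L\<^sup>2) \<le> card T" by (rule Kb) simp
      show "D {a, b} \<le> D {a, c}" using Pmin[of a c] abc by (simp add: P_def)
      show "0 \<le> D {a, b}" using PQ by (simp add: P_def)
    qed simp
    moreover have u0: "0 < u" unfolding u_def using T0 PQ L_pos by simp
    moreover have "ln u = ln (card T) - ln 4 - 2 * ln L - ln P + (2 * real l - 1) * (ln E - ln 2 - ln L)"
    proof -
      have "E / (2 * L) = P / (2 * L * Q)" by (simp add: E_def mult_ac)
      then have "u = card T / (4 * L\<^sup>2 * P) * (E / (2 * L)) ^ (k - 2)" by (simp only: u_def)
      moreover have "real (k - 2) = 2 * real l - 1" using l by (simp add: k_def of_nat_diff)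
      ultimately show ?thesis using T0 PQ E0 L_pos by (simp add: ln_mult ln_div ln_realpow)
    qed
    ultimately have "0 < N" and
      1: "ln (card T) - ln 4 - 2 * ln L - ln P + (2 * real l - 1) * (ln E - ln 2 - ln L) + k * ln P - k * ln L - A \<le> ln N"
      using concl[of u] by auto
    \<comment> \<open>In the fan count \<open>P\<close> has exponent k - 1 + (2 l - 1) x = 2 l + (2
      l - 1) x, the coefficient that occurs in \<open>ln_lower_fan\<close>.\<close>
    have "(2 * real l - 1) * (x * ln P - 2 * ln L) \<le> (2 * real l - 1) * ln E"
      using lnE l2 by (intro mult_left_mono) auto
    moreover have "ln (card T) - ln 8 - 2 * ln L - ln P + (2 * real l - 1) * (ln E - ln L) - k * ln 2 + k * ln P
        - k * ln L - A \<le> ln N"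
    proof -
      have "(2 * real l - 1) * ln 2 \<le> k * ln (2 :: real)" by (intro mult_right_mono) (auto simp: k_def)
      moreover have "ln 4 \<le> ln (8 :: real)" by simp
      ultimately show ?thesis using 1 unfolding right_diff_distrib by linarith
    qed
    moreover have "8 * l * ln L \<le> 12 * real l * ln L" using l2 L0 by (intro mult_right_mono) auto
    ultimately show ?thesis using fan \<open>0 < N\<close> unfolding c1_def c2_def kr
      by (simp add: algebra_simps add_divide_distrib diff_divide_distrib)
  qed
  then show "0 < card (copies (linear_cycle r k) G)"
    "(real k + x) * ln (card T) - (2 * real l + 2 + 2 * x) * ln (card V) - c1 - c2 * ln L
      \<le> ln (card (copies (linear_cycle r k) G))"
    by (auto simp: N_def)
qed

end

section \<open>The lower bound for the number of copies\<close>

definition edge_tuples :: "nat \<Rightarrow> 'a hypergraph \<Rightarrow> (nat \<Rightarrow> 'a) set" where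
  "edge_tuples r G = {t \<in> {..<r} \<rightarrow>\<^sub>E verts G. inj_on t {..<r} \<and> t ` {..<r} \<in> edges G}"

lemma card_edges_le_edge_tuples:
  assumes "rgraph r G"
  shows "card (edges G) \<le> card (edge_tuples r G)" "card (edge_tuples r G) \<le> card (verts G) ^ r"
proof -
  have fin: "finite (verts G)" using assms by (simp add: rgraph_def)
  have finP: "finite ({..<r} \<rightarrow>\<^sub>E verts G)" using fin by (intro finite_PiE) auto
  have sub: "edge_tuples r G \<subseteq> {..<r} \<rightarrow>\<^sub>E verts G" by (auto simp: edge_tuples_def)
  have finT: "finite (edge_tuples r G)" by (rule finite_subset[OF sub finP])
  show "card (edge_tuples r G) \<le> card (verts G) ^ r"
    using card_mono[OF finP sub] by (simp add: card_PiE)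
  have "edges G \<subseteq> (\<lambda>t. t ` {..<r}) ` edge_tuples r G"
  proof
    fix e assume e: "e \<in> edges G"
    then have er: "e \<subseteq> verts G" "card e = r" using assms by (auto simp: rgraph_def)
    have "finite e" using er fin finite_subset by blast
    then obtain f where f: "bij_betw f {..<r} e"
      using finite_same_card_bij[of "{..<r}" e] er(2) by auto
    have "restrict f {..<r} \<in> edge_tuples r G" "restrict f {..<r} ` {..<r} = e"
      using f er(1) e by (auto simp: edge_tuples_def bij_betw_def inj_on_def)
    then show "e \<in> (\<lambda>t. t ` {..<r}) ` edge_tuples r G" by (metis image_eqI)
  qed
  then have "card (edges G) \<le> card ((\<lambda>t. t ` {..<r}) ` edge_tuples r G)"
    using finT by (intro card_mono) auto
  also have "\<dots> \<le> card (edge_tuples r G)" using finT by (rule card_image_le)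
  finally show "card (edges G) \<le> card (edge_tuples r G)" .
qed

text \<open>The shape of the error term: \<open>L\<close> is bounded by a constant times a fixed
  power of ln n, so \<open>ln L\<close> is bounded linearly in ln ln n, and dividing by ln n
  expresses the loss as a power of n.\<close>

lemma tendsto_ln_ln_over_ln:
  "(\<lambda>n. (a + b * (c + d * ln (ln (real n)))) / ln (real n)) \<longlonglongrightarrow> (0::real)"
proof -
  have ln_top: "filterlim (\<lambda>n. ln (real n)) at_top sequentially"
    by (rule filterlim_compose[OF ln_at_top filterlim_real_sequentially])
  have 1: "(\<lambda>n. ln (ln (real n)) / ln (real n)) \<longlonglongrightarrow> 0"
    by (rule filterlim_compose[OF ln_x_over_x_tendsto_0 ln_top])
  have 2: "(\<lambda>n. 1 / ln (real n)) \<longlonglongrightarrow> 0"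
    using tendsto_inverse_0_at_top[OF ln_top] by (simp add: inverse_eq_divide)
  have "(\<lambda>n. (a + b * c) * (1 / ln (real n)) + b * d * (ln (ln (real n)) / ln (real n))) \<longlonglongrightarrow> (a + b * c) * 0 + b * d * 0"
    by (intro tendsto_intros 1 2)
  then show ?thesis by (simp add: algebra_simps add_divide_distrib)
qed

text \<open>The vertex type is arbitrary because the bound is applied to tensor powers as well. Any
  s above x is allowed because the edge density is at most 1.\<close>

lemma linear_cycle_copies:
  fixes r l :: nat and s :: real
  defines "x \<equiv> 1 / (real r - 2)" and "k \<equiv> 2 * l + 1"
  assumes r: "3 \<le> r" and l: "2 \<le> l" and s: "x \<le> s"
  shows "\<exists>(C :: real) (\<epsilon> :: nat \<Rightarrow> real). \<epsilon> \<longlonglongrightarrow> 0 \<and>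
    (\<forall>\<^sub>F n in sequentially. \<forall>G :: 'a hypergraph.
       rgraph r G \<and> card (verts G) = n \<and>
       real (card (edges G)) \<ge> real n ^ (r - 1) * ln (real n) powr C \<longrightarrow>
       real (card (copies (linear_cycle r k) G)) \<ge>
         real n powr ((real r - 1) * real k - \<epsilon> n) * (real (card (edges G)) / real n ^ r) powr (real k + s))"
proof -
  define A where "A = ln (real ((r * k) ^ k * k ^ k)) + real k * (ln 2 + real r * ln (real r))"
  define B where "B = ln (4 * real l * (real l + 1) * 2 ^ l)"
  define c1 where "c1 = A + ln 8 + k * ln 2 + (2 * real l + (2 * real l - 1) * x) * B / 2"
  define c2 where "c2 = 12 * real l + (2 * real l + (2 * real l - 1) * x) * (real l + 3 / 2)"
  define h where "h = (2::nat) ^ r"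
  define a where "a = 2 ^ (r + 2) * (real r / ln 2 + 1) ^ h"
  define c0 where "c0 = 2 * real (k + r * k) * r"
  define \<epsilon> where "\<epsilon> n = (c1 + (c2 + (real k + x)) * (ln a + real h * ln (ln (real n)))) / ln (real n)" for n
  \<comment> \<open>\<open>K\<close> asks for c0 n^(r - 1) L^3 tuples, and one more \<open>L\<close>
    is lost in passing to the regular subsystem. Now L^4 is at most a^4 times the (4 h)-th power of
    ln n, and the additional 1 in the exponent absorbs the constant
    \<open>c0 * a ^ 4\<close>.\<close>
  define C where "C = real (4 * h + 1)"
  have x: "0 < x" "real r * x = 1 + 2 * x" using r by (auto simp: x_def field_simps)
  have c2: "0 \<le> c2" unfolding c2_def using x(1) l by (intro add_nonneg_nonneg mult_nonneg_nonneg) auto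
  have a0: "0 < a" unfolding a_def by (intro mult_pos_pos zero_less_power add_nonneg_pos) auto
  have "\<epsilon> \<longlonglongrightarrow> 0" unfolding \<epsilon>_def by (rule tendsto_ln_ln_over_ln)
  moreover have "\<forall>\<^sub>F n in sequentially. \<forall>G :: 'a hypergraph.
       rgraph r G \<and> card (verts G) = n \<and>
       real (card (edges G)) \<ge> real n ^ (r - 1) * ln (real n) powr C \<longrightarrow>
       real (card (copies (linear_cycle r k) G)) \<ge>
         real n powr ((real r - 1) * real k - \<epsilon> n) * (real (card (edges G)) / real n ^ r) powr (real k + s)"
  proof -
    have ln_top: "filterlim (\<lambda>n. ln (real n)) at_top sequentially"
      by (rule filterlim_compose[OF ln_at_top filterlim_real_sequentially])
    \<comment> \<open>This is the only demand on n. It does not involve \<open>G\<close>, so the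
      bound is uniform over all hypergraphs on n vertices.\<close>
    have "\<forall>\<^sub>F n in sequentially. max 1 (c0 * a ^ 4) \<le> ln (real n)"
      using ln_top unfolding filterlim_at_top by blast
    then show ?thesis
    proof eventually_elim
      case (elim n)
      have y1: "1 \<le> ln (real n)" and y2: "c0 * a ^ 4 \<le> ln (real n)" using elim by auto
      define y where "y = ln (real n)"
      note y1 = y1[folded y_def] and y2 = y2[folded y_def]
      have n1: "1 < n" using y1 unfolding y_def by (cases "n = 0"; cases "n = 1") auto
      have n0: "0 < real n" using n1 by simp
      show ?case
      proof (intro allI impI, elim conjE)
        fix G :: "'a hypergraph"
        assume G: "rgraph r G" and n: "card (verts G) = n"
          and e: "real (card (edges G)) \<ge> real n ^ (r - 1) * ln (real n) powr C"
        define L where "L = 2 ^ (r + 2) * (real r * log 2 (real n) + 1) ^ (2 ^ r)"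
        define e' where "e' = real (card (edges G))"
        have yC: "ln (real n) powr C = y ^ (4 * h) * y"
          using y1 unfolding C_def y_def[symmetric] by (subst powr_realpow) auto
        have L_le: "L \<le> a * y ^ h"
        proof -
          have "real r * log 2 (real n) + 1 = real r / ln 2 * y + 1" by (simp add: log_def y_def)
          also have "\<dots> \<le> (real r / ln 2 + 1) * y" using y1 by (simp add: algebra_simps)
          finally have "(real r * log 2 (real n) + 1) ^ h \<le> ((real r / ln 2 + 1) * y) ^ h"
            using n1 by (intro power_mono) auto
          then show ?thesis unfolding L_def a_def h_def by (simp add: power_mult_distrib)
        qed
        have L0: "0 < L" unfolding L_def using n1 by (intro mult_pos_pos zero_less_power add_nonneg_pos) auto
        have e0: "0 < e'"
        proof -
          have "0 < real n ^ (r - 1) * ln (real n) powr C" using n0 y1 yC by simp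
          then show ?thesis using e unfolding e'_def by linarith
        qed
        have eT: "e' \<le> card (edge_tuples r G)"
          using card_edges_le_edge_tuples(1)[OF G] by (simp add: e'_def)
        have "\<exists>S D. S \<subseteq> edge_tuples r G \<and> card (edge_tuples r G) \<le> L * card S
          \<and> regular_tuples r (verts G) S D L"
          unfolding L_def
        proof (rule exists_regular_subsystem)
          show "finite (verts G)" using G by (simp add: rgraph_def)
          show "edge_tuples r G \<noteq> {}" using eT e0 by (metis card.empty not_le of_nat_0)
        qed (use n n1 in \<open>auto simp: edge_tuples_def\<close>)
        then obtain S D where S: "S \<subseteq> edge_tuples r G" "card (edge_tuples r G) \<le> L * card S"
          and reg: "regular_tuples r (verts G) S D L" by blast
        interpret regular_tuples r "verts G" S D L by (rule reg)
        have eS: "e' \<le> L * card S" using eT S(2) by linarith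
        then have S0: "0 < real (card S)" using e0 L0 by (smt (verit) mult_nonneg_nonpos)
        have edges: "edge_sets \<subseteq> edges G" using S(1) by (auto simp: edge_sets_def edge_tuples_def)
        have K: "2 * L * real (k + r * k) * r * (real (card (verts G)) ^ (r - 1) * L\<^sup>2) \<le> card S"
        proof -
          have "L ^ 4 \<le> (a * y ^ h) ^ 4" using L_le L0 by (intro power_mono) auto
          also have "\<dots> = a ^ 4 * y ^ (4 * h)" by (simp add: power_mult_distrib power_mult[symmetric] mult.commute)
          finally have "c0 * L ^ 4 \<le> c0 * (a ^ 4 * y ^ (4 * h))"
            unfolding c0_def by (intro mult_left_mono) auto
          also have "\<dots> = y ^ (4 * h) * (c0 * a ^ 4)" by simp
          also have "\<dots> \<le> y ^ (4 * h) * y" using y2 y1 by (intro mult_left_mono) auto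
          finally have "real n ^ (r - 1) * (c0 * L ^ 4) \<le> real n ^ (r - 1) * (y ^ (4 * h) * y)"
            by (intro mult_left_mono) auto
          also have "\<dots> \<le> e'" using e unfolding yC e'_def .
          also have "\<dots> \<le> L * card S" by (rule eS)
          finally have "L * (2 * L * real (k + r * k) * r * (real n ^ (r - 1) * L\<^sup>2)) \<le> L * card S"
            by (simp add: c0_def power2_eq_square power4_eq_xxxx mult_ac)
          then show ?thesis using L0 n by simp
        qed
        define N where "N = real (card (copies (linear_cycle r k) G))"
        have N: "0 < N" "(real k + x) * ln (card S) - (2 * real l + 2 + 2 * x) * y - c1 - c2 * ln L \<le> ln N"
          using linear_cycle_copies_regular[OF r l G refl edges K[unfolded k_def]]
          unfolding N_def y_def n A_def B_def c1_def c2_def x_def k_def by simp_all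
        have lnL: "ln L \<le> ln a + h * ln y"
        proof -
          have "ln L \<le> ln (a * y ^ h)" using L_le L0 by (intro ln_mono) auto
          then show ?thesis using a0 y1 by (simp add: ln_mult ln_realpow)
        qed
        have "ln e' \<le> ln (L * card S)" using eS e0 by (intro ln_mono) auto
        then have lnS: "ln e' - ln L \<le> ln (card S)" using L0 S0 by (simp add: ln_mult)
        have "(real k + x) * (ln e' - ln L) \<le> (real k + x) * ln (card S)"
          using lnS x by (intro mult_left_mono) auto
        moreover have "(c2 + (real k + x)) * ln L \<le> (c2 + (real k + x)) * (ln a + h * ln y)"
          using lnL x c2 by (intro mult_left_mono) auto
        moreover have "\<epsilon> n * y = c1 + (c2 + (real k + x)) * (ln a + real h * ln y)"
          unfolding \<epsilon>_def y_def[symmetric] using y1 by simp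
        ultimately have lower: "(real k + x) * ln e' - (2 * real l + 2 + 2 * x) * y - \<epsilon> n * y \<le> ln N"
          using N(2) by (simp add: algebra_simps)
        define q where "q = e' / real n ^ r"
        have q0: "0 < q" unfolding q_def using e0 n0 by simp
        have "e' \<le> real n ^ r" using eT card_edges_le_edge_tuples(2)[OF G] n
          by (metis of_nat_le_iff of_nat_power order_trans)
        then have "q \<le> 1" unfolding q_def using n0 by simp
        have lnq: "ln q = ln e' - r * y" unfolding q_def y_def using e0 n0 by (simp add: ln_div ln_realpow)
        define R where "R = real n powr ((real r - 1) * real k - \<epsilon> n) * q powr (real k + s)"
        have R0: "0 < R" unfolding R_def using n0 q0 by simp
        have "ln R = ((real r - 1) * real k - \<epsilon> n) * y + (real k + s) * ln q"
          unfolding R_def y_def using n0 q0 by (simp add: ln_mult ln_powr)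
        \<comment> \<open>Here \<open>ln q\<close> is at most 0, so lowering the exponent from s to
          x can only increase the expression.\<close>
        also have "\<dots> \<le> ((real r - 1) * real k - \<epsilon> n) * y + (real k + x) * ln q"
          using s q0 \<open>q \<le> 1\<close> by (intro add_left_mono mult_right_mono_neg) auto
        also have "\<dots> = (real k + x) * ln e' - (real k + real r * x) * y - \<epsilon> n * y"
          unfolding lnq by (simp add: algebra_simps)
        also have "\<dots> = (real k + x) * ln e' - (2 * real l + 2 + 2 * x) * y - \<epsilon> n * y"
          unfolding x(2) k_def by simp
        also have "\<dots> \<le> ln N" by (rule lower)
        finally have "R \<le> N" using R0 N(1) by simp
        then show "real n powr ((real r - 1) * real k - \<epsilon> n) * (real (card (edges G)) / real n ^ r) powr (real k + s)
          \<le> real (card (copies (linear_cycle r k) G))"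
          unfolding R_def N_def q_def e'_def .
      qed
    qed
  qed
  ultimately show ?thesis by blast
qed

section \<open>The Sidorenko gap\<close>

text \<open>An isomorphism onto a copy, cut down to \<open>verts F\<close>, is a homomorphism whose
  image recovers the copy.\<close>

lemma card_copies_le_homs:
  assumes F: "finite (verts F)" "\<And>e. e \<in> edges F \<Longrightarrow> e \<subseteq> verts F" and G: "finite (verts G)"
  shows "card (copies F G) \<le> card (homs F G)"
proof -
  let ?S = "\<lambda>\<phi>. Hypergraph (\<phi> ` verts F) ((\<lambda>e. \<phi> ` e) ` edges F)"
  have fin: "finite (homs F G)"
    by (rule finite_subset[of _ "verts F \<rightarrow>\<^sub>E verts G"]) (auto simp: homs_def F G intro!: finite_PiE)
  have "copies F G \<subseteq> ?S ` homs F G"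
  proof
    fix S assume S: "S \<in> copies F G"
    then obtain f where f: "bij_betw f (verts F) (verts S)" "edges S = (\<lambda>e. f ` e) ` edges F"
      by (auto simp: copies_def isomorphic_def)
    define \<phi> where "\<phi> = restrict f (verts F)"
    have img: "\<phi> ` e = f ` e" if "e \<subseteq> verts F" for e using that by (auto simp: \<phi>_def)
    have sub: "verts S \<subseteq> verts G" "edges S \<subseteq> edges G" using S by (auto simp: copies_def subgraph_def)
    have e_eq: "(\<lambda>e. \<phi> ` e) ` edges F = (\<lambda>e. f ` e) ` edges F"
      by (rule image_cong[OF refl]) (rule img[OF F(2)])
    have "\<phi> ` verts F = verts S" using img[of "verts F"] f(1) by (simp add: bij_betw_def)
    then have "S = ?S \<phi>" using f(2) e_eq by (cases S) simp
    moreover have "\<phi> \<in> homs F G"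
      unfolding homs_def
    proof (intro CollectI conjI ballI)
      show "\<phi> \<in> verts F \<rightarrow>\<^sub>E verts G"
        unfolding \<phi>_def using f(1) sub(1) by (auto simp: bij_betw_def)
      show "\<phi> ` e \<in> edges G" if "e \<in> edges F" for e using that f(2) sub(2) img F(2) by auto
    qed
    ultimately show "S \<in> ?S ` homs F G" by blast
  qed
  then have "card (copies F G) \<le> card (?S ` homs F G)" using fin by (intro card_mono) auto
  also have "\<dots> \<le> card (homs F G)" by (rule card_image_le[OF fin])
  finally show ?thesis .
qed

text \<open>The \<open>N\<close>-th tensor power of \<open>H\<close> with every vertex blown up to \<open>b\<close> copies. The blow-up makes
  the number of vertices large compared with the inverse of the edge density.\<close>

definition tensor_blowup :: "nat \<Rightarrow> 'a hypergraph \<Rightarrow> nat \<Rightarrow> nat \<Rightarrow> ((nat \<Rightarrow> 'a) \<times> nat) hypergraph" where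
  "tensor_blowup r H N b = Hypergraph (({..<N} \<rightarrow>\<^sub>E verts H) \<times> {..<b})
     {e. e \<subseteq> ({..<N} \<rightarrow>\<^sub>E verts H) \<times> {..<b} \<and> card e = r \<and> (\<forall>i<N. (\<lambda>v. fst v i) ` e \<in> edges H)}"

lemma rgraph_tensor_blowup:
  assumes "finite (verts H)"
  shows "rgraph r (tensor_blowup r H N b)"
  using assms by (auto simp: rgraph_def tensor_blowup_def intro!: finite_PiE)

lemma card_verts_tensor_blowup:
  "card (verts (tensor_blowup r H N b)) = card (verts H) ^ N * b"
  by (simp add: tensor_blowup_def card_cartesian_product card_PiE)

text \<open>A map into the tensor power consists of N maps into \<open>H\<close> and a map into the
  levels of the blow-up. It is a homomorphism exactly if all N coordinate maps are, with no
  condition on the levels.\<close>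

lemma card_homs_tensor_blowup:
  assumes F: "finite (verts F)" "\<And>e. e \<in> edges F \<Longrightarrow> e \<subseteq> verts F \<and> card e = r"
    and H: "rgraph r H" and N: "0 < N"
  shows "card (homs F (tensor_blowup r H N b)) = card (homs F H) ^ N * b ^ card (verts F)"
proof -
  define f where "f \<phi> = (\<lambda>i\<in>{..<N}. \<lambda>v\<in>verts F. fst (\<phi> v) i, \<lambda>v\<in>verts F. snd (\<phi> v))"
    for \<phi> :: "'a \<Rightarrow> (nat \<Rightarrow> 'b) \<times> nat"
  define g where "g p = (\<lambda>v\<in>verts F. (\<lambda>i\<in>{..<N}. fst p i v, snd p v))"
    for p :: "(nat \<Rightarrow> 'a \<Rightarrow> 'b) \<times> ('a \<Rightarrow> nat)"
  let ?T = "tensor_blowup r H N b"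
  let ?P = "({..<N} \<rightarrow>\<^sub>E homs F H) \<times> (verts F \<rightarrow>\<^sub>E {..<b})"
  have vT: "verts ?T = ({..<N} \<rightarrow>\<^sub>E verts H) \<times> {..<b}" by (simp add: tensor_blowup_def)
  have "bij_betw f (homs F ?T) ?P"
  proof (rule bij_betw_byWitness[where f' = g])
    show "\<forall>\<phi>\<in>homs F ?T. g (f \<phi>) = \<phi>"
    proof
      fix \<phi> assume "\<phi> \<in> homs F ?T"
      then have \<phi>: "\<phi> \<in> verts F \<rightarrow>\<^sub>E verts ?T" by (simp add: homs_def)
      show "g (f \<phi>) = \<phi>"
      proof
        fix v show "g (f \<phi>) v = \<phi> v"
        proof (cases "v \<in> verts F")
          case True
          have "\<phi> v \<in> ({..<N} \<rightarrow>\<^sub>E verts H) \<times> {..<b}" using PiE_mem[OF \<phi> True] unfolding vT .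
          then have "fst (\<phi> v) \<in> {..<N} \<rightarrow>\<^sub>E verts H" unfolding mem_Times_iff by (rule conjunct1)
          then have "(\<lambda>i\<in>{..<N}. fst (\<phi> v) i) = fst (\<phi> v)" by (rule PiE_restrict)
          moreover have "g (f \<phi>) v = (\<lambda>i\<in>{..<N}. fst (\<phi> v) i, snd (\<phi> v))"
            using True by (simp add: f_def g_def cong: restrict_cong)
          ultimately show ?thesis by simp
        next
          case False
          then show ?thesis using \<phi> by (simp add: g_def PiE_arb[OF \<phi>])
        qed
      qed
    qed
    show "\<forall>p\<in>?P. f (g p) = p"
    proof
      fix p assume p: "p \<in> ?P"
      have "fst p \<in> {..<N} \<rightarrow>\<^sub>E homs F H" "snd p \<in> verts F \<rightarrow>\<^sub>E {..<b}" using p by auto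
      have "fst (f (g p)) i = fst p i" for i
      proof (cases "i < N")
        case True
        then have "fst p i \<in> homs F H" using PiE_mem[OF \<open>fst p \<in> {..<N} \<rightarrow>\<^sub>E homs F H\<close>] by simp
        then have "fst p i \<in> verts F \<rightarrow>\<^sub>E verts H" by (simp add: homs_def)
        then have "restrict (fst p i) (verts F) = fst p i" by (rule PiE_restrict)
        moreover have "fst (f (g p)) i = restrict (fst p i) (verts F)"
          using True by (auto simp: f_def g_def)
        ultimately show ?thesis by simp
      next
        case False
        then show ?thesis using p by (auto simp: f_def PiE_def extensional_def)
      qed
      moreover have "snd (f (g p)) = restrict (snd p) (verts F)" by (auto simp: f_def g_def)
      moreover have "restrict (snd p) (verts F) = snd p"
        using \<open>snd p \<in> verts F \<rightarrow>\<^sub>E {..<b}\<close> by (rule PiE_restrict)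
      ultimately show "f (g p) = p" by (auto simp: prod_eq_iff)
    qed
    show "f ` homs F ?T \<subseteq> ?P"
    proof (rule image_subsetI)
      fix \<phi> assume \<phi>: "\<phi> \<in> homs F ?T"
      then have \<phi>V: "\<phi> v \<in> ({..<N} \<rightarrow>\<^sub>E verts H) \<times> {..<b}" if "v \<in> verts F" for v
        using that by (auto simp: homs_def vT)
      have "(\<lambda>v\<in>verts F. fst (\<phi> v) i) \<in> homs F H" if i: "i < N" for i
        unfolding homs_def
      proof (intro CollectI conjI ballI)
        show "(\<lambda>v\<in>verts F. fst (\<phi> v) i) \<in> verts F \<rightarrow>\<^sub>E verts H"
        proof (rule restrict_PiE_iff[THEN iffD2], rule ballI)
          fix v assume "v \<in> verts F"
          from \<phi>V[OF this] show "fst (\<phi> v) i \<in> verts H" using i by (auto simp: mem_Times_iff)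
        qed
        fix e assume e: "e \<in> edges F"
        then have "\<phi> ` e \<in> edges ?T" using \<phi> by (simp add: homs_def)
        then have "(\<lambda>v. fst v i) ` \<phi> ` e \<in> edges H" using i by (simp add: tensor_blowup_def)
        moreover have "(\<lambda>v\<in>verts F. fst (\<phi> v) i) ` e = (\<lambda>v. fst v i) ` \<phi> ` e"
          unfolding image_image using F(2)[OF e] by (intro image_cong) auto
        ultimately show "(\<lambda>v\<in>verts F. fst (\<phi> v) i) ` e \<in> edges H" by simp
      qed
      moreover have "(\<lambda>v\<in>verts F. snd (\<phi> v)) \<in> verts F \<rightarrow>\<^sub>E {..<b}"
        using \<phi>V by (auto simp: mem_Times_iff)
      ultimately show "f \<phi> \<in> ?P" by (auto simp: f_def)
    qed
    show "g ` ?P \<subseteq> homs F ?T"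
    proof (rule image_subsetI)
      fix p assume p: "p \<in> ?P"
      have p1: "fst p i \<in> homs F H" if "i < N" for i using p that by auto
      have p2: "snd p v < b" if "v \<in> verts F" for v using p that by auto
      have gv: "g p v \<in> ({..<N} \<rightarrow>\<^sub>E verts H) \<times> {..<b}" if "v \<in> verts F" for v
        using p1 p2 that by (auto simp: g_def homs_def)
      show "g p \<in> homs F ?T"
        unfolding homs_def vT
      proof (intro CollectI conjI ballI)
        show "g p \<in> verts F \<rightarrow>\<^sub>E ({..<N} \<rightarrow>\<^sub>E verts H) \<times> {..<b}"
        proof (rule PiE_I)
          show "g p v \<in> ({..<N} \<rightarrow>\<^sub>E verts H) \<times> {..<b}" if "v \<in> verts F" for v using gv[OF that] .
        qed (simp add: g_def)
        fix e assume e: "e \<in> edges F"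
        note eF = F(2)[OF e]
        have proj: "(\<lambda>v. fst v i) ` g p ` e = fst p i ` e" if "i < N" for i
          unfolding image_image using eF that by (intro image_cong) (auto simp: g_def)
        have fine: "finite e" using eF F(1) finite_subset by blast
        \<comment> \<open>An edge of the tensor power must have r distinct vertices. A single
          coordinate already separates the images, because edges of \<open>H\<close> have r
          vertices; \<open>0 < N\<close> supplies such a coordinate.\<close>
        have "card (g p ` e) = r"
        proof (rule antisym)
          show "card (g p ` e) \<le> r" using card_image_le[OF fine, of "g p"] eF by simp
          have "fst p 0 ` e \<in> edges H" using p1[OF N] e by (simp add: homs_def)
          then have "r = card ((\<lambda>v. fst v 0) ` g p ` e)" using H proj[OF N] by (simp add: rgraph_def)
          also have "\<dots> \<le> card (g p ` e)" using fine by (intro card_image_le) auto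
          finally show "r \<le> card (g p ` e)" .
        qed
        moreover have "g p ` e \<subseteq> ({..<N} \<rightarrow>\<^sub>E verts H) \<times> {..<b}" using gv eF by blast
        moreover have "(\<lambda>v. fst v i) ` g p ` e \<in> edges H" if "i < N" for i
          unfolding proj[OF that] using p1[OF that] e by (simp add: homs_def)
        ultimately show "g p ` e \<in> edges ?T" by (simp add: tensor_blowup_def)
      qed
    qed
  qed
  then have "card (homs F ?T) = card ?P" by (rule bij_betw_same_card)
  then show ?thesis using F(1) by (simp add: card_cartesian_product card_PiE)
qed

section \<open>Edge densities and the limit along tensor powers\<close>

lemma card_homs_single_edge_le:
  assumes "rgraph r H"
  shows "card (homs (single_edge r) H) \<le> r ^ r * card (edges H)"
proof -
  have fin: "finite (verts H)" using assms by (simp add: rgraph_def)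
  have "edges H \<subseteq> Pow (verts H)" using assms by (auto simp: rgraph_def)
  then have finE: "finite (edges H)" using fin finite_subset by blast
  have finh: "finite (homs (single_edge r) H)"
    by (rule finite_subset[of _ "{..<r} \<rightarrow>\<^sub>E verts H"]) (auto simp: homs_def single_edge_def fin intro!: finite_PiE)
  have "card (homs (single_edge r) H) \<le> r ^ r * card ((\<lambda>\<phi>. \<phi> ` {..<r}) ` homs (single_edge r) H)"
  proof (rule card_le_mult_image[OF finh])
    fix e assume "e \<in> (\<lambda>\<phi>. \<phi> ` {..<r}) ` homs (single_edge r) H"
    then have "e \<in> edges H" by (auto simp: homs_def single_edge_def)
    then have e: "card e = r" "e \<subseteq> verts H" using assms by (auto simp: rgraph_def)
    then have "finite e" using fin finite_subset by blast
    note e = e(1) this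
    have "card {\<phi> \<in> homs (single_edge r) H. \<phi> ` {..<r} = e} \<le> card ({..<r} \<rightarrow>\<^sub>E e)"
      using e by (intro card_mono finite_PiE) (auto simp: homs_def single_edge_def)
    then show "card {\<phi> \<in> homs (single_edge r) H. \<phi> ` {..<r} = e} \<le> r ^ r" using e by (simp add: card_PiE)
  qed
  also have "\<dots> \<le> r ^ r * card (edges H)"
    using finE by (intro mult_left_mono card_mono) (auto simp: homs_def single_edge_def)
  finally show ?thesis .
qed

text \<open>Constant maps are not homomorphisms. Strictness makes ln \<tau> negative in
  \<open>sidorenko_gap_le\<close>, where cancelling it turns a lower bound for densities into an
  upper bound for s.\<close>

lemma hom_density_single_edge_less_1:
  assumes H: "rgraph r H" "verts H \<noteq> {}" and r: "2 \<le> r"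
  shows "hom_density (single_edge r) H < 1"
proof -
  have fin: "finite (verts H)" using H by (simp add: rgraph_def)
  obtain x where x: "x \<in> verts H" using H by auto
  have "(\<lambda>i\<in>{..<r}. x) \<notin> homs (single_edge r) H"
  proof
    assume "(\<lambda>i\<in>{..<r}. x) \<in> homs (single_edge r) H"
    then have "(\<lambda>i\<in>{..<r}. x) ` {..<r} \<in> edges H" by (auto simp: homs_def single_edge_def)
    moreover have "(\<lambda>i\<in>{..<r}. x) ` {..<r} = {x}" using r by (simp add: image_constant_conv lessThan_empty_iff)
    ultimately have "card {x} = r" using H(1) by (auto simp: rgraph_def)
    then show False using r by simp
  qed
  moreover have "(\<lambda>i\<in>{..<r}. x) \<in> {..<r} \<rightarrow>\<^sub>E verts H" using x by auto
  moreover have "homs (single_edge r) H \<subseteq> {..<r} \<rightarrow>\<^sub>E verts H" by (auto simp: homs_def single_edge_def)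
  ultimately have "homs (single_edge r) H \<subset> {..<r} \<rightarrow>\<^sub>E verts H" by blast
  then have "card (homs (single_edge r) H) < card ({..<r} \<rightarrow>\<^sub>E verts H)"
    using fin by (intro psubset_card_mono finite_PiE) auto
  then have "card (homs (single_edge r) H) < card (verts H) ^ r" by (simp add: card_PiE)
  then have "real (card (homs (single_edge r) H)) < real (card (verts H)) ^ r"
    by (metis of_nat_less_iff of_nat_power)
  then show ?thesis unfolding hom_density_def by (simp add: single_edge_def divide_less_eq)
qed

lemma eventually_power_dominates:
  fixes c d C :: real
  assumes d: "0 < d"
  shows "\<forall>\<^sub>F N in sequentially. c * (real N * d) powr C \<le> 2 ^ N"
proof -
  define m where "m = nat \<lceil>C\<rceil>"
  define a where "a = d / ln 2"
  define M where "M = \<bar>c\<bar> * a ^ m"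
  have a0: "0 < a" using d by (simp add: a_def)
  have M0: "0 \<le> M" using a0 by (simp add: M_def)
  have top: "filterlim (\<lambda>N. real N * ln 2) at_top sequentially"
    by (rule filterlim_at_top_mult_tendsto_pos[OF tendsto_const _ filterlim_real_sequentially]) simp
  have top': "filterlim (\<lambda>N. real N * d) at_top sequentially"
    by (rule filterlim_at_top_mult_tendsto_pos[OF tendsto_const d filterlim_real_sequentially])
  have "(\<lambda>N. (real N * ln 2) ^ m / exp (real N * ln 2)) \<longlonglongrightarrow> (0 :: real)"
    by (rule filterlim_compose[OF tendsto_power_div_exp_0 top])
  then have "\<forall>\<^sub>F N in sequentially. (real N * ln 2) ^ m / exp (real N * ln 2) < 1 / (M + 1)"
    by (rule order_tendstoD(2)) (use M0 in auto)
  moreover have "\<forall>\<^sub>F N in sequentially. 1 \<le> real N * d"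
    using top' unfolding filterlim_at_top by blast
  ultimately show ?thesis
  proof eventually_elim
    case (elim N)
    define y where "y = real N * ln 2"
    have ey: "exp y = 2 ^ N" by (simp add: y_def exp_of_nat_mult)
    have "(real N * d) powr C \<le> (real N * d) powr real m"
      using elim(2) by (intro powr_mono) (simp_all add: m_def real_nat_ceiling_ge)
    also have "\<dots> = (y * a) ^ m" using elim(2) by (simp add: powr_realpow y_def a_def)
    finally have "\<bar>c\<bar> * (real N * d) powr C \<le> M * y ^ m"
      by (simp add: M_def power_mult_distrib mult_left_mono mult_ac)
    also have "\<dots> \<le> (M + 1) * y ^ m" by (intro mult_right_mono) (auto simp: y_def)
    also have "\<dots> \<le> exp y"
      using elim(1) M0 unfolding y_def[symmetric] by (simp add: field_simps)
    finally have "\<bar>c\<bar> * (real N * d) powr C \<le> 2 ^ N" unfolding ey .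
    moreover have "c * (real N * d) powr C \<le> \<bar>c\<bar> * (real N * d) powr C" by (intro mult_right_mono) auto
    ultimately show ?case by linarith
  qed
qed

text \<open>The lower bound is applied with n = X^N. Homomorphism densities of the tensor powers are
  exact N-th powers, so after taking logarithms and dividing by N, the error \<epsilon> and the
  factor r^r between homomorphisms and edges vanish as N grows. What remains is
  \<open>(k + s0) * ln \<tau> \<le> ln \<theta>\<close>.\<close>

lemma sidorenko_gap_le:
  fixes F :: "'a hypergraph" and s0 :: real
  assumes F: "finite (verts F)" "verts F \<noteq> {}" "\<And>e. e \<in> edges F \<Longrightarrow> e \<subseteq> verts F \<and> card e = r" and r: "2 \<le> r"
    and lower: "\<exists>(C :: real) (\<epsilon> :: nat \<Rightarrow> real). \<epsilon> \<longlonglongrightarrow> 0 \<and>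
      (\<forall>\<^sub>F n in sequentially. \<forall>G :: ((nat \<Rightarrow> nat) \<times> nat) hypergraph.
         rgraph r G \<and> card (verts G) = n \<and>
         real (card (edges G)) \<ge> real n ^ (r - 1) * ln (real n) powr C \<longrightarrow>
         real (card (copies F G)) \<ge> real n powr (real (card (verts F)) - \<epsilon> n) *
           (real (card (edges G)) / real n ^ r) powr (real (card (edges F)) + s0))"
    and exponent: "0 \<le> real (card (edges F)) + s0"
  shows "sidorenko_gap r F \<le> ereal s0"
  unfolding sidorenko_gap_def
proof (rule Sup_least, clarify)
  fix s and H :: "nat hypergraph"
  assume H: "rgraph r H"
    and eq: "hom_density F H = hom_density (single_edge r) H powr (s + real (card (edges F)))"
    and pos: "0 < hom_density F H"
  define \<theta> where "\<theta> = hom_density F H"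
  define \<tau> where "\<tau> = hom_density (single_edge r) H"
  define v where "v = card (verts F)"
  define k where "k = real (card (edges F))"
  define W where "W = card (verts H)"
  have v0: "0 < v" using F by (simp add: v_def card_gt_0_iff)
  have W0: "0 < W"
  proof (rule ccontr)
    assume "\<not> 0 < W"
    then have "\<theta> = 0" using v0 by (simp add: \<theta>_def hom_density_def W_def v_def)
    then show False using pos by (simp add: \<theta>_def)
  qed
  have \<theta>0: "0 < \<theta>" using pos by (simp add: \<theta>_def)
  have "\<tau> \<noteq> 0" using eq pos by (auto simp: \<tau>_def)
  moreover have "0 \<le> \<tau>" by (simp add: \<tau>_def hom_density_def)
  ultimately have \<tau>0: "0 < \<tau>" by linarith
  have "verts H \<noteq> {}" using W0 by (auto simp: W_def)
  then have \<tau>1: "\<tau> < 1" unfolding \<tau>_def by (rule hom_density_single_edge_less_1[OF H _ r])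
  obtain C \<epsilon> where \<epsilon>: "\<epsilon> \<longlonglongrightarrow> 0" and low: "\<forall>\<^sub>F n in sequentially. \<forall>G :: ((nat \<Rightarrow> nat) \<times> nat) hypergraph.
         rgraph r G \<and> card (verts G) = n \<and>
         real (card (edges G)) \<ge> real n ^ (r - 1) * ln (real n) powr C \<longrightarrow>
         real (card (copies F G)) \<ge> real n powr (real v - \<epsilon> n) *
           (real (card (edges G)) / real n ^ r) powr (k + s0)"
    using lower unfolding v_def k_def by blast
  \<comment> \<open>Chosen to make \<tau> X \<ge> 2. With n = X^N, the blown-up power then has at
    least 2^N n^(r - 1) / r^r edges, which eventually beats the required power of ln n. Without the
    blow-up \<tau> W may be below 1, as for a single edge with r = 3.\<close>
  obtain b where b: "2 / \<tau> \<le> real b" using real_arch_simple by blast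
  have b2: "2 < real b"
  proof -
    have "2 < 2 / \<tau>" using \<tau>0 \<tau>1 by (simp add: field_simps)
    then show ?thesis using b by linarith
  qed
  define X where "X = W * b"
  have X2: "2 < X"
  proof -
    have "2 < b" using b2 by simp
    also have "b \<le> W * b" using W0 by simp
    finally show ?thesis by (simp add: X_def)
  qed
  have X\<tau>: "2 \<le> \<tau> * X"
  proof -
    have "2 \<le> \<tau> * real b" using b \<tau>0 by (simp add: field_simps)
    also have "\<dots> \<le> \<tau> * X"
      using \<tau>0 mult_right_mono[of 1 "real W" "real b"] W0 by (intro mult_left_mono) (auto simp: X_def)
    finally show ?thesis .
  qed
  have X_top: "filterlim (\<lambda>N. X ^ N) at_top sequentially"
    using X2 by (intro filterlim_subseq) (auto simp: strict_mono_def intro: power_strict_increasing)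
  have ev1: "\<forall>\<^sub>F N in sequentially. \<forall>G :: ((nat \<Rightarrow> nat) \<times> nat) hypergraph.
         rgraph r G \<and> card (verts G) = X ^ N \<and>
         real (card (edges G)) \<ge> real (X ^ N) ^ (r - 1) * ln (real (X ^ N)) powr C \<longrightarrow>
         real (card (copies F G)) \<ge> real (X ^ N) powr (real v - \<epsilon> (X ^ N)) *
           (real (card (edges G)) / real (X ^ N) ^ r) powr (k + s0)"
    using eventually_compose_filterlim[OF low X_top] .
  \<comment> \<open>As ln (X^N) = N ln X, a power of ln n is here only a power of N.\<close>
  have ev2: "\<forall>\<^sub>F N in sequentially. real r ^ r * (real N * ln (real X)) powr C \<le> 2 ^ N"
    using X2 by (intro eventually_power_dominates) simp
  have "\<forall>\<^sub>F N in sequentially. - \<epsilon> (X ^ N) * ln X + (k + s0) * (ln \<tau> - r * ln r * (1 / real N)) \<le> ln \<theta>"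
    using ev1 ev2 eventually_gt_at_top[of 0]
  proof eventually_elim
    case (elim N)
    define G where "G = tensor_blowup r H N (b ^ N)"
    have finH: "finite (verts H)" using H by (simp add: rgraph_def)
    have G: "rgraph r G" unfolding G_def by (rule rgraph_tensor_blowup[OF finH])
    have n: "card (verts G) = X ^ N"
      unfolding G_def card_verts_tensor_blowup W_def[symmetric] X_def by (simp add: power_mult_distrib)
    have homF: "real (card (homs F G)) = \<theta> ^ N * real (X ^ N) ^ v"
    proof -
      have "card (homs F G) = card (homs F H) ^ N * (b ^ N) ^ v"
        unfolding G_def v_def using F H elim by (intro card_homs_tensor_blowup) auto
      moreover have "real (card (homs F H)) = \<theta> * real W ^ v"
        using W0 by (simp add: \<theta>_def hom_density_def W_def v_def)
      ultimately show ?thesis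
        by (simp add: X_def power_mult_distrib power_mult[symmetric] mult.commute)
    qed
    have homK: "real (card (homs (single_edge r) G)) = \<tau> ^ N * real (X ^ N) ^ r"
    proof -
      have "card (homs (single_edge r) G) = card (homs (single_edge r) H) ^ N * (b ^ N) ^ card (verts (single_edge r))"
        unfolding G_def using H elim by (intro card_homs_tensor_blowup) (auto simp: single_edge_def)
      moreover have "real (card (homs (single_edge r) H)) = \<tau> * real W ^ r"
        using W0 by (simp add: \<tau>_def hom_density_def W_def single_edge_def)
      ultimately show ?thesis
        by (simp add: X_def single_edge_def power_mult_distrib power_mult[symmetric] mult.commute)
    qed
    define e where "e = real (card (edges G))"
    have rr: "0 < real r ^ r" using r by simp
    have XN: "0 < real (X ^ N)" using X2 by simp
    have "real (card (homs (single_edge r) G)) \<le> real (r ^ r * card (edges G))"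
      using card_homs_single_edge_le[OF G] by (rule of_nat_mono)
    then have e: "\<tau> ^ N * real (X ^ N) ^ r \<le> real r ^ r * e" unfolding homK e_def by simp
    have lnX: "ln (real (X ^ N)) = real N * ln X" using X2 by (simp add: ln_realpow)
    have "real (X ^ N) ^ (r - 1) * ln (real (X ^ N)) powr C \<le> e"
    proof -
      have "real r ^ r * ln (real (X ^ N)) powr C \<le> 2 ^ N" unfolding lnX using elim by simp
      also have "\<dots> \<le> (\<tau> * X) ^ N" using X\<tau> by (intro power_mono) auto
      also have "\<dots> = \<tau> ^ N * real (X ^ N)" by (simp add: power_mult_distrib)
      finally have "real (X ^ N) ^ (r - 1) * (real r ^ r * ln (real (X ^ N)) powr C)
          \<le> real (X ^ N) ^ (r - 1) * (\<tau> ^ N * real (X ^ N))" using XN by (intro mult_left_mono) auto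
      also have "\<dots> = \<tau> ^ N * real (X ^ N) ^ r" using r by (cases r) auto
      also have "\<dots> \<le> real r ^ r * e" by (rule e)
      finally have "real r ^ r * (real (X ^ N) ^ (r - 1) * ln (real (X ^ N)) powr C) \<le> real r ^ r * e"
        by (simp add: mult_ac)
      then show ?thesis using rr by simp
    qed
    then have "real (X ^ N) powr (real v - \<epsilon> (X ^ N)) * (e / real (X ^ N) ^ r) powr (k + s0) \<le> card (copies F G)"
      using elim(1) G n unfolding e_def by blast
    also have "\<dots> \<le> card (homs F G)"
      using F finH by (intro of_nat_mono card_copies_le_homs) (auto simp: G_def tensor_blowup_def intro!: finite_PiE)
    also have "\<dots> = \<theta> ^ N * real (X ^ N) ^ v" by (rule homF)
    finally have main: "real (X ^ N) powr (real v - \<epsilon> (X ^ N)) * (e / real (X ^ N) ^ r) powr (k + s0)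
      \<le> \<theta> ^ N * real (X ^ N) ^ v" .
    have e0: "0 < e"
    proof -
      have "0 < \<tau> ^ N * real (X ^ N) ^ r" using \<tau>0 XN by simp
      then have "0 < real r ^ r * e" using e by linarith
      then show ?thesis using rr by (simp add: zero_less_mult_iff)
    qed
    define Y where "Y = real N * ln X"
    define Z where "Z = real (X ^ N)"
    have Z: "0 < Z" "ln Z = Y" using XN lnX by (simp_all add: Z_def Y_def)
    have "ln (Z powr (real v - \<epsilon> (X ^ N)) * (e / Z ^ r) powr (k + s0)) \<le> ln (\<theta> ^ N * Z ^ v)"
      using main Z(1) e0 unfolding Z_def by (intro ln_mono) auto
    then have 1: "(real v - \<epsilon> (X ^ N)) * Y + (k + s0) * (ln e - r * Y) \<le> N * ln \<theta> + v * Y"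
      using Z e0 \<theta>0 by (simp add: ln_mult ln_div ln_powr ln_realpow)
    have "ln (\<tau> ^ N * Z ^ r) \<le> ln (real r ^ r * e)"
      using e \<tau>0 Z(1) unfolding Z_def by (intro ln_mono) auto
    then have 2: "N * ln \<tau> + r * Y \<le> r * ln r + ln e"
      using Z e0 \<tau>0 r by (simp add: ln_mult ln_realpow)
    have "(k + s0) * (N * ln \<tau> - r * ln r) \<le> (k + s0) * (ln e - r * Y)"
      using 2 exponent unfolding k_def by (intro mult_left_mono) auto
    then have "- \<epsilon> (X ^ N) * Y + (k + s0) * (N * ln \<tau> - r * ln r) \<le> N * ln \<theta>"
      using 1 by (simp add: algebra_simps)
    moreover have "N * (- \<epsilon> (X ^ N) * ln X + (k + s0) * (ln \<tau> - r * ln r * (1 / real N)))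
        = - \<epsilon> (X ^ N) * Y + (k + s0) * (N * ln \<tau> - N * (r * ln r * (1 / real N)))"
      by (simp only: Y_def algebra_simps)
    moreover have "N * (r * ln r * (1 / real N)) = r * ln r" using elim(3) by simp
    ultimately have "N * (- \<epsilon> (X ^ N) * ln X + (k + s0) * (ln \<tau> - r * ln r * (1 / real N))) \<le> N * ln \<theta>"
      by (simp only:)
    then show ?case using elim by simp
  qed
  moreover have "(\<lambda>N. - \<epsilon> (X ^ N) * ln X + (k + s0) * (ln \<tau> - r * ln r * (1 / real N)))
     \<longlonglongrightarrow> - 0 * ln X + (k + s0) * (ln \<tau> - r * ln r * 0)"
    by (intro tendsto_intros filterlim_compose[OF \<epsilon> X_top] lim_1_over_n)
  ultimately have "- 0 * ln X + (k + s0) * (ln \<tau> - r * ln r * 0) \<le> ln \<theta>"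
    by (intro tendsto_upperbound[where F = sequentially]) auto
  then have "(k + s0) * ln \<tau> \<le> ln \<theta>" by simp
  also have "ln \<theta> = (s + k) * ln \<tau>"
    unfolding \<theta>_def eq k_def[symmetric] \<tau>_def[symmetric] using \<tau>0 by (simp add: ln_powr)
  finally have "k + s0 \<ge> s + k" using \<tau>0 \<tau>1 by (simp add: mult_le_cancel_right)
  then show "ereal s \<le> ereal s0" by simp
qed

theorem theorem1p9:
  fixes r l :: nat
  assumes "r \<ge> 3" and "l \<ge> 2"
  shows "(\<exists>(C :: real) (\<epsilon> :: nat \<Rightarrow> real). \<epsilon> \<longlonglongrightarrow> 0 \<and>
           (\<forall>\<^sub>F n in sequentially. \<forall>G :: nat hypergraph.
              rgraph r G \<and> card (verts G) = n \<and>
              real (card (edges G)) \<ge> real n ^ (r - 1) * ln (real n) powr C \<longrightarrow>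
              real (card (copies (linear_cycle r (2 * l + 1)) G)) \<ge>
                real n powr ((real r - 1) * (2 * real l + 1) - \<epsilon> n) *
                (real (card (edges G)) / real n ^ r) powr
                  (2 * real l + 1 + (4 * real l - 1) / ((real r - 1) * (2 * real l + 1) - 3))))
         \<and> sidorenko_gap r (linear_cycle r (2 * l + 1)) \<le>
             ereal ((4 * real l - 1) / ((real r - 1) * (2 * real l + 1) - 3))"
proof -
  define s where "s = (4 * real l - 1) / ((real r - 1) * (2 * real l + 1) - 3)"
  have r3: "3 \<le> real r" and l2: "2 \<le> real l" using assms by auto
  have "2 * 5 \<le> (real r - 1) * (2 * real l + 1)" using r3 l2 by (intro mult_mono) auto
  then have den: "0 < (real r - 1) * (2 * real l + 1) - 3" by simp
  have "0 \<le> (2 * real l - 2) * (real r - 3)" using r3 l2 by (intro mult_nonneg_nonneg) auto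
  then have "(real r - 1) * (2 * real l + 1) - 3 \<le> (4 * real l - 1) * (real r - 2)"
    by (simp add: algebra_simps)
  then have s: "1 / (real r - 2) \<le> s" unfolding s_def using den r3 by (simp add: field_simps)
  have k: "real (2 * l + 1) = 2 * real l + 1" by simp
  \<comment> \<open>The vertex type stays free: it becomes the natural numbers for the first claim
    and the vertices of tensor powers for the second.\<close>
  note copies = linear_cycle_copies[OF assms s, unfolded k]
  let ?F = "linear_cycle r (2 * l + 1)"
  have F_eq: "?F = Hypergraph {..<(r - 1) * (2 * l + 1)} (cycle_edge (r - 1) (2 * l + 1) ` {..<2 * l + 1})"
    using assms by (intro linear_cycle_eq) auto
  have vF: "real (card (verts ?F)) = (real r - 1) * (2 * real l + 1)"
  proof -
    have "card (verts ?F) = (r - 1) * (2 * l + 1)" unfolding F_eq by simp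
    moreover have "real (r - 1) = real r - 1" using assms by (simp add: of_nat_diff)
    ultimately show ?thesis by (simp only: of_nat_mult k)
  qed
  have eF: "real (card (edges ?F)) = 2 * real l + 1"
    using card_edges_linear_cycle[OF assms(1), of "2 * l + 1"] by simp
  have "sidorenko_gap r ?F \<le> ereal s"
  proof (rule sidorenko_gap_le)
    show "finite (verts ?F)" unfolding F_eq by simp
    have "0 < (r - 1) * (2 * l + 1)" using assms by simp
    then have "0 \<in> verts ?F" unfolding F_eq by (simp only: hypergraph.sel lessThan_iff)
    then show "verts ?F \<noteq> {}" by blast
    show "e \<subseteq> verts ?F \<and> card e = r" if "e \<in> edges ?F" for e
      using that assms cycle_edge_subset[of _ "2 * l + 1" "r - 1"] card_cycle_edge[of _ "2 * l + 1" "r - 1"]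
      unfolding F_eq by auto
    show "2 \<le> r" using assms by simp
    show "0 \<le> real (card (edges ?F)) + s"
      unfolding eF s_def using den l2 by (intro add_nonneg_nonneg divide_nonneg_pos) auto
  qed (unfold vF eF, rule copies)
  then show ?thesis using copies unfolding s_def by blast
qed

end
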